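(* Let $m\ge3$ be an odd integer and $n=2m$. Let $f:[0,\infty)\to[0,\infty)$ be continuous with $\log(1+f(t))=O(t^\lambda)$ as $t\to\infty$, where $0<\lambda<1$. Let $u$ be a $C^{2m}$ nonnegative solution of $$0\le-\Delta^m u\le f(u)\quad\text{in }B_2(0)\setminus\{0\}\subset\mathbb{R}^n.$$ Then $u(x)=o\left(|x|^{-\frac{n-2}{1-\lambda}}\right)$ as $x\to0$.
   Context: $\Delta^m$ is the $m$-fold iterated Laplacian; $B_r(0)$ is the open ball of radius $r$ about the origin. *)

theory Defs
  imports "HOL-Analysis.Analysis" "HOL-Library.Landau_Symbols"
begin

definition partial :: "'a::euclidean_space \<Rightarrow> ('a \<Rightarrow> real) \<Rightarrow> 'a \<Rightarrow> real" where
  "partial i g x = deriv (\<lambda>t. g (x + t *\<^sub>R i)) 0"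

fun iter_partial :: "'a::euclidean_space list \<Rightarrow> ('a \<Rightarrow> real) \<Rightarrow> 'a \<Rightarrow> real" where
  "iter_partial [] g = g"
| "iter_partial (i # is) g = partial i (iter_partial is g)"

definition Ck_on :: "nat \<Rightarrow> 'a::euclidean_space set \<Rightarrow> ('a \<Rightarrow> real) \<Rightarrow> bool" where
  "Ck_on k S g \<longleftrightarrow>
     (\<forall>is. set is \<subseteq> Basis \<and> length is < k \<longrightarrow>
        (\<forall>i\<in>Basis. \<forall>x\<in>S. (\<lambda>t. iter_partial is g (x + t *\<^sub>R i)) differentiable (at 0))) \<and>
     (\<forall>is. set is \<subseteq> Basis \<and> length is \<le> k \<longrightarrow> continuous_on S (iter_partial is g))"

definition laplacian :: "('a::euclidean_space \<Rightarrow> real) \<Rightarrow> 'a \<Rightarrow> real" where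
  "laplacian g x = (\<Sum>i\<in>Basis. partial i (partial i g) x)"

end

theory Submission
  imports Defs
begin

text \<open>Write \<open>g = - \<Delta>\<^sup>m u \<ge> 0\<close> and \<open>n = 2m\<close>. Testing a cut-off of \<open>u\<close> against radial functions
  \<open>w \<ge> 0\<close> that vanish near 0, satisfy \<open>\<Delta>\<^sup>m w \<ge> 0\<close> and behave like \<open>|x|\<^sup>n\<^sup>-\<^sup>2\<close> away from 0 shows that
  \<open>|x|\<^sup>n\<^sup>-\<^sup>2 g\<close> is integrable near 0 and that the average of \<open>u\<close> over the annulus \<open>|x| ~ r\<close> is
  \<open>O(r\<^sup>2\<^sup>-\<^sup>n)\<close>. Since \<open>m\<close> is odd, \<open>ln (1/|x|)\<close> is a positive fundamental solution of \<open>- \<Delta>\<^sup>m\<close> up to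
  a constant; testing against a truncation of it at scale \<open>R ~ r\<close> gives
  \<open>u y \<le> C r\<^sup>2\<^sup>-\<^sup>n + C \<integral> ln (R/|x - y|) g x dx\<close>. Choose \<open>y\<close> near \<open>x\<^sub>0\<close> such that \<open>u \<le> 2 u y\<close> close to \<open>y\<close>,
  hence \<open>g \<le> exp (C (1 + (u y)\<^sup>\<lambda>))\<close> there. Splitting the integral at the radius where this bound on
  \<open>g\<close> becomes harmless costs a factor \<open>(u y)\<^sup>\<lambda>\<close>, so \<open>U = u y \<ge> u x\<^sub>0\<close> satisfies
  \<open>U \<le> C r\<^sup>2\<^sup>-\<^sup>n + o(1) r\<^sup>2\<^sup>-\<^sup>n U\<^sup>\<lambda>\<close>, and the sublinear term is absorbed.\<close>

section \<open>Partial derivatives and the Laplacian\<close>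

text \<open>Nothing is known about \<open>u\<close> at the puncture, so every integration by parts
  takes place on a compact subset of the punctured ball; this is why all test functions vanish near
  0 and no surface integrals appear. They are functions of a squared distance s: since n = 2m, the
  Laplacian then becomes 4 (s Q'' + m Q'), and test functions arise by solving this one-dimensional
  equation or by applying it to a logarithm. Adding \<delta> to |x - y|^2 keeps the logarithm smooth
  at its pole. The obstacle to a pointwise estimate is a circularity: the bound on g near a point
  involves u near that same point. The choice of y makes u comparable with U there, and the
  logarithm turns exp (C U^\<lambda>) into a mere factor U^\<lambda>. The inequality U \<le> \<eta>
  r^(2-n) U^\<lambda> solves to U \<le> (\<eta> r^(2-n))^(1/(1-\<lambda>)), which is the exponent
  claimed; the small o comes from \<eta>, the mass near 0 of the convergent integral of |x|^(n-2)
  g.\<close>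

lemma eventually_along_line:
  fixes S :: "'a::real_normed_vector set"
  assumes "open S" "x \<in> S"
  shows "\<forall>\<^sub>F t in nhds (0::real). x + t *\<^sub>R i \<in> S"
proof -
  have "((\<lambda>t. x + t *\<^sub>R i) \<longlongrightarrow> x + 0 *\<^sub>R i) (nhds (0::real))"
    by (intro tendsto_intros tendsto_ident_at filterlim_ident)
  then show ?thesis using assms by (auto dest!: topological_tendstoD)
qed

lemma partial_eqI:
  "((\<lambda>t. g (x + t *\<^sub>R i)) has_real_derivative D) (at 0) \<Longrightarrow> partial i g x = D"
  by (simp add: partial_def DERIV_imp_deriv)

lemma has_derivative_partial:
  "(\<lambda>t. g (x + t *\<^sub>R i)) differentiable (at 0) \<Longrightarrow>
    ((\<lambda>t. g (x + t *\<^sub>R i)) has_real_derivative partial i g x) (at 0)"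
  by (simp add: partial_def DERIV_deriv_iff_real_differentiable)

lemma directional_cong:
  fixes f g :: "'a::euclidean_space \<Rightarrow> real"
  assumes "open S" "x \<in> S" "\<And>y. y \<in> S \<Longrightarrow> f y = g y"
  shows "((\<lambda>t. f (x + t *\<^sub>R i)) has_real_derivative D) (at 0) \<longleftrightarrow>
         ((\<lambda>t. g (x + t *\<^sub>R i)) has_real_derivative D) (at 0)"
  using eventually_along_line[OF assms(1,2), of i]
  by (intro DERIV_cong_ev) (auto elim!: eventually_mono simp: assms(3))

lemma partial_cong:
  assumes "open S" "x \<in> S" "\<And>y. y \<in> S \<Longrightarrow> f y = g y"
  shows "partial i f x = partial i g x"
  unfolding partial_def
  using eventually_along_line[OF assms(1,2), of i]
  by (intro deriv_cong_ev) (auto elim!: eventually_mono simp: assms(3))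

lemma laplacian_cong:
  assumes "open S" "x \<in> S" "\<And>y. y \<in> S \<Longrightarrow> f y = g y"
  shows "laplacian f x = laplacian g x"
  unfolding laplacian_def
  using assms by (intro sum.cong refl partial_cong[OF assms(1)]) auto

lemma iter_laplacian_cong:
  assumes "open S" "x \<in> S" "\<And>y. y \<in> S \<Longrightarrow> f y = g y"
  shows "(laplacian ^^ k) f x = (laplacian ^^ k) g x"
  using assms(2)
proof (induction k arbitrary: x)
  case (Suc k)
  have "laplacian ((laplacian ^^ k) f) x = laplacian ((laplacian ^^ k) g) x"
    using Suc.IH by (rule laplacian_cong[OF assms(1) Suc.prems])
  then show ?case by simp
qed (simp add: assms)

lemma partial_const: "partial i (\<lambda>x. c) x = 0"
  by (simp add: partial_def)

lemma laplacian_zero: "laplacian (\<lambda>x. 0) = (\<lambda>x. 0)"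
  unfolding laplacian_def partial_def by auto

lemma iter_laplacian_zero: "(laplacian ^^ k) (\<lambda>x. 0) = (\<lambda>x. 0)"
  by (induction k) (auto simp: laplacian_zero)

section \<open>Recursive description of the classes C^k and their closure properties\<close>

lemma iter_partial_snoc: "iter_partial (is @ [j]) g = iter_partial is (partial j g)"
  by (induction "is") auto

lemma Ck_on_0: "Ck_on 0 S g \<longleftrightarrow> continuous_on S g"
  by (auto simp: Ck_on_def)

text \<open>\<open>iter_partial\<close> applies the head of the list last, so the derivative taken
  first is the last list element. Splitting lists at their end turns the definition into a recursion
  on k, which supports the inductions below.\<close>

lemma Ck_on_Suc:
  "Ck_on (Suc k) S g \<longleftrightarrow> continuous_on S g \<and>
     (\<forall>i\<in>Basis. (\<forall>x\<in>S. (\<lambda>t. g (x + t *\<^sub>R i)) differentiable (at 0)) \<and> Ck_on k S (partial i g))"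
  (is "?L \<longleftrightarrow> ?R")
proof
  assume L: ?L
  have d: "(\<lambda>t. iter_partial is g (x + t *\<^sub>R i)) differentiable (at 0)"
    if "set is \<subseteq> Basis" "length is < Suc k" "i \<in> Basis" "x \<in> S" for "is" and i x :: 'a
    using L that unfolding Ck_on_def by blast
  have c: "continuous_on S (iter_partial is g)"
    if "set is \<subseteq> Basis" "length is \<le> Suc k" for "is"
    using L that unfolding Ck_on_def by blast
  show ?R
  proof (intro conjI ballI)
    show "continuous_on S g" using c[of "[]"] by simp
    fix i :: 'a assume i: "i \<in> Basis"
    show "(\<lambda>t. g (x + t *\<^sub>R i)) differentiable (at 0)" if "x \<in> S" for x
      using d[of "[]" i x] i that by simp
    show "Ck_on k S (partial i g)"
      unfolding Ck_on_def iter_partial_snoc[symmetric]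
      by (intro conjI allI impI ballI d c) (use i in auto)
  qed
next
  assume R: ?R
  show ?L unfolding Ck_on_def
  proof (intro conjI allI impI ballI)
    fix "is" :: "'a list" and i x :: 'a
    assume a: "set is \<subseteq> Basis \<and> length is < Suc k" and i: "i \<in> Basis" and x: "x \<in> S"
    show "(\<lambda>t. iter_partial is g (x + t *\<^sub>R i)) differentiable (at 0)"
    proof (cases "is" rule: rev_cases)
      case Nil
      then show ?thesis using R i x by auto
    next
      case (snoc js j)
      then have "Ck_on k S (partial j g)" "set js \<subseteq> Basis" "length js < k" using R a by auto
      then show ?thesis unfolding snoc iter_partial_snoc Ck_on_def using i x by blast
    qed
  next
    fix "is" :: "'a list"
    assume a: "set is \<subseteq> Basis \<and> length is \<le> Suc k"
    show "continuous_on S (iter_partial is g)"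
    proof (cases "is" rule: rev_cases)
      case Nil
      then show ?thesis using R by auto
    next
      case (snoc js j)
      then have "Ck_on k S (partial j g)" "set js \<subseteq> Basis" "length js \<le> k" using R a by auto
      then show ?thesis unfolding snoc iter_partial_snoc Ck_on_def by blast
    qed
  qed
qed

lemma Ck_on_cong:
  assumes "open S" "\<And>x. x \<in> S \<Longrightarrow> f x = g x" "Ck_on k S f"
  shows "Ck_on k S g"
  using assms(2,3)
proof (induction k arbitrary: f g)
  case 0
  then show ?case by (simp add: Ck_on_0 cong: continuous_on_cong)
next
  case (Suc k)
  have "continuous_on S g"
    using Suc.prems by (simp add: Ck_on_Suc cong: continuous_on_cong)
  moreover have "(\<lambda>t. g (x + t *\<^sub>R i)) differentiable (at 0)" if "x \<in> S" "i \<in> Basis" for x i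
    using Suc.prems(2) that directional_cong[OF assms(1) that(1), of f g i] Suc.prems(1)
    unfolding Ck_on_Suc real_differentiable_def by blast
  moreover have "Ck_on k S (partial i g)" if "i \<in> Basis" for i
    using Suc.IH[of "partial i f" "partial i g"] partial_cong[OF assms(1), of _ f g i]
      Suc.prems that by (auto simp: Ck_on_Suc)
  ultimately show ?case by (auto simp: Ck_on_Suc)
qed

text \<open>An explicit formula \<open>g'\<close> agrees with \<open>partial i g\<close> only on
  \<open>S\<close>; the smoothness is carried over by congruence on that open set.\<close>

lemma Ck_on_SucI:
  assumes "open S" "continuous_on S g"
    and "\<And>i x. i \<in> Basis \<Longrightarrow> x \<in> S \<Longrightarrow>
           ((\<lambda>t. g (x + t *\<^sub>R i)) has_real_derivative g' i x) (at 0)"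
    and "\<And>i. i \<in> Basis \<Longrightarrow> Ck_on k S (g' i)"
  shows "Ck_on (Suc k) S g"
proof -
  have "Ck_on k S (partial i g)" if "i \<in> Basis" for i
    using Ck_on_cong[OF assms(1) _ assms(4)[OF that], of "partial i g"]
      partial_eqI[OF assms(3)[OF that]] by simp
  then show ?thesis
    using assms(2,3) unfolding Ck_on_Suc real_differentiable_def by blast
qed

lemma Ck_on_SucD:
  assumes "Ck_on (Suc k) S g"
  shows "continuous_on S g"
    and "\<And>i x. i \<in> Basis \<Longrightarrow> x \<in> S \<Longrightarrow>
           ((\<lambda>t. g (x + t *\<^sub>R i)) has_real_derivative partial i g x) (at 0)"
    and "\<And>i. i \<in> Basis \<Longrightarrow> Ck_on k S (partial i g)"
  using assms by (auto simp: Ck_on_Suc intro!: has_derivative_partial)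

lemma Ck_on_mono: "Ck_on k S g \<Longrightarrow> j \<le> k \<Longrightarrow> Ck_on j S g"
  unfolding Ck_on_def by auto

lemma Ck_on_subset: "Ck_on k S g \<Longrightarrow> T \<subseteq> S \<Longrightarrow> Ck_on k T g"
  unfolding Ck_on_def by (auto intro: continuous_on_subset)

lemma Ck_on_continuous: "Ck_on k S g \<Longrightarrow> continuous_on S g"
  using Ck_on_mono[of k S g 0] by (simp add: Ck_on_0)

lemma Ck_on_const: "open S \<Longrightarrow> Ck_on k S (\<lambda>x. c)"
proof (induction k arbitrary: c)
  case (Suc k)
  show ?case
    by (rule Ck_on_SucI[where g' = "\<lambda>_ _. 0"]) (use Suc in \<open>auto intro!: derivative_eq_intros\<close>)
qed (simp add: Ck_on_0)

lemma Ck_on_add: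
  assumes "open S" "Ck_on k S f" "Ck_on k S g"
  shows "Ck_on k S (\<lambda>x. f x + g x)"
  using assms(2,3)
proof (induction k arbitrary: f g)
  case 0
  then show ?case by (auto simp: Ck_on_0 intro: continuous_intros)
next
  case (Suc k)
  note f = Ck_on_SucD[OF Suc.prems(1)] and g = Ck_on_SucD[OF Suc.prems(2)]
  show ?case
    by (rule Ck_on_SucI[where g' = "\<lambda>i x. partial i f x + partial i g x"])
       (use assms(1) f g Suc.IH in \<open>auto intro!: continuous_intros derivative_intros\<close>)
qed

lemma Ck_on_sum:
  assumes "open S" "\<And>i. i \<in> I \<Longrightarrow> Ck_on k S (f i)"
  shows "Ck_on k S (\<lambda>x. \<Sum>i\<in>I. f i x)"
  using assms(2)
  by (induction I rule: infinite_finite_induct)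
     (auto intro: Ck_on_add Ck_on_const assms(1))

lemma Ck_on_mult:
  assumes "open S" "Ck_on k S f" "Ck_on k S g"
  shows "Ck_on k S (\<lambda>x. f x * g x)"
  using assms(2,3)
proof (induction k arbitrary: f g)
  case 0
  then show ?case by (auto simp: Ck_on_0 intro: continuous_intros)
next
  case (Suc k)
  note f = Ck_on_SucD[OF Suc.prems(1)] and g = Ck_on_SucD[OF Suc.prems(2)]
  have fk: "Ck_on k S f" and gk: "Ck_on k S g"
    using Suc.prems Ck_on_mono le_SucI by blast+
  show ?case
  proof (rule Ck_on_SucI[where g' = "\<lambda>i x. partial i f x * g x + partial i g x * f x"])
    fix i x assume "i \<in> (Basis :: 'a set)" "x \<in> S"
    then show "((\<lambda>t. f (x + t *\<^sub>R i) * g (x + t *\<^sub>R i)) has_real_derivative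
        partial i f x * g x + partial i g x * f x) (at 0)"
      using DERIV_mult[OF f(2) g(2), of i x i x] by simp
  qed (use assms(1) f g fk gk Suc.IH in \<open>auto intro!: continuous_intros Ck_on_add\<close>)
qed

lemma Ck_on_inner:
  assumes "open (S :: 'a::euclidean_space set)"
  shows "Ck_on k S (\<lambda>x. (x - a) \<bullet> b)"
proof (cases k)
  case 0
  then show ?thesis by (auto simp: Ck_on_0 intro!: continuous_intros)
next
  case (Suc j)
  show ?thesis unfolding Suc
    by (rule Ck_on_SucI[where g' = "\<lambda>i x. i \<bullet> b"])
       (auto intro!: continuous_intros Ck_on_const assms derivative_eq_intros
         simp: inner_add_left inner_diff_left)
qed

lemma Ck_on_norm_squared:
  assumes "open (S :: 'a::euclidean_space set)"
  shows "Ck_on k S (\<lambda>x. (x - a) \<bullet> (x - a))"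
proof -
  have "Ck_on k S (\<lambda>x. \<Sum>b\<in>Basis. ((x - a) \<bullet> b) * ((x - a) \<bullet> b))"
    by (intro Ck_on_sum Ck_on_mult Ck_on_inner assms)
  then show ?thesis by (subst euclidean_inner)
qed

text \<open>A tower of named derivatives: \<open>D 0\<close> is the function and \<open>D j\<close>
  its j-th derivative on \<open>T\<close>. The profiles below are glued from pieces or defined by
  integrals, where explicit derivatives are handier than iterating \<open>deriv\<close>.\<close>

definition deriv_chain :: "nat \<Rightarrow> real set \<Rightarrow> (nat \<Rightarrow> real \<Rightarrow> real) \<Rightarrow> bool" where
  "deriv_chain k T D \<longleftrightarrow>
     (\<forall>j<k. \<forall>s\<in>T. (D j has_real_derivative D (Suc j) s) (at s)) \<and> continuous_on T (D k)"

lemma deriv_chain_continuous: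
  assumes "deriv_chain k T D" "j \<le> k"
  shows "continuous_on T (D j)"
proof (cases "j = k")
  case False
  then show ?thesis using assms unfolding deriv_chain_def
    by (intro DERIV_continuous_on[where D="D (Suc j)"]) (auto intro: has_field_derivative_at_within)
qed (use assms in \<open>auto simp: deriv_chain_def\<close>)

text \<open>Induction on k for all towers at once: the derivative of \<open>D 0 (g x)\<close> is
  \<open>D 1 (g x) * partial i g x\<close>, whose first factor has the same form for the tower
  shifted by one.\<close>

lemma Ck_on_compose:
  assumes "open S" "deriv_chain k T D" "Ck_on k S g" "\<And>x. x \<in> S \<Longrightarrow> g x \<in> T"
  shows "Ck_on k S (\<lambda>x. D 0 (g x))"
  using assms(2,3)
proof (induction k arbitrary: D)
  case 0
  then show ?case using assms(4)
    by (auto simp: Ck_on_0 deriv_chain_def intro: continuous_on_compose2)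
next
  case (Suc k)
  note g = Ck_on_SucD[OF Suc.prems(2)]
  have D: "(D 0 has_real_derivative D (Suc 0) s) (at s)" if "s \<in> T" for s
    using Suc.prems(1) that by (auto simp: deriv_chain_def)
  have "deriv_chain k T (\<lambda>j. D (Suc j))"
    using Suc.prems(1) by (auto simp: deriv_chain_def)
  moreover have gk: "Ck_on k S g" using Suc.prems(2) Ck_on_mono le_SucI by blast
  ultimately have 1: "Ck_on k S (\<lambda>x. D (Suc 0) (g x))" using Suc.IH by blast
  show ?case
  proof (rule Ck_on_SucI[where g' = "\<lambda>i x. D (Suc 0) (g x) * partial i g x"])
    show "continuous_on S (\<lambda>x. D 0 (g x))"
      using deriv_chain_continuous[OF Suc.prems(1), of 0] g(1) assms(4)
      by (auto intro: continuous_on_compose2)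
    fix i x assume "i \<in> (Basis :: 'a set)" "x \<in> S"
    then show "((\<lambda>t. D 0 (g (x + t *\<^sub>R i))) has_real_derivative D (Suc 0) (g x) * partial i g x) (at 0)"
      using DERIV_chain2[OF _ g(2), of "D 0" "D (Suc 0) (g x)" x i] D assms(4) by simp
  qed (use assms(1) 1 g in \<open>auto intro!: Ck_on_mult\<close>)
qed

lemma Ck_on_laplacian:
  assumes "open S" "Ck_on (Suc (Suc k)) S g"
  shows "Ck_on k S (laplacian g)"
proof -
  have "Ck_on k S (\<lambda>x. \<Sum>i\<in>Basis. partial i (partial i g) x)"
    using assms by (intro Ck_on_sum) (auto dest: Ck_on_SucD(3))
  then show ?thesis by (simp add: laplacian_def[abs_def])
qed

lemma Ck_on_iter_laplacian:
  assumes "open S" "Ck_on (2 * k + j) S g"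
  shows "Ck_on j S ((laplacian ^^ k) g)"
  using assms(2)
proof (induction k arbitrary: j)
  case (Suc k)
  have "Ck_on (2 * k + Suc (Suc j)) S g" using Suc.prems by simp
  then show ?case using Suc.IH Ck_on_laplacian[OF assms(1)] by simp
qed simp

text \<open>Using s = |x - a|^2 instead of |x - a| keeps the formula valid at the centre a. Along i,
  s has first derivative 2 (x - a) \<bullet> i and second derivative 2, whence the terms 4 s D'' and
  2 n D'.\<close>

lemma laplacian_radial:
  fixes a :: "'a::euclidean_space"
  assumes "open S" "deriv_chain 2 T D" "\<And>x. x \<in> S \<Longrightarrow> (x - a) \<bullet> (x - a) \<in> T" "x \<in> S"
  defines "s \<equiv> (x - a) \<bullet> (x - a)"
  shows "laplacian (\<lambda>x. D 0 ((x - a) \<bullet> (x - a))) x = 4 * s * D 2 s + 2 * real DIM('a) * D 1 s"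
proof -
  have D: "(D 0 has_real_derivative D 1 s) (at s)" "(D 1 has_real_derivative D 2 s) (at s)"
    if "s \<in> T" for s using assms(2) that by (auto simp: deriv_chain_def numeral_2_eq_2)
  have sq: "((\<lambda>t. (x + t *\<^sub>R i - a) \<bullet> (x + t *\<^sub>R i - a)) has_real_derivative 2 * ((x - a) \<bullet> i)) (at 0)"
    for x i :: 'a
  proof -
    have "(\<lambda>t. (x + t *\<^sub>R i - a) \<bullet> (x + t *\<^sub>R i - a)) =
        (\<lambda>t. (x - a) \<bullet> (x - a) + 2 * t * ((x - a) \<bullet> i) + t\<^sup>2 * (i \<bullet> i))"
    proof
      fix t :: real
      have "x + t *\<^sub>R i - a = (x - a) + t *\<^sub>R i" by simp
      then show "(x + t *\<^sub>R i - a) \<bullet> (x + t *\<^sub>R i - a) =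
          (x - a) \<bullet> (x - a) + 2 * t * ((x - a) \<bullet> i) + t\<^sup>2 * (i \<bullet> i)"
        by (simp only: inner_add_left inner_add_right inner_scaleR_left inner_scaleR_right
            inner_commute[of i "x - a"] power2_eq_square) (simp add: algebra_simps)
    qed
    then show ?thesis by (auto intro!: derivative_eq_intros)
  qed
  have p1: "((\<lambda>t. D 0 ((x + t *\<^sub>R i - a) \<bullet> (x + t *\<^sub>R i - a))) has_real_derivative
     D 1 ((x - a) \<bullet> (x - a)) * (2 * ((x - a) \<bullet> i))) (at 0)" if "x \<in> S" for x i
    using DERIV_chain2[OF _ sq, of "D 0" "D 1 ((x - a) \<bullet> (x - a))"] D(1) assms(3)[OF that] by simp
  have p2: "partial i (partial i (\<lambda>x. D 0 ((x - a) \<bullet> (x - a)))) x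
     = D 2 s * (2 * ((x - a) \<bullet> i))\<^sup>2 + 2 * D 1 s" if i: "i \<in> Basis" for i
  proof -
    have "partial i (partial i (\<lambda>x. D 0 ((x - a) \<bullet> (x - a)))) x
       = partial i (\<lambda>x. D 1 ((x - a) \<bullet> (x - a)) * (2 * ((x - a) \<bullet> i))) x"
      using partial_eqI[OF p1] by (intro partial_cong[OF assms(1,4)]) auto
    also have "\<dots> = (D 2 s * (2 * ((x - a) \<bullet> i))) * (2 * ((x - a) \<bullet> i)) + 2 * D 1 s"
    proof (rule partial_eqI)
      have c1: "((\<lambda>t. 2 * ((x + t *\<^sub>R i - a) \<bullet> i)) has_real_derivative 2) (at 0)"
        using i by (auto intro!: derivative_eq_intros simp: inner_add_left inner_diff_left algebra_simps)
      have c2: "((\<lambda>t. D 1 ((x + t *\<^sub>R i - a) \<bullet> (x + t *\<^sub>R i - a))) has_real_derivative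
          D 2 s * (2 * ((x - a) \<bullet> i))) (at 0)"
        using DERIV_chain2[OF _ sq, of "D 1" "D 2 s"] D(2) assms(3)[OF assms(4)] s_def by simp
      show "((\<lambda>t. D 1 ((x + t *\<^sub>R i - a) \<bullet> (x + t *\<^sub>R i - a)) * (2 * ((x + t *\<^sub>R i - a) \<bullet> i)))
         has_real_derivative D 2 s * (2 * ((x - a) \<bullet> i)) * (2 * ((x - a) \<bullet> i)) + 2 * D 1 s) (at 0)"
        using DERIV_mult[OF c2 c1] by (simp only: s_def scaleR_zero_left add_0_right mult.commute)
    qed
    finally show ?thesis by (simp add: power2_eq_square)
  qed
  have "laplacian (\<lambda>x. D 0 ((x - a) \<bullet> (x - a))) x
      = (\<Sum>i\<in>Basis. D 2 s * (2 * ((x - a) \<bullet> i))\<^sup>2 + 2 * D 1 s)"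
    unfolding laplacian_def by (intro sum.cong refl p2)
  also have "\<dots> = 4 * D 2 s * (\<Sum>i\<in>Basis. ((x - a) \<bullet> i) * ((x - a) \<bullet> i)) + 2 * real DIM('a) * D 1 s"
    by (simp add: sum.distrib) (simp add: sum_distrib_left power2_eq_square ac_simps)
  also have "(\<Sum>i\<in>Basis. ((x - a) \<bullet> i) * ((x - a) \<bullet> i)) = s"
    unfolding s_def by (rule euclidean_inner[symmetric])
  finally show ?thesis by simp
qed

section \<open>Green's identity for compactly supported products\<close>

lemma continuous_on_extend_zero:
  fixes f :: "'a::euclidean_space \<Rightarrow> real"
  assumes "open S" "closed K" "K \<subseteq> S" "continuous_on S f" "\<And>x. x \<in> S - K \<Longrightarrow> f x = 0"
  shows "continuous_on UNIV (\<lambda>x. if x \<in> S then f x else 0)"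
proof -
  have "continuous_on S (\<lambda>x. if x \<in> S then f x else 0)"
    using assms(4) by (simp cong: continuous_on_cong)
  moreover have "continuous_on (- K) (\<lambda>x. if x \<in> S then f x else 0)"
    by (rule continuous_on_cong[THEN iffD2, OF refl _ continuous_on_const[of _ 0]])
       (use assms(5) in auto)
  ultimately have "continuous_on (S \<union> - K) (\<lambda>x. if x \<in> S then f x else 0)"
    using assms(1,2) by (intro continuous_on_open_Un) auto
  moreover have "S \<union> - K = UNIV" using assms(3) by auto
  ultimately show ?thesis by simp
qed

lemma integrable_compact_support:
  fixes f :: "'a::euclidean_space \<Rightarrow> real"
  assumes "continuous_on UNIV f" "compact K" "\<And>x. x \<notin> K \<Longrightarrow> f x = 0"
  shows "integrable lborel f"
proof -
  have "integrable lborel (\<lambda>x. indicator K x *\<^sub>R f x)"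
    using assms by (intro borel_integrable_compact) (auto intro: continuous_on_subset)
  moreover have "(\<lambda>x. indicator K x *\<^sub>R f x) = f"
    using assms(3) by (auto simp: indicator_def fun_eq_iff)
  ultimately show ?thesis by simp
qed

lemma lborel_integral_translate:
  fixes f :: "'a::euclidean_space \<Rightarrow> real"
  assumes "f \<in> borel_measurable borel"
  shows "(LINT x|lborel. f (x + c)) = (LINT x|lborel. f x)"
proof -
  have "(LINT x|lborel. f x) = (LINT x|distr lborel borel ((+) c). f x)"
    by (simp add: lborel_distr_plus)
  also have "\<dots> = (LINT x|lborel. f (c + x))"
    using assms by (intro integral_distr) auto
  finally show ?thesis by (simp add: add.commute)
qed

text \<open>Difference quotients of F in direction i integrate to 0 because Lebesgue measure is
  translation invariant; dominated convergence passes this on to the derivative, without iterated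
  integrals.\<close>

lemma integral_directional_derivative_zero:
  fixes F F' :: "'a::euclidean_space \<Rightarrow> real" and i :: 'a
  assumes cF: "continuous_on UNIV F" and cF': "continuous_on UNIV F'"
    and der: "\<And>x. ((\<lambda>t. F (x + t *\<^sub>R i)) has_real_derivative F' x) (at 0)"
    and K: "compact K" and F0: "\<And>x. x \<notin> K \<Longrightarrow> F x = 0" and F'0: "\<And>x. x \<notin> K \<Longrightarrow> F' x = 0"
  shows "integrable lborel F'" "(LINT x|lborel. F' x) = 0"
proof -
  define h where "h = (\<lambda>(n::nat) x. (F (x + (1 / real (Suc n)) *\<^sub>R i) - F x) * real (Suc n))"
  have iF: "integrable lborel F" by (rule integrable_compact_support[OF cF K F0])
  show iF': "integrable lborel F'" by (rule integrable_compact_support[OF cF' K F'0])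
  have [measurable]: "F \<in> borel_measurable borel" "F' \<in> borel_measurable borel"
    using cF cF' by (auto intro: borel_measurable_continuous_onI)
  have iFc: "integrable lborel (\<lambda>x. F (x + c))" for c
  proof (rule integrable_compact_support)
    show "continuous_on UNIV (\<lambda>x. F (x + c))"
      by (rule continuous_on_compose2[OF cF]) (auto intro!: continuous_intros)
    show "compact ((\<lambda>x. x - c) ` K)"
      using K by (intro compact_continuous_image continuous_intros)
    show "F (x + c) = 0" if "x \<notin> (\<lambda>x. x - c) ` K" for x
      using that F0[of "x + c"] by force
  qed
  have h0: "(LINT x|lborel. h n x) = 0" for n
    unfolding h_def using iF iFc by (simp add: lborel_integral_translate)
  obtain B where B: "\<And>x. \<bar>F' x\<bar> \<le> B"
  proof -
    have "bounded (F' ` K)"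
      using K cF' by (intro compact_imp_bounded compact_continuous_image) (auto intro: continuous_on_subset)
    then obtain B where "\<And>x. x \<in> K \<Longrightarrow> \<bar>F' x\<bar> \<le> B" by (auto simp: bounded_iff)
    then have "\<bar>F' x\<bar> \<le> max B 0" for x using F'0[of x] by (cases "x \<in> K") (auto simp: max.coboundedI1)
    then show ?thesis using that by blast
  qed
  obtain r where r: "\<And>x. x \<in> K \<Longrightarrow> norm x \<le> r"
    using compact_imp_bounded[OF K] by (auto simp: bounded_iff)
  have der_t: "((\<lambda>t. F (x + t *\<^sub>R i)) has_real_derivative F' (x + t *\<^sub>R i)) (at t)" for x t
    using der[of "x + t *\<^sub>R i"] DERIV_shift[of "\<lambda>t. F (x + t *\<^sub>R i)" _ 0 t]
    by (simp add: algebra_simps)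
  \<comment> \<open>By the mean value theorem the quotient is a value of \<open>F'\<close> at
    distance at most \<open>norm i\<close> from x, the step being at most 1. Hence one ball serves
    as the support of a common dominating function.\<close>
  have hb: "norm (h n x) \<le> B * indicator (cball (0::'a) (r + norm i)) x" for n x
  proof -
    let ?e = "1 / real (Suc n)"
    have "0 < ?e" by simp
    then obtain z where z: "0 < z" "z < ?e"
      "F (x + ?e *\<^sub>R i) - F (x + 0 *\<^sub>R i) = (?e - 0) * F' (x + z *\<^sub>R i)"
      using MVT2[of 0 ?e "\<lambda>t. F (x + t *\<^sub>R i)" "\<lambda>t. F' (x + t *\<^sub>R i)"] der_t by blast
    then have hz: "h n x = F' (x + z *\<^sub>R i)" unfolding h_def by (simp add: field_simps)
    show ?thesis
    proof (cases "x \<in> cball 0 (r + norm i)")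
      case True
      then show ?thesis using hz B by simp
    next
      case False
      have "?e \<le> 1" by simp
      then have "z \<le> 1" using z(2) by linarith
      then have "norm (z *\<^sub>R i) \<le> 1 * norm i"
        using z(1) mult_right_mono[of z 1 "norm i"] by simp
      moreover have "norm x \<le> norm (x + z *\<^sub>R i) + norm (z *\<^sub>R i)"
        using norm_triangle_ineq4[of "x + z *\<^sub>R i" "z *\<^sub>R i"] by simp
      ultimately have "x + z *\<^sub>R i \<notin> K" using False r[of "x + z *\<^sub>R i"] by auto
      then show ?thesis using hz F'0 False by simp
    qed
  qed
  have lim: "(\<lambda>n. h n x) \<longlonglongrightarrow> F' x" for x
  proof -
    have "((\<lambda>e. (F (x + e *\<^sub>R i) - F x) / e) \<longlongrightarrow> F' x) (at 0)"
      using der[of x] by (simp add: DERIV_def)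
    moreover have "filterlim (\<lambda>n. 1 / real (Suc n)) (at 0) sequentially"
      using LIMSEQ_inverse_real_of_nat unfolding filterlim_at
      by (auto simp: inverse_eq_divide eventually_sequentially)
    ultimately have "(\<lambda>n. (F (x + (1 / real (Suc n)) *\<^sub>R i) - F x) / (1 / real (Suc n))) \<longlonglongrightarrow> F' x"
      by (rule filterlim_compose)
    then show ?thesis by (simp add: h_def)
  qed
  have "(\<lambda>n. LINT x|lborel. h n x) \<longlonglongrightarrow> (LINT x|lborel. F' x)"
  proof (rule integral_dominated_convergence[where w = "\<lambda>x. B * indicator (cball (0::'a) (r + norm i)) x"])
    show "h n \<in> borel_measurable lborel" for n unfolding h_def by measurable
    show "integrable lborel (\<lambda>x. B * indicator (cball (0::'a) (r + norm i)) x)"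
      using emeasure_compact_finite[of "cball (0::'a) (r + norm i)"]
      by (intro integrable_mult_right integrable_real_indicator) auto
  qed (use lim hb in auto)
  then show "(LINT x|lborel. F' x) = 0" by (simp add: h0 LIMSEQ_const_iff)
qed

text \<open>Summing over i, the i-th derivative of w (d_i v) - (d_i w) v integrates to 0. The zero
  sets \<open>A\<close> and \<open>B\<close> are open so that the derivatives vanish there too; a
  different factor may vanish on different parts of the complement of \<open>K\<close>.\<close>

lemma green_compact_support:
  fixes v w :: "'a::euclidean_space \<Rightarrow> real"
  assumes S: "open S" and K: "compact K" "K \<subseteq> S"
    and AB: "open A" "open B" "S - K \<subseteq> A \<union> B"
    and w0: "\<And>x. x \<in> A \<Longrightarrow> w x = 0" and v0: "\<And>x. x \<in> B \<Longrightarrow> v x = 0"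
    and Cw: "Ck_on 2 S w" and Cv: "Ck_on 2 S v"
  shows "(LINT x:K|lborel. w x * laplacian v x) = (LINT x:K|lborel. laplacian w x * v x)"
proof -
  have cw: "continuous_on S w" "\<And>i. i \<in> Basis \<Longrightarrow> continuous_on S (partial i w)"
      "\<And>i. i \<in> Basis \<Longrightarrow> continuous_on S (partial i (partial i w))"
    using Cw by (auto simp: numeral_2_eq_2 Ck_on_Suc Ck_on_0)
  have cv: "continuous_on S v" "\<And>i. i \<in> Basis \<Longrightarrow> continuous_on S (partial i v)"
      "\<And>i. i \<in> Basis \<Longrightarrow> continuous_on S (partial i (partial i v))"
    using Cv by (auto simp: numeral_2_eq_2 Ck_on_Suc Ck_on_0)
  have dw: "((\<lambda>t. w (x + t *\<^sub>R i)) has_real_derivative partial i w x) (at 0)"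
     "((\<lambda>t. partial i w (x + t *\<^sub>R i)) has_real_derivative partial i (partial i w) x) (at 0)"
    if "i \<in> Basis" "x \<in> S" for i x
    using Ck_on_SucD(2)[of 1 S w i x] Ck_on_SucD(2)[of 0 S "partial i w" i x]
      Ck_on_SucD(3)[of 1 S w i] Cw that by (auto simp: numeral_2_eq_2)
  have dv: "((\<lambda>t. v (x + t *\<^sub>R i)) has_real_derivative partial i v x) (at 0)"
     "((\<lambda>t. partial i v (x + t *\<^sub>R i)) has_real_derivative partial i (partial i v) x) (at 0)"
    if "i \<in> Basis" "x \<in> S" for i x
    using Ck_on_SucD(2)[of 1 S v i x] Ck_on_SucD(2)[of 0 S "partial i v" i x]
      Ck_on_SucD(3)[of 1 S v i] Cv that by (auto simp: numeral_2_eq_2)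
  have pw0: "partial i w x = 0" if "x \<in> A" for i x
    using partial_cong[OF AB(1) that, of w "\<lambda>_. 0" i] w0 by (simp add: partial_const)
  have ppw0: "partial i (partial i w) x = 0" if "x \<in> A" for i x
    using partial_cong[OF AB(1) that, of "partial i w" "\<lambda>_. 0" i] pw0 by (simp add: partial_const)
  have pv0: "partial i v x = 0" if "x \<in> B" for i x
    using partial_cong[OF AB(2) that, of v "\<lambda>_. 0" i] v0 by (simp add: partial_const)
  have ppv0: "partial i (partial i v) x = 0" if "x \<in> B" for i x
    using partial_cong[OF AB(2) that, of "partial i v" "\<lambda>_. 0" i] pv0 by (simp add: partial_const)
  define f where "f = (\<lambda>i x. w x * partial i v x - partial i w x * v x)"
  define f' where "f' = (\<lambda>i x. w x * partial i (partial i v) x - partial i (partial i w) x * v x)"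
  define F where "F = (\<lambda>i x. if x \<in> S then f i x else 0)"
  define F' where "F' = (\<lambda>i x. if x \<in> S then f' i x else 0)"
  have f0: "f i x = 0" "f' i x = 0" if "x \<in> S - K" for i x
    using that AB(3) w0 v0 pw0 ppw0 pv0 ppv0 unfolding f_def f'_def by (auto dest!: subsetD)
  have zero: "integrable lborel (F' i)" "(LINT x|lborel. F' i x) = 0" if i: "i \<in> Basis" for i
  proof -
    have c: "continuous_on UNIV (F i)" "continuous_on UNIV (F' i)"
      unfolding F_def F'_def
      using K f0 cw cv i
      by (auto intro!: continuous_on_extend_zero[OF S compact_imp_closed[OF K(1)] K(2)]
          continuous_intros simp: f_def f'_def)
    have d: "((\<lambda>t. F i (x + t *\<^sub>R i)) has_real_derivative F' i x) (at 0)" for x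
    proof (cases "x \<in> S")
      case True
      have "((\<lambda>t. f i (x + t *\<^sub>R i)) has_real_derivative f' i x) (at 0)"
        unfolding f_def f'_def
        by (rule derivative_eq_intros refl dw[OF i True] dv[OF i True])+ simp
      then show ?thesis
        using directional_cong[OF S True, of "F i" "f i" i] True by (simp add: F_def F'_def)
    next
      case False
      then have "x \<in> - K" using K by auto
      moreover have "F i y = 0" if "y \<in> - K" for y using that f0 by (auto simp: F_def)
      ultimately show ?thesis
        using directional_cong[of "- K" x "F i" "\<lambda>_. 0" i] K(1) False
        by (simp add: F'_def open_Compl compact_imp_closed)
    qed
    have z: "F i x = 0" "F' i x = 0" if "x \<notin> K" for x using that f0 by (auto simp: F_def F'_def)
    show "integrable lborel (F' i)" "(LINT x|lborel. F' i x) = 0"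
      using integral_directional_derivative_zero[OF c d K(1) z] by auto
  qed
  have sum_eq: "(\<Sum>i\<in>Basis. F' i x) = indicator K x *\<^sub>R (w x * laplacian v x) - indicator K x *\<^sub>R (laplacian w x * v x)" for x
  proof (cases "x \<in> K")
    case True
    then have "x \<in> S" using K by auto
    then show ?thesis using True
      by (simp add: F'_def f'_def laplacian_def sum_subtractf sum_distrib_left sum_distrib_right)
  next
    case False
    then show ?thesis using f0 by (auto simp: F'_def intro!: sum.neutral)
  qed
  have "continuous_on S (\<lambda>x. w x * laplacian v x)" "continuous_on S (\<lambda>x. laplacian w x * v x)"
    unfolding laplacian_def using cw cv by (auto intro!: continuous_intros)
  then have int: "integrable lborel (\<lambda>x. indicator K x *\<^sub>R (w x * laplacian v x))"
      "integrable lborel (\<lambda>x. indicator K x *\<^sub>R (laplacian w x * v x))"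
    by - (rule borel_integrable_compact[OF K(1)], rule continuous_on_subset[OF _ K(2)], assumption)+
  have "0 = (\<Sum>i\<in>Basis. LINT x|lborel. F' i x)" using zero by simp
  also have "\<dots> = (LINT x|lborel. (\<Sum>i\<in>Basis. F' i x))"
    using zero by (intro Bochner_Integration.integral_sum[symmetric]) auto
  also have "\<dots> = (LINT x:K|lborel. w x * laplacian v x) - (LINT x:K|lborel. laplacian w x * v x)"
    unfolding sum_eq set_lebesgue_integral_def by (intro Bochner_Integration.integral_diff int)
  finally show ?thesis by simp
qed

text \<open>The index of \<open>w\<close> counts the Laplacians that still rest on \<open>v\<close>:
  each use of Green's identity moves one of them over and lowers the index. Only the members above
  level 0 need two derivatives, so the chain may end in a merely continuous
  \<open>w 0\<close>.\<close>

lemma green_iterated: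
  fixes v :: "'a::euclidean_space \<Rightarrow> real" and w :: "nat \<Rightarrow> 'a \<Rightarrow> real"
  assumes S: "open S" and K: "compact K" "K \<subseteq> S"
    and AB: "open A" "open B" "S - K \<subseteq> A \<union> B"
    and w0: "\<And>k x. k \<le> m \<Longrightarrow> x \<in> A \<Longrightarrow> w k x = 0" and v0: "\<And>x. x \<in> B \<Longrightarrow> v x = 0"
    and Cw: "\<And>k. k < m \<Longrightarrow> Ck_on 2 S (w (Suc k))"
    and lap: "\<And>k x. k < m \<Longrightarrow> x \<in> S \<Longrightarrow> laplacian (w (Suc k)) x = w k x"
    and Cv: "Ck_on (2 * m) S v"
  shows "(LINT x:K|lborel. w m x * (laplacian ^^ m) v x) = (LINT x:K|lborel. w 0 x * v x)"
proof -
  have "(LINT x:K|lborel. w k x * (laplacian ^^ k) v x) = (LINT x:K|lborel. w 0 x * v x)" if "k \<le> m" for k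
    using that
  proof (induction k)
    case (Suc k)
    have C: "Ck_on (2 * k + 2) S v" using Cv Suc.prems by (elim Ck_on_mono) auto
    have z: "(laplacian ^^ k) v x = 0" if "x \<in> B" for x
      using iter_laplacian_cong[OF AB(2) that, of v "\<lambda>_. 0" k] v0 by (simp add: iter_laplacian_zero)
    have "(LINT x:K|lborel. w (Suc k) x * laplacian ((laplacian ^^ k) v) x) =
        (LINT x:K|lborel. laplacian (w (Suc k)) x * (laplacian ^^ k) v x)"
      using Suc.prems by (intro green_compact_support[OF S K AB] w0 z Cw Ck_on_iter_laplacian[OF S C]) auto
    also have "\<dots> = (LINT x:K|lborel. w k x * (laplacian ^^ k) v x)"
      using K Suc.prems lap by (intro set_lebesgue_integral_cong) (auto dest: compact_imp_closed)
    finally show ?case using Suc by simp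
  qed simp
  then show ?thesis by simp
qed

section \<open>Radial solutions of the iterated Laplace equation\<close>

lemma increment_le_of_deriv_le:
  fixes f g :: "real \<Rightarrow> real"
  assumes "a \<le> b"
    and "\<And>x. a \<le> x \<Longrightarrow> x \<le> b \<Longrightarrow> (f has_real_derivative f' x) (at x)"
    and "\<And>x. a \<le> x \<Longrightarrow> x \<le> b \<Longrightarrow> (g has_real_derivative g' x) (at x)"
    and "\<And>x. a \<le> x \<Longrightarrow> x \<le> b \<Longrightarrow> f' x \<le> g' x"
  shows "f b - f a \<le> g b - g a"
proof -
  have "(\<lambda>x. g x - f x) a \<le> (\<lambda>x. g x - f x) b"
  proof (rule DERIV_nonneg_imp_nondecreasing[OF assms(1)])
    fix x assume "a \<le> x" "x \<le> b"
    then show "\<exists>y. ((\<lambda>x. g x - f x) has_real_derivative y) (at x) \<and> 0 \<le> y"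
      using assms(2-4)[of x] by (intro exI[of _ "g' x - f' x"] conjI derivative_intros) auto
  qed
  then show ?thesis by simp
qed

text \<open>Dropping the factor 1/(j + 1) of the antiderivative keeps the constant \<open>C\<close>
  the same through any number of integrations.\<close>

lemma deriv_le_power_imp:
  fixes f :: "real \<Rightarrow> real"
  assumes "\<And>x. 1 \<le> x \<Longrightarrow> (f has_real_derivative f' x) (at x)"
    and "\<And>x. 1 \<le> x \<Longrightarrow> f' x \<le> C * x ^ j" and "f 1 = 0" "C \<ge> 0" "1 \<le> s"
  shows "f s \<le> C * s ^ Suc j"
proof -
  have "f s - f 1 \<le> C * s ^ Suc j - C * 1 ^ Suc j"
  proof (rule increment_le_of_deriv_le[where g = "\<lambda>x. C * x ^ Suc j"])
    show "((\<lambda>x. C * x ^ Suc j) has_real_derivative C * (real (Suc j) * x ^ j)) (at x)" for x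
      using DERIV_cmult[OF DERIV_pow[of "Suc j" x], of C] by simp
    fix x :: real assume x: "1 \<le> x"
    have "C * x ^ j * 1 \<le> C * x ^ j * real (Suc j)"
      using x assms(4) by (intro mult_left_mono) auto
    then show "f' x \<le> C * (real (Suc j) * x ^ j)" using assms(2)[OF x] by (simp add: mult_ac)
  qed (use assms in auto)
  then show ?thesis using assms by simp
qed

text \<open>Integrating from A gives c/(j + 1) (s^(j+1) - A^(j+1)); beyond 2 A the subtracted term
  is at most half of s^(j+1), which costs the factor 2.\<close>

lemma power_le_deriv_imp:
  fixes f :: "real \<Rightarrow> real"
  assumes "\<And>x. A \<le> x \<Longrightarrow> (f has_real_derivative f' x) (at x)"
    and "\<And>x. A \<le> x \<Longrightarrow> c * x ^ j \<le> f' x" and "f A \<ge> 0" "c \<ge> 0" "A \<ge> 0" "2 * A \<le> s"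
  shows "c / (2 * real (Suc j)) * s ^ Suc j \<le> f s"
proof -
  let ?d = "c / real (Suc j)"
  have "?d * s ^ Suc j - ?d * A ^ Suc j \<le> f s - f A"
  proof (rule increment_le_of_deriv_le[where f = "\<lambda>x. ?d * x ^ Suc j"])
    show "((\<lambda>x. ?d * x ^ Suc j) has_real_derivative c * x ^ j) (at x)" for x
      by (rule derivative_eq_intros refl | simp)+
  qed (use assms in auto)
  moreover have "A ^ Suc j \<le> (s / 2) ^ Suc j" using assms by (intro power_mono) auto
  moreover have "(s / 2) ^ Suc j \<le> s ^ Suc j / 2"
  proof -
    have "s ^ Suc j / 2 ^ Suc j \<le> s ^ Suc j / 2"
      using assms by (intro divide_left_mono) (auto simp: self_le_power)
    then show ?thesis by (simp add: power_divide)
  qed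
  ultimately have "?d * s ^ Suc j - ?d * (s ^ Suc j / 2) \<le> f s"
    using assms(3,4) mult_left_mono[of "A ^ Suc j" "s ^ Suc j / 2" ?d] by auto
  moreover have "d * X - d * (X / 2) = d / 2 * X" for d X :: real by (simp add: field_simps)
  ultimately have "?d / 2 * s ^ Suc j \<le> f s" by metis
  then show ?thesis by (simp add: mult.commute)
qed

lemma antiderivative_vanishing:
  fixes f :: "real \<Rightarrow> real"
  assumes "continuous_on {0<..} f" "\<forall>s\<le>1. f s = 0"
  obtains F where "\<And>s. s > 0 \<Longrightarrow> (F has_real_derivative f s) (at s)" "\<And>s. s \<le> 1 \<Longrightarrow> F s = 0"
proof
  \<comment> \<open>The base point 1/2 lies where f vanishes, so the integral is 0 up to 1; for s
    below 1/2 the interval is empty and the value is again 0.\<close>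
  define F where "F = (\<lambda>s. integral {1/2..s} f)"
  show F0: "F s = 0" if "s \<le> 1" for s
  proof -
    have "integral {1/2..s} f = integral {1/2..s} (\<lambda>_. 0)"
      using assms(2) that by (intro integral_cong) auto
    then show ?thesis by (simp add: F_def)
  qed
  show "(F has_real_derivative f s) (at s)" if s: "s > 0" for s
  proof (cases "s < 1")
    case True
    then have "\<forall>\<^sub>F x in nhds s. F x = 0"
      using F0 by (intro eventually_nhds_in_open[of "{..<1}", THEN eventually_mono]) auto
    then show ?thesis using DERIV_cong_ev[OF refl, of F "\<lambda>_. 0" s "f s" 0] assms(2) True by simp
  next
    case False
    have "continuous_on {1/2..s+1} f"
      by (rule continuous_on_subset[OF assms(1)]) auto
    then have "((\<lambda>u. integral {1/2..u} f) has_vector_derivative f s) (at s within {1/2..s+1})"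
      using False by (intro integral_has_vector_derivative) auto
    moreover have "at s within {1/2..s+1} = at s"
      using False by (intro at_within_interior) auto
    ultimately show ?thesis
      by (simp add: F_def has_real_derivative_iff_has_vector_derivative)
  qed
qed

text \<open>Solves \<open>s Q'' + m Q' = P\<close>, that is \<open>(s\<^sup>m Q')' = s\<^sup>m\<^sup>-\<^sup>1 P\<close>, by two integrations.\<close>

lemma radial_inverse:
  fixes P :: "real \<Rightarrow> real"
  assumes m: "m \<ge> 1" and P: "continuous_on {0<..} P" "\<forall>s\<le>1. P s = 0"
  obtains D I where "deriv_chain 2 {0<..} D" "\<And>s. s > 0 \<Longrightarrow> s * D 2 s + real m * D 1 s = P s"
    "\<And>s. s \<le> 1 \<Longrightarrow> D 0 s = 0" "\<And>s. s \<le> 1 \<Longrightarrow> I s = 0"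
    "\<And>s. s > 0 \<Longrightarrow> (I has_real_derivative s ^ (m - 1) * P s) (at s)"
    "\<And>s. D 1 s = I s / s ^ m"
proof -
  have "continuous_on {0<..} (\<lambda>s. s ^ (m - 1) * P s)" "\<forall>s\<le>1. s ^ (m - 1) * P s = 0"
    using P by (auto intro!: continuous_intros)
  note antiderivative_I = antiderivative_vanishing[OF this]
  obtain I where I: "\<And>s. s > 0 \<Longrightarrow> (I has_real_derivative s ^ (m - 1) * P s) (at s)" "\<And>s. s \<le> 1 \<Longrightarrow> I s = 0"
    by (fact antiderivative_I)
  have cI: "continuous_on {0<..} I"
    by (rule DERIV_continuous_on[OF has_field_derivative_at_within[OF I(1)]]) auto
  have "continuous_on {0<..} (\<lambda>s. I s / s ^ m)" "\<forall>s\<le>1. I s / s ^ m = 0"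
    using cI I(2) by (auto intro!: continuous_intros)
  note antiderivative_Q = antiderivative_vanishing[OF this]
  obtain Q where Q: "\<And>s. s > 0 \<Longrightarrow> (Q has_real_derivative I s / s ^ m) (at s)" "\<And>s. s \<le> 1 \<Longrightarrow> Q s = 0"
    by (fact antiderivative_Q)
  define Q2 where "Q2 = (\<lambda>s. (P s - real m * (I s / s ^ m)) / s)"
  define D where "D = (\<lambda>j::nat. if j = 0 then Q else if j = 1 then (\<lambda>s. I s / s ^ m) else Q2)"
  have D: "D 0 = Q" "D 1 = (\<lambda>s. I s / s ^ m)" "D (Suc 0) = (\<lambda>s. I s / s ^ m)" "D 2 = Q2" "D (Suc (Suc 0)) = Q2"
    by (auto simp: D_def)
  have d2: "((\<lambda>s. I s / s ^ m) has_real_derivative Q2 s) (at s)" if s: "s > 0" for s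
  proof -
    obtain n where n: "m = Suc n" using m by (cases m) auto
    have "((\<lambda>s. I s / s ^ m) has_real_derivative
       (s ^ (m - 1) * P s * s ^ m - I s * (real m * s ^ (m - 1))) / (s ^ m * s ^ m)) (at s)"
      using s by (auto intro!: derivative_eq_intros I(1))
    moreover have "(s ^ (m - 1) * P s * s ^ m - I s * (real m * s ^ (m - 1))) / (s ^ m * s ^ m) = Q2 s"
      using s by (simp add: Q2_def n field_simps)
    ultimately show ?thesis by simp
  qed
  show ?thesis
  proof (rule that[of D I])
    have "continuous_on {0<..} Q2" unfolding Q2_def using P cI by (auto intro!: continuous_intros)
    then show "deriv_chain 2 {0<..} D"
      using Q d2 by (auto simp: deriv_chain_def D numeral_2_eq_2 less_Suc_eq)
  qed (use I Q in \<open>auto simp: D Q2_def\<close>)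
qed

text \<open>One inversion raises the growth exponent by one: a source like s^k gives I like s^(m+k),
  then Q' = I / s^m like s^k, then Q like s^(k+1). Each of the two integrations doubles the
  threshold of the lower bound.\<close>

lemma radial_inverse_growth:
  fixes P :: "real \<Rightarrow> real"
  assumes m: "m \<ge> 1" and P: "continuous_on {0<..} P" "\<forall>s\<le>1. P s = 0" "\<forall>s. P s \<ge> 0"
    and up: "C \<ge> 0" "\<forall>s\<ge>1. P s \<le> C * s ^ k"
    and low: "c > 0" "A \<ge> 1" "\<forall>s\<ge>A. c * s ^ k \<le> P s"
  obtains D c' A' where "deriv_chain 2 {0<..} D" "\<And>s. s > 0 \<Longrightarrow> s * D 2 s + real m * D 1 s = P s"
    "\<And>s. s \<le> 1 \<Longrightarrow> D 0 s = 0" "\<And>s. D 0 s \<ge> 0"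
    "\<And>s. s \<ge> 1 \<Longrightarrow> D 0 s \<le> C * s ^ Suc k" "c' > 0" "A' \<ge> 1" "\<And>s. s \<ge> A' \<Longrightarrow> c' * s ^ Suc k \<le> D 0 s"
proof -
  obtain D I where D: "deriv_chain 2 {0<..} D" "\<And>s. s > 0 \<Longrightarrow> s * D 2 s + real m * D 1 s = P s"
    "\<And>s. s \<le> 1 \<Longrightarrow> D 0 s = 0" "\<And>s. s \<le> 1 \<Longrightarrow> I s = 0"
    "\<And>s. s > 0 \<Longrightarrow> (I has_real_derivative s ^ (m - 1) * P s) (at s)"
    "\<And>s. D 1 s = I s / s ^ m"
    by (fact radial_inverse[OF m P(1,2)])
  have D1: "(D 0 has_real_derivative D 1 s) (at s)" if "s > 0" for s
    using D(1) that by (auto simp: deriv_chain_def)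
  have I0: "I s \<ge> 0" for s
  proof (cases "s \<le> 1")
    case False
    have "\<exists>y. (I has_real_derivative y) (at x) \<and> 0 \<le> y" if "1 \<le> x" for x
      using D(5)[of x] P(3) that by (intro exI[of _ "x ^ (m - 1) * P x"]) simp
    then have "I 1 \<le> I s"
      using False by (intro DERIV_nonneg_imp_nondecreasing[of 1 s I]) simp_all
    then show ?thesis using D(4) by simp
  qed (use D(4) in simp)
  have Q0: "D 0 s \<ge> 0" for s
  proof (cases "s \<le> 1")
    case False
    have "\<exists>y. (D 0 has_real_derivative y) (at x) \<and> 0 \<le> y" if "1 \<le> x" for x
      using D1[of x] D(6)[of x] I0[of x] that by (intro exI[of _ "D 1 x"]) simp
    then have "D 0 1 \<le> D 0 s"
      using False by (intro DERIV_nonneg_imp_nondecreasing[of 1 s "D 0"]) simp_all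
    then show ?thesis using D(3) by simp
  qed (use D(3) in simp)
  have pw: "x ^ (m - 1) * x ^ k = x ^ (m - 1 + k)" "x ^ Suc (m - 1 + k) = x ^ k * x ^ m" for x :: real
    using m by (cases m; simp add: power_add)+
  have Iup: "I s \<le> C * s ^ Suc (m - 1 + k)" if "s \<ge> 1" for s
  proof (rule deriv_le_power_imp[OF D(5)])
    fix x :: real assume "1 \<le> x"
    then show "x ^ (m - 1) * P x \<le> C * x ^ (m - 1 + k)"
      using mult_left_mono[OF up(2)[rule_format], of x "x ^ (m - 1)"]
      unfolding pw(1)[symmetric] by (simp add: mult.left_commute)
  qed (use D(4) up that in auto)
  have Qup: "D 0 s \<le> C * s ^ Suc k" if "s \<ge> 1" for s
  proof (rule deriv_le_power_imp[OF D1])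
    fix x :: real assume "1 \<le> x"
    then show "D 1 x \<le> C * x ^ k"
      using Iup[of x] unfolding D(6) pw(2) by (simp add: field_simps)
  qed (use D(3) up that in auto)
  define d where "d = c / (2 * real (Suc (m - 1 + k)))"
  have d: "d > 0" using low by (simp add: d_def)
  have Ilow: "d * s ^ Suc (m - 1 + k) \<le> I s" if "s \<ge> 2 * A" for s
    unfolding d_def
  proof (rule power_le_deriv_imp[OF D(5)])
    fix x :: real assume "A \<le> x"
    then show "c * x ^ (m - 1 + k) \<le> x ^ (m - 1) * P x"
      using mult_left_mono[OF low(3)[rule_format], of x "x ^ (m - 1)"] low(2)
      unfolding pw(1)[symmetric] by (simp add: mult.left_commute)
  qed (use low I0 that in auto)
  have Qlow: "d / (2 * real (Suc k)) * s ^ Suc k \<le> D 0 s" if "s \<ge> 2 * (2 * A)" for s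
  proof (rule power_le_deriv_imp[OF D1])
    fix x :: real assume "2 * A \<le> x"
    then show "d * x ^ k \<le> D 1 x"
      using Ilow[of x] low(2) unfolding D(6) pw(2) by (simp add: field_simps)
  qed (use low d Q0 that in auto)
  show ?thesis
    by (rule that[of D "d / (2 * real (Suc k))" "2 * (2 * A)"]) (use D Q0 Qup Qlow d low(2) in auto)
qed

text \<open>The source decays like s^(-m-1), so s^(m-1) q is dominated by s^(-2) and its integral I
  stays bounded; then Q' is at most s^(-m), and Q is bounded because m \<ge> 2. This first inversion
  thus ends at growth s^0, and after m of them the growth is s^(m-1) = |x|^(n-2).\<close>

lemma radial_inverse_base:
  assumes m: "m \<ge> 2"
  defines "q \<equiv> \<lambda>s. max 0 (s - 1) / s ^ (m + 2) :: real"
  obtains D c A where "deriv_chain 2 {0<..} D" "\<And>s. s > 0 \<Longrightarrow> s * D 2 s + real m * D 1 s = q s"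
    "\<And>s. s \<le> 1 \<Longrightarrow> D 0 s = 0" "\<And>s. D 0 s \<ge> 0"
    "\<And>s. s \<ge> 1 \<Longrightarrow> D 0 s \<le> 1" "c > 0" "A \<ge> 1" "\<And>s. s \<ge> A \<Longrightarrow> c \<le> D 0 s"
proof -
  have cq: "continuous_on {0<..} q" unfolding q_def by (auto intro!: continuous_intros)
  have q1: "\<forall>s\<le>1. q s = 0" by (simp add: q_def)
  have m1: "m \<ge> 1" using m by simp
  obtain D I where D: "deriv_chain 2 {0<..} D" "\<And>s. s > 0 \<Longrightarrow> s * D 2 s + real m * D 1 s = q s"
    "\<And>s. s \<le> 1 \<Longrightarrow> D 0 s = 0" "\<And>s. s \<le> 1 \<Longrightarrow> I s = 0"
    "\<And>s. s > 0 \<Longrightarrow> (I has_real_derivative s ^ (m - 1) * q s) (at s)"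
    "\<And>s. D 1 s = I s / s ^ m"
    by (fact radial_inverse[OF m1 cq q1])
  have D1: "(D 0 has_real_derivative D 1 s) (at s)" if "s > 0" for s
    using D(1) that by (auto simp: deriv_chain_def)
  have q': "s ^ (m - 1) * q s = (s - 1) / s ^ 3" if "s \<ge> 1" for s
  proof -
    have "m + 2 = (m - 1) + 3" using m by simp
    then have "s ^ (m + 2) = s ^ (m - 1) * s ^ 3" by (simp only: power_add)
    then show ?thesis using that by (simp add: q_def)
  qed
  have Ipos: "I s > 0" if "s > 1" for s
  proof -
    have "I 1 < I s"
    proof (rule DERIV_pos_imp_increasing_open[OF that])
      fix x assume x: "1 < x" "x < s"
      then show "\<exists>y. (I has_real_derivative y) (at x) \<and> 0 < y"
        using D(5)[of x] q'[of x] by (intro exI[of _ "(x - 1) / x ^ 3"]) auto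
    next
      show "continuous_on {1..s} I"
        by (rule DERIV_continuous_on[OF has_field_derivative_at_within[OF D(5)]]) auto
    qed
    then show ?thesis using D(4) by simp
  qed
  have inv: "((\<lambda>x. 1 - 1 / x) has_real_derivative 1 / x\<^sup>2) (at x)" if "1 \<le> x" for x :: real
    using that by (auto intro!: derivative_eq_intros simp: power2_eq_square)
  have Iup: "I s \<le> 1" if "s \<ge> 1" for s
  proof -
    have "I s - I 1 \<le> (1 - 1 / s) - (1 - 1 / 1)"
    proof (rule increment_le_of_deriv_le[OF that D(5) inv])
      fix x :: real assume x: "1 \<le> x"
      then have "(x - 1) / x ^ 3 \<le> x / x ^ 3" by (intro divide_right_mono) auto
      also have "\<dots> = 1 / x\<^sup>2" using x by (simp add: power2_eq_square power3_eq_cube)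
      finally show "x ^ (m - 1) * q x \<le> 1 / x\<^sup>2" using q'[OF x] by simp
    qed auto
    moreover have "1 / s \<ge> 0" using that by simp
    ultimately show ?thesis using D(4)[of 1] by linarith
  qed
  have Qup: "D 0 s \<le> 1" if "s \<ge> 1" for s
  proof -
    have "D 0 s - D 0 1 \<le> (1 - 1 / s) - (1 - 1 / 1)"
    proof (rule increment_le_of_deriv_le[OF that D1 inv])
      fix x :: real assume x: "1 \<le> x"
      have "I x / x ^ m \<le> 1 / x ^ m" using Iup[OF x] x by (intro divide_right_mono) auto
      also have "\<dots> \<le> 1 / x\<^sup>2" using x m by (intro divide_left_mono power_increasing) auto
      finally show "D 1 x \<le> 1 / x\<^sup>2" by (simp only: D(6))
    qed auto
    moreover have "1 / s \<ge> 0" using that by simp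
    ultimately show ?thesis using D(3)[of 1] by linarith
  qed
  have Dinc: "D 0 a < D 0 b" if "1 \<le> a" "a < b" for a b
  proof (rule DERIV_pos_imp_increasing_open[OF that(2)])
    fix x assume x: "a < x" "x < b"
    then show "\<exists>y. (D 0 has_real_derivative y) (at x) \<and> 0 < y"
      using D1[of x] Ipos[of x] that D(6)[of x] by (intro exI[of _ "D 1 x"]) auto
  next
    show "continuous_on {a..b} (D 0)"
      by (rule DERIV_continuous_on[OF has_field_derivative_at_within[OF D1]]) (use that in auto)
  qed
  have D0: "D 0 s \<ge> 0" for s
    using Dinc[of 1 s] D(3)[of s] D(3)[of 1] by (cases "s \<le> 1") auto
  show ?thesis
  proof (rule that[of D "D 0 2" 2])
    show "D 0 2 > 0" using Dinc[of 1 2] D(3)[of 1] by simp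
    show "D 0 2 \<le> D 0 s" if "s \<ge> 2" for s using Dinc[of 2 s] that by (cases "s = 2") auto
  qed (use D D0 Qup in auto)
qed

text \<open>Profiles of the test functions that vanish for s \<le> 1, obtained by inverting the
  radial operator again and again; consecutive members are linked by the equation, as
  \<open>green_iterated\<close> requires.\<close>

lemma radial_polyharmonic_chain:
  assumes m: "m \<ge> 2"
  obtains D C c A where
    "\<And>k. deriv_chain 2 {0<..} (D (Suc k))"
    "\<And>k s. s > 0 \<Longrightarrow> s * D (Suc k) 2 s + real m * D (Suc k) 1 s = D k 0 s"
    "\<And>k s. s \<le> 1 \<Longrightarrow> D k 0 s = 0" "\<And>s. D 0 0 s = max 0 (s - 1) / s ^ (m + 2)"
    "\<And>k s. D k 0 s \<ge> 0"
    "\<And>s. s \<ge> 1 \<Longrightarrow> D m 0 s \<le> C * s ^ (m - 1)" "C \<ge> 0" "c > 0" "A \<ge> 1"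
    "\<And>s. s \<ge> A \<Longrightarrow> c * s ^ (m - 1) \<le> D m 0 s"
proof -
  define q where "q = (\<lambda>s. max 0 (s - 1) / s ^ (m + 2) :: real)"
  \<comment> \<open>\<open>G\<close> is the invariant of the choice: from level 1 on, level n grows
    like s^(n-1), with upper constant 1 at every level. Level 0 is exceptional because q decays.
    \<open>R\<close> is the equation between neighbouring levels.\<close>
  define G where "G = (\<lambda>n (E :: nat \<Rightarrow> real \<Rightarrow> real). continuous_on {0<..} (E 0) \<and> (\<forall>s\<le>1. E 0 s = 0) \<and>
     (\<forall>s. E 0 s \<ge> 0) \<and> (n = 0 \<longrightarrow> E 0 = q) \<and>
     (n > 0 \<longrightarrow> (\<forall>s\<ge>1. E 0 s \<le> 1 * s ^ (n - 1)) \<and> (\<exists>c>0. \<exists>A\<ge>1. \<forall>s\<ge>A. c * s ^ (n - 1) \<le> E 0 s)))"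
  define R where "R = (\<lambda>(n::nat) (E :: nat \<Rightarrow> real \<Rightarrow> real) E'. deriv_chain 2 {0<..} E' \<and>
      (\<forall>s>0. s * E' 2 s + real m * E' 1 s = E 0 s))"
  have "\<exists>D. \<forall>n. G n (D n) \<and> R n (D n) (D (Suc n))"
  proof (rule dependent_nat_choice)
    have "continuous_on {0<..} q" "\<And>s. q s \<ge> 0"
      unfolding q_def by (auto intro!: continuous_intros) (auto simp: max_def intro!: divide_nonneg_nonneg)
    moreover have "q s = 0" if "s \<le> 1" for s using that by (simp add: q_def)
    ultimately show "\<exists>E. G 0 E" by (intro exI[of _ "\<lambda>_. q"]) (auto simp: G_def)
  next
    fix E n assume E: "G n E"
    show "\<exists>E'. G (Suc n) E' \<and> R n E E'"
    proof (cases "n = 0")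
      case True
      obtain D c A where "deriv_chain 2 {0<..} D" "\<And>s. s > 0 \<Longrightarrow> s * D 2 s + real m * D 1 s = q s"
        "\<And>s. s \<le> 1 \<Longrightarrow> D 0 s = 0" "\<And>s. D 0 s \<ge> 0"
        "\<And>s. s \<ge> 1 \<Longrightarrow> D 0 s \<le> 1" "c > 0" "A \<ge> 1" "\<And>s. s \<ge> A \<Longrightarrow> c \<le> D 0 s"
        unfolding q_def by (fact radial_inverse_base[OF m])
      note D = this
      have "continuous_on {0<..} (D 0)" using deriv_chain_continuous[OF D(1)] by simp
      moreover have "\<exists>c>0. \<exists>A\<ge>1. \<forall>s\<ge>A. c * s ^ (Suc n - 1) \<le> D 0 s"
        using D(6-8) True by auto
      moreover have "E 0 = q" using E True by (simp add: G_def)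
      ultimately have "G (Suc n) D \<and> R n E D" using True D(1-5) unfolding G_def R_def by simp
      then show ?thesis by blast
    next
      case False
      from E False obtain c A where cA: "c > 0" "A \<ge> 1" "\<forall>s\<ge>A. c * s ^ (n - 1) \<le> E 0 s"
        unfolding G_def by auto
      have E': "continuous_on {0<..} (E 0)" "\<forall>s\<le>1. E 0 s = 0" "\<forall>s. E 0 s \<ge> 0"
        "\<forall>s\<ge>1. E 0 s \<le> 1 * s ^ (n - 1)"
        using E False unfolding G_def by auto
      have m1: "m \<ge> 1" using m by simp
      obtain D c' A' where "deriv_chain 2 {0<..} D" "\<And>s. s > 0 \<Longrightarrow> s * D 2 s + real m * D 1 s = E 0 s"
        "\<And>s. s \<le> 1 \<Longrightarrow> D 0 s = 0" "\<And>s. D 0 s \<ge> 0"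
        "\<And>s. s \<ge> 1 \<Longrightarrow> D 0 s \<le> 1 * s ^ Suc (n - 1)" "c' > 0" "A' \<ge> 1"
        "\<And>s. s \<ge> A' \<Longrightarrow> c' * s ^ Suc (n - 1) \<le> D 0 s"
        by (fact radial_inverse_growth[OF m1 E'(1-3) zero_le_one E'(4) cA])
      note D = this
      have "continuous_on {0<..} (D 0)" using deriv_chain_continuous[OF D(1)] by simp
      moreover have "\<exists>c>0. \<exists>A\<ge>1. \<forall>s\<ge>A. c * s ^ (Suc n - 1) \<le> D 0 s"
        using D(6-8) False by auto
      moreover have "s ^ Suc (n - 1) = s ^ (Suc n - 1)" for s :: real using False by simp
      ultimately have "G (Suc n) D \<and> R n E D" using D(1-5) unfolding G_def R_def by simp
      then show ?thesis by blast
    qed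
  qed
  then obtain D where D: "\<And>n. G n (D n)" "\<And>n. R n (D n) (D (Suc n))" by blast
  from D(1)[of m] m obtain c A where cA: "c > 0" "A \<ge> 1" "\<And>s. s \<ge> A \<Longrightarrow> c * s ^ (m - 1) \<le> D m 0 s"
    unfolding G_def by auto
  show ?thesis
  proof (rule that[of D 1 c A])
    show "deriv_chain 2 {0<..} (D (Suc k))" for k using D(2)[of k] by (simp add: R_def)
    show "s * D (Suc k) 2 s + real m * D (Suc k) 1 s = D k 0 s" if "s > 0" for k s
      using D(2)[of k] that by (simp add: R_def)
    show "D k 0 s = 0" if "s \<le> 1" for k s using D(1)[of k] that by (simp add: G_def)
    show "D 0 0 s = max 0 (s - 1) / s ^ (m + 2)" for s using D(1)[of 0] by (simp add: G_def q_def)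
    show "D k 0 s \<ge> 0" for k s using D(1)[of k] by (simp add: G_def)
    show "D m 0 s \<le> 1 * s ^ (m - 1)" if "s \<ge> 1" for s using D(1)[of m] that m by (simp add: G_def)
  qed (use cA in auto)
qed

section \<open>Iterated radial Laplacian and the truncated logarithm\<close>

text \<open>The coefficient of x^i in k! L(-x), where L is the generalized Laguerre polynomial of
  degree k with parameter m - 1. These arise when the k-th power of s (d/ds)^2 + m (d/ds) is written
  with all powers of s on the left.\<close>

definition radial_coeff :: "nat \<Rightarrow> nat \<Rightarrow> nat \<Rightarrow> real" where
  "radial_coeff m k i = real (k choose i) * fact (m + k - 1) / fact (m + i - 1)"

text \<open>Applying the operator once more to s^i (d/ds)^(k+i), the coefficient of s^j
  (d/ds)^(k+1+j) receives contributions from i = j + 1, i = j and i = j - 1.\<close>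

lemma radial_coeff_Suc:
  assumes "m \<ge> 1"
  shows "radial_coeff m (Suc k) j = real (Suc j) * real (j + m) * radial_coeff m k (Suc j)
     + real (2 * j + m) * radial_coeff m k j + (if j = 0 then 0 else radial_coeff m k (j - 1))"
proof -
  obtain n where m: "m = Suc n" using assms by (cases m) auto
  \<comment> \<open>The absorption identity for binomial coefficients, stated over the reals so that
    the difference k - i need not be truncated.\<close>
  have b: "real (Suc i) * real (k choose Suc i) = (real k - real i) * real (k choose i)" for i
    using arg_cong[OF Suc_times_binomial_eq[of k i], of real] by (simp add: algebra_simps)
  have "radial_coeff m k (Suc j) = real (k choose Suc j) * fact (n + k) / (real (Suc (n + j)) * fact (n + j))"
    by (simp add: radial_coeff_def m)
  then have "real (Suc j) * real (j + m) * radial_coeff m k (Suc j)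
      = (real (Suc j) * real (k choose Suc j)) * fact (n + k) / fact (n + j)"
    by (simp add: m add.commute del: of_nat_Suc)
  then have t1: "real (Suc j) * real (j + m) * radial_coeff m k (Suc j)
      = (real k - real j) * real (k choose j) * fact (n + k) / fact (n + j)" by (simp only: b)
  show ?thesis
  proof (cases j)
    case 0
    then show ?thesis using t1 by (simp add: radial_coeff_def m field_simps)
  next
    case (Suc i)
    have t3: "radial_coeff m k i = real (k choose i) * real (Suc (n + i)) * fact (n + k) / fact (n + j)"
      by (simp add: radial_coeff_def m Suc del: of_nat_Suc)
    have t0: "radial_coeff m (Suc k) j =
        (real (k choose i) + real (k choose j)) * real (Suc (n + k)) * fact (n + k) / fact (n + j)"
      by (simp add: radial_coeff_def m Suc del: of_nat_Suc)
    have t2: "radial_coeff m k j = real (k choose j) * fact (n + k) / fact (n + j)"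
      by (simp add: radial_coeff_def m)
    have "(real (k choose i) + real (k choose j)) * real (Suc (n + k)) =
       (real k - real j) * real (k choose j) + real (2 * j + m) * real (k choose j)
         + real (k choose i) * real (Suc (n + i))"
      using b[of i] by (simp add: Suc m algebra_simps)
    then have "radial_coeff m (Suc k) j = ((real k - real j) * real (k choose j) + real (2 * j + m) * real (k choose j)
         + real (k choose i) * real (Suc (n + i))) * fact (n + k) / fact (n + j)"
      by (simp only: t0)
    then show ?thesis unfolding t1 using t2 t3 Suc by (simp add: ring_distribs add_divide_distrib del: of_nat_Suc)
  qed
qed

text \<open>In closed form, the \<open>k\<close>-th power of \<open>s (d/ds)\<^sup>2 + m (d/ds)\<close> is
  \<open>\<Sum>i\<le>k. radial_coeff m k i s\<^sup>i (d/ds)\<^sup>k\<^sup>+\<^sup>i\<close>; the second argument of \<open>radial_power\<close>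
  selects its derivative of order 0, 1 or 2.\<close>

definition radial_power :: "nat \<Rightarrow> nat \<Rightarrow> (nat \<Rightarrow> real \<Rightarrow> real) \<Rightarrow> nat \<Rightarrow> real \<Rightarrow> real" where
  "radial_power m k D j s = (\<Sum>i\<le>k. radial_coeff m k i *
     (if j = 0 then s ^ i * D (k + i) s
      else if j = 1 then real i * s ^ (i - 1) * D (k + i) s + s ^ i * D (Suc (k + i)) s
      else real i * (real (i - 1) * s ^ (i - 2)) * D (k + i) s
         + 2 * (real i * s ^ (i - 1)) * D (Suc (k + i)) s + s ^ i * D (Suc (Suc (k + i))) s))"

text \<open>The highest derivative that occurs has order 2 k + 2, at most 2 m since k < m.\<close>

lemma deriv_chain_radial_power:
  assumes D: "deriv_chain (2 * m) T D" and k: "k < m"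
  shows "deriv_chain 2 T (radial_power m k D)"
proof -
  have d: "(D j has_real_derivative D (Suc j) s) (at s)" if "s \<in> T" "j < 2 * m" for j s
    using D that by (auto simp: deriv_chain_def)
  have p: "((\<lambda>x. x ^ i) has_real_derivative real i * s ^ (i - 1)) (at s)" for i and s :: real
    using DERIV_pow[of i s] by simp
  have p2: "((\<lambda>x. real i * x ^ (i - 1)) has_real_derivative real i * (real (i - 1) * s ^ (i - 2))) (at s)"
    for i and s :: real
    using DERIV_cmult[OF p[of "i - 1" s], of "real i"] by (simp add: numeral_2_eq_2)
  have d0: "(radial_power m k D 0 has_real_derivative radial_power m k D 1 s) (at s)" if s: "s \<in> T" for s
    unfolding radial_power_def using k
    by (auto intro!: DERIV_sum DERIV_cmult DERIV_cong[OF DERIV_mult[OF p d[OF s]]])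
  have d1: "(radial_power m k D 1 has_real_derivative radial_power m k D 2 s) (at s)" if s: "s \<in> T" for s
  proof -
    have "((\<lambda>x. real i * x ^ (i - 1) * D (k + i) x + x ^ i * D (Suc (k + i)) x) has_real_derivative
        real i * (real (i - 1) * s ^ (i - 2)) * D (k + i) s
         + 2 * (real i * s ^ (i - 1)) * D (Suc (k + i)) s + s ^ i * D (Suc (Suc (k + i))) s) (at s)"
      if "i \<le> k" for i
      by (rule DERIV_cong[OF DERIV_add[OF DERIV_mult[OF p2 d[OF s]] DERIV_mult[OF p d[OF s]]]])
         (use that k in \<open>auto simp: algebra_simps\<close>)
    then show ?thesis unfolding radial_power_def by (auto intro!: DERIV_sum DERIV_cmult)
  qed
  have "continuous_on T (D j)" if "j \<le> 2 * m" for j using deriv_chain_continuous[OF D that] .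
  then have "continuous_on T (radial_power m k D 2)"
    unfolding radial_power_def using k by (auto intro!: continuous_intros)
  then show ?thesis using d0 d1 by (auto simp: deriv_chain_def numeral_2_eq_2 less_Suc_eq)
qed

lemma radial_power_Suc:
  assumes m: "m \<ge> 1"
  shows "s * radial_power m k D 2 s + real m * radial_power m k D 1 s = radial_power m (Suc k) D 0 s"
proof -
  define c where "c = radial_coeff m k"
  define X where "X = (\<lambda>j. s ^ j * D (Suc k + j) s)"
  have c0: "c i = 0" if "i > k" for i using that by (simp add: c_def radial_coeff_def)
  define a1 where "a1 = (\<lambda>i. real i * (real (i - 1) + real m) * c i * X (i - 1))"
  define a2 where "a2 = (\<lambda>i. real (2 * i + m) * c i * X i)"
  define a3 where "a3 = (\<lambda>i. c i * X (Suc i))"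
  have summand: "s * (c i * (real i * (real (i - 1) * s ^ (i - 2)) * D (k + i) s
         + 2 * (real i * s ^ (i - 1)) * D (Suc (k + i)) s + s ^ i * D (Suc (Suc (k + i))) s))
     + real m * (c i * (real i * s ^ (i - 1) * D (k + i) s + s ^ i * D (Suc (k + i)) s)) = a1 i + a2 i + a3 i" for i
  proof (cases i)
    case 0
    then show ?thesis by (simp add: a1_def a2_def a3_def X_def algebra_simps)
  next
    case (Suc j)
    then show ?thesis by (cases j) (auto simp: a1_def a2_def a3_def X_def algebra_simps)
  qed
  have "s * radial_power m k D 2 s + real m * radial_power m k D 1 s = (\<Sum>i\<le>k. a1 i + a2 i + a3 i)"
    unfolding radial_power_def c_def[symmetric] sum_distrib_left summand[symmetric]
    by (simp add: sum.distrib)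
  also have "\<dots> = (\<Sum>i\<le>k. a1 i) + (\<Sum>i\<le>k. a2 i) + (\<Sum>i\<le>k. a3 i)" by (simp add: sum.distrib)
  \<comment> \<open>The coefficients vanish beyond k, so all three sums can be extended and shifted
    to the common range up to k + 1, where the recursion for the coefficients applies
    termwise.\<close>
  also have "(\<Sum>i\<le>k. a1 i) = (\<Sum>i\<le>Suc (Suc k). a1 i)" by (simp add: a1_def c0)
  also have "\<dots> = (\<Sum>j\<le>Suc k. a1 (Suc j))" by (subst sum.atMost_Suc_shift) (simp add: a1_def)
  also have "(\<Sum>i\<le>k. a2 i) = (\<Sum>i\<le>Suc k. a2 i)" by (simp add: a2_def c0)
  also have "(\<Sum>i\<le>k. a3 i) = (\<Sum>j\<le>Suc k. (if j = 0 then 0 else c (j - 1)) * X j)"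
    by (subst sum.atMost_Suc_shift) (simp add: a3_def)
  also have "(\<Sum>j\<le>Suc k. a1 (Suc j)) + (\<Sum>i\<le>Suc k. a2 i) + (\<Sum>j\<le>Suc k. (if j = 0 then 0 else c (j - 1)) * X j)
     = (\<Sum>j\<le>Suc k. radial_coeff m (Suc k) j * X j)"
    unfolding sum.distrib[symmetric]
    by (intro sum.cong refl)
       (simp only: radial_coeff_Suc[OF m] a1_def a2_def c_def[symmetric] ring_distribs diff_Suc_1 of_nat_add)
  finally show ?thesis by (simp add: radial_power_def X_def)
qed

section \<open>The truncated logarithm\<close>

lemma DERIV_extend_zero:
  fixes f f' :: "real \<Rightarrow> real"
  assumes d: "(f has_real_derivative f' s) (at s)" and f1: "f 1 = 0" "f' 1 = 0"
  shows "((\<lambda>s. if s < 1 then f s else 0) has_real_derivative (if s < 1 then f' s else 0)) (at s)"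
proof (cases s "1 :: real" rule: linorder_cases)
  case less
  then have "\<forall>\<^sub>F x in nhds s. x < 1" using eventually_nhds_in_open[of "{..<1}" s] by simp
  then have ev: "\<forall>\<^sub>F x in nhds s. (if x < 1 then f x else 0) = f x" by (rule eventually_mono) simp
  have "((\<lambda>s. if s < 1 then f s else 0) has_real_derivative f' s) (at s)"
    by (rule DERIV_cong_ev[OF refl ev refl, THEN iffD2]) (rule d)
  then show ?thesis using less by simp
next
  case greater
  then have "\<forall>\<^sub>F x in nhds s. x > 1" using eventually_nhds_in_open[of "{1<..}" s] by simp
  then have ev: "\<forall>\<^sub>F x in nhds s. (if x < 1 then f x else 0) = 0" by (rule eventually_mono) simp
  have "((\<lambda>s. if s < 1 then f s else 0) has_real_derivative 0) (at s)"
    by (rule DERIV_cong_ev[OF refl ev refl, THEN iffD2]) (rule DERIV_const)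
  then show ?thesis using greater by simp
next
  case equal
  have lim: "((\<lambda>y. \<bar>(f y - f 1) / (y - 1)\<bar>) \<longlongrightarrow> 0) (at 1)"
    using d equal f1 by (intro tendsto_rabs_zero) (simp add: has_field_derivative_iff)
  have "\<forall>\<^sub>F y in at 1. norm ((if y < 1 then f y else 0) / (y - 1)) \<le> \<bar>(f y - f 1) / (y - 1)\<bar>"
    by (simp add: f1)
  from Lim_null_comparison[OF this lim] show ?thesis using equal by (simp add: has_field_derivative_iff)
qed

definition neg_ln_deriv :: "nat \<Rightarrow> real \<Rightarrow> real" where
  "neg_ln_deriv j x = (if j = 0 then - ln x else (-1) ^ j * fact (j - 1) / x ^ j)"

text \<open>The j-th derivative of the Taylor polynomial of degree 2m of -ln at 1. For j = 2m + 1
  the sum is empty, which is the correct value 0.\<close>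

definition neg_ln_taylor :: "nat \<Rightarrow> nat \<Rightarrow> real \<Rightarrow> real" where
  "neg_ln_taylor m j x = (\<Sum>k<2 * m + 1 - j. neg_ln_deriv (j + k) 1 * (x - 1) ^ k / fact k)"

lemma DERIV_neg_ln_deriv:
  assumes "x > 0"
  shows "(neg_ln_deriv j has_real_derivative neg_ln_deriv (Suc j) x) (at x)"
proof (cases j)
  case 0
  have "((\<lambda>x. - ln x) has_real_derivative - (1 / x)) (at x)"
    using assms by (auto intro!: derivative_eq_intros)
  then show ?thesis using 0 by (simp add: neg_ln_deriv_def[abs_def])
next
  case (Suc i)
  have "((\<lambda>x. (-1) ^ j * fact (j - 1) / x ^ j) has_real_derivative
     - ((-1) ^ j * fact (j - 1) * (real j * x ^ (j - 1))) / (x ^ j * x ^ j)) (at x)"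
    using assms by (auto intro!: derivative_eq_intros)
  moreover have "- ((-1) ^ j * fact (j - 1) * (real j * x ^ (j - 1))) / (x ^ j * x ^ j) = neg_ln_deriv (Suc j) x"
  proof -
    have "x ^ j * x ^ j = x ^ (j - 1) * x ^ Suc j" by (simp add: Suc)
    moreover have "fact j = real j * fact (j - 1)" by (simp add: Suc)
    ultimately show ?thesis using assms by (simp add: neg_ln_deriv_def)
  qed
  ultimately show ?thesis using Suc by (simp add: neg_ln_deriv_def[abs_def])
qed

lemma DERIV_neg_ln_taylor:
  assumes "j \<le> 2 * m"
  shows "(neg_ln_taylor m j has_real_derivative neg_ln_taylor m (Suc j) x) (at x)"
proof -
  define N where "N = 2 * m - j"
  have N: "2 * m + 1 - j = Suc N" "2 * m + 1 - Suc j = N" using assms by (auto simp: N_def)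
  have "(neg_ln_taylor m j has_real_derivative
     (\<Sum>k<Suc N. neg_ln_deriv (j + k) 1 * (real k * (x - 1) ^ (k - 1)) / fact k)) (at x)"
    unfolding neg_ln_taylor_def N
    by (intro DERIV_sum) (auto intro!: derivative_eq_intros)
  also have "(\<Sum>k<Suc N. neg_ln_deriv (j + k) 1 * (real k * (x - 1) ^ (k - 1)) / fact k)
     = (\<Sum>k<N. neg_ln_deriv (j + Suc k) 1 * (real (Suc k) * (x - 1) ^ k) / fact (Suc k))"
    by (subst sum.lessThan_Suc_shift) simp
  also have "\<dots> = neg_ln_taylor m (Suc j) x"
    unfolding neg_ln_taylor_def N by (intro sum.cong refl) (simp del: of_nat_Suc)
  finally show ?thesis .
qed

lemma neg_ln_taylor_1: "j \<le> 2 * m \<Longrightarrow> neg_ln_taylor m j 1 = neg_ln_deriv j 1"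
  by (simp add: neg_ln_taylor_def Suc_diff_le sum.lessThan_Suc_shift del: sum.lessThan_Suc)

text \<open>In powers of 1 - x the expansion of -ln x has only nonnegative coefficients. Subtracting
  the polynomial therefore only lowers the kernel, which stays below the logarithm.\<close>

lemma neg_ln_taylor_nonneg: "x \<le> 1 \<Longrightarrow> neg_ln_taylor m 0 x \<ge> 0"
  unfolding neg_ln_taylor_def
proof (intro sum_nonneg)
  fix k assume "x \<le> 1"
  have "(-1) ^ k * (x - 1) ^ k = (1 - x) ^ k" by (simp flip: power_mult_distrib)
  then have "(-1) ^ k * (x - 1) ^ k \<ge> 0" using \<open>x \<le> 1\<close> by simp
  then have "fact (k - 1) * ((-1) ^ k * (x - 1) ^ k) / fact k \<ge> 0" by simp
  then show "0 \<le> neg_ln_deriv (0 + k) 1 * (x - 1) ^ k / fact k"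
    by (simp add: neg_ln_deriv_def mult_ac)
qed

lemma neg_ln_taylor_bound:
  assumes "0 \<le> x" "x \<le> 1"
  shows "\<bar>neg_ln_taylor m j x\<bar> \<le> (\<Sum>k<2 * m + 1 - j. \<bar>neg_ln_deriv (j + k) 1\<bar>)"
  unfolding neg_ln_taylor_def
proof (intro order.trans[OF sum_abs] sum_mono)
  fix k
  have "\<bar>x - 1\<bar> ^ k \<le> 1" using assms by (intro power_le_one) auto
  also have "(1::real) \<le> fact k" by (rule fact_ge_1)
  finally have "\<bar>x - 1\<bar> ^ k / fact k \<le> 1" by simp
  then have "\<bar>neg_ln_deriv (j + k) 1\<bar> * (\<bar>x - 1\<bar> ^ k / fact k) \<le> \<bar>neg_ln_deriv (j + k) 1\<bar> * 1"
    by (intro mult_left_mono) auto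
  then show "\<bar>neg_ln_deriv (j + k) 1 * (x - 1) ^ k / fact k\<bar> \<le> \<bar>neg_ln_deriv (j + k) 1\<bar>"
    by (simp add: abs_mult power_abs)
qed

text \<open>Subtracting the Taylor polynomial at 1 makes the extension by zero beyond 1 of class \<open>C\<^sup>2\<^sup>m\<close>.\<close>

definition trunc_log :: "nat \<Rightarrow> nat \<Rightarrow> real \<Rightarrow> real" where
  "trunc_log m j x = (if x < 1 then neg_ln_deriv j x - neg_ln_taylor m j x else 0)"

lemma deriv_chain_trunc_log: "deriv_chain (2 * m) {0<..} (trunc_log m)"
  unfolding deriv_chain_def
proof (intro conjI allI impI ballI)
  fix j s assume j: "j < 2 * m" and s: "s \<in> {0::real<..}"
  show "(trunc_log m j has_real_derivative trunc_log m (Suc j) s) (at s)"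
    unfolding trunc_log_def[abs_def]
    by (rule DERIV_extend_zero)
       (use j s in \<open>auto intro!: DERIV_diff DERIV_neg_ln_deriv DERIV_neg_ln_taylor simp: neg_ln_taylor_1\<close>)
next
  have "continuous_on {0<..} (\<lambda>x. neg_ln_deriv (2 * m) x)"
    by (rule DERIV_continuous_on[OF has_field_derivative_at_within[OF DERIV_neg_ln_deriv]]) auto
  moreover have "continuous_on {0<..} (\<lambda>x. neg_ln_taylor m (2 * m) x)"
    by (rule DERIV_continuous_on[OF has_field_derivative_at_within[OF DERIV_neg_ln_taylor]]) auto
  ultimately have c: "continuous_on {0<..} (\<lambda>x. neg_ln_deriv (2 * m) x - neg_ln_taylor m (2 * m) x)"
    by (intro continuous_intros)
  \<comment> \<open>The top derivative of the difference vanishes at 1, so evaluating it at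
    \<open>min x 1\<close> gives the extension by zero.\<close>
  have "continuous_on {0<..} (\<lambda>x. (\<lambda>x. neg_ln_deriv (2 * m) x - neg_ln_taylor m (2 * m) x) (min x 1))"
    by (rule continuous_on_compose2[OF c]) (auto intro!: continuous_intros)
  then show "continuous_on {0<..} (trunc_log m (2 * m))"
    by (rule continuous_on_cong[THEN iffD1, OF refl, rotated])
       (auto simp: trunc_log_def min_def neg_ln_taylor_1)
qed

text \<open>The factorial in the derivative of -ln cancels the denominator of the coefficient. With
  t = s + \<delta> the sum then collapses by the binomial theorem to (t - s)^m = \<delta>^m. As a
  function of s = |x - y|^2 in dimension 2m, the result concentrates at y as \<delta> tends to
  0.\<close>

lemma radial_power_neg_ln:
  assumes m: "m \<ge> 1" and s: "s + \<delta> > 0"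
  shows "(\<Sum>i\<le>m. radial_coeff m m i * (s ^ i * neg_ln_deriv (m + i) (s + \<delta>)))
     = (-1) ^ m * fact (2 * m - 1) * \<delta> ^ m / (s + \<delta>) ^ (2 * m)"
proof -
  let ?t = "s + \<delta>"
  have "radial_coeff m m i * (s ^ i * neg_ln_deriv (m + i) ?t)
     = (-1) ^ m * fact (2 * m - 1) / ?t ^ (2 * m) * (real (m choose i) * (- s) ^ i * ?t ^ (m - i))"
    if "i \<le> m" for i
  proof -
    have "?t ^ (2 * m) = ?t ^ (m + i) * ?t ^ (m - i)"
      using that by (simp add: mult_2 flip: power_add)
    then have "1 / ?t ^ (m + i) = ?t ^ (m - i) / ?t ^ (2 * m)" using s by simp
    moreover have "neg_ln_deriv (m + i) ?t = (-1) ^ (m + i) * fact (m + i - 1) * (1 / ?t ^ (m + i))"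
      using m by (simp add: neg_ln_deriv_def)
    ultimately have "neg_ln_deriv (m + i) ?t = (-1) ^ (m + i) * fact (m + i - 1) * (?t ^ (m - i) / ?t ^ (2 * m))"
      by simp
    then show ?thesis
      by (simp add: radial_coeff_def power_add power_minus[of s] mult_ac flip: mult_2)
  qed
  then have "(\<Sum>i\<le>m. radial_coeff m m i * (s ^ i * neg_ln_deriv (m + i) ?t))
     = (-1) ^ m * fact (2 * m - 1) / ?t ^ (2 * m) * (\<Sum>i\<le>m. real (m choose i) * (- s) ^ i * ?t ^ (m - i))"
    by (simp add: sum_distrib_left)
  also have "(\<Sum>i\<le>m. real (m choose i) * (- s) ^ i * ?t ^ (m - i)) = (- s + ?t) ^ m"
    by (rule binomial_ring[symmetric])
  finally show ?thesis by simp
qed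

text \<open>The error stems from the Taylor polynomial alone: its terms scale like s^i / a^(m+i), at
  most 1 / a^m for s \<le> a, so \<open>C\<close> depends on neither a nor \<delta>. The tower lives
  on s > -\<delta>, which contains s = 0 and makes the kernel smooth at its centre.\<close>

lemma log_kernel:
  assumes m: "m \<ge> 1"
  obtains C where "C \<ge> 0"
    "\<And>a \<delta>. a > 0 \<Longrightarrow> \<delta> > 0 \<Longrightarrow> \<exists>K. deriv_chain (2 * m) {-\<delta><..} K \<and>
       (\<forall>j s. s + \<delta> \<ge> a \<longrightarrow> K j s = 0) \<and>
       (\<forall>s\<ge>0. s + \<delta> < a \<longrightarrow> K 0 s \<le> ln (a / (s + \<delta>)) \<and>
          \<bar>radial_power m m K 0 s - (-1) ^ m * fact (2 * m - 1) * \<delta> ^ m / (s + \<delta>) ^ (2 * m)\<bar> \<le> C / a ^ m)"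
proof
  define B where "B = (\<lambda>j. \<Sum>k<2 * m + 1 - j. \<bar>neg_ln_deriv (j + k) 1\<bar>)"
  define C where "C = (\<Sum>i\<le>m. radial_coeff m m i * B (m + i))"
  have rc: "radial_coeff m m i \<ge> 0" for i by (simp add: radial_coeff_def)
  have B0: "B j \<ge> 0" for j by (auto simp: B_def intro: sum_nonneg)
  show "C \<ge> 0" unfolding C_def using rc B0 by (intro sum_nonneg mult_nonneg_nonneg)
  fix a \<delta> :: real assume a: "a > 0" and \<delta>: "\<delta> > 0"
  define K where "K = (\<lambda>j s. trunc_log m j ((s + \<delta>) / a) / a ^ j)"
  show "\<exists>K. deriv_chain (2 * m) {-\<delta><..} K \<and> (\<forall>j s. s + \<delta> \<ge> a \<longrightarrow> K j s = 0) \<and>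
     (\<forall>s\<ge>0. s + \<delta> < a \<longrightarrow> K 0 s \<le> ln (a / (s + \<delta>)) \<and>
          \<bar>radial_power m m K 0 s - (-1) ^ m * fact (2 * m - 1) * \<delta> ^ m / (s + \<delta>) ^ (2 * m)\<bar> \<le> C / a ^ m)"
  proof (intro exI[of _ K] conjI allI impI)
    show "deriv_chain (2 * m) {-\<delta><..} K" unfolding deriv_chain_def
    proof (intro conjI allI impI ballI)
      fix j s assume j: "j < 2 * m" and s: "s \<in> {-\<delta><..}"
      have "(trunc_log m j has_real_derivative trunc_log m (Suc j) ((s + \<delta>) / a)) (at ((s + \<delta>) / a))"
        using deriv_chain_trunc_log[of m] j s a by (auto simp: deriv_chain_def)
      moreover have "((\<lambda>s. (s + \<delta>) / a) has_real_derivative 1 / a) (at s)"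
        using a by (auto intro!: derivative_eq_intros)
      ultimately have "((\<lambda>s. trunc_log m j ((s + \<delta>) / a)) has_real_derivative
          trunc_log m (Suc j) ((s + \<delta>) / a) * (1 / a)) (at s)"
        by (rule DERIV_chain2)
      from DERIV_cdivide[OF this, of "a ^ j"]
      show "(K j has_real_derivative K (Suc j) s) (at s)" by (simp add: K_def)
    next
      have "continuous_on {0<..} (trunc_log m (2 * m))"
        using deriv_chain_trunc_log[of m] by (simp add: deriv_chain_def)
      then have "continuous_on {-\<delta><..} (\<lambda>s. trunc_log m (2 * m) ((s + \<delta>) / a))"
        by (rule continuous_on_compose2) (use a in \<open>auto intro!: continuous_intros\<close>)
      then show "continuous_on {-\<delta><..} (K (2 * m))"
        unfolding K_def using a by (intro continuous_intros) auto
    qed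
    show "K j s = 0" if "s + \<delta> \<ge> a" for j s
      using that a by (simp add: K_def trunc_log_def)
    fix s assume s: "0 \<le> s" "s + \<delta> < a"
    have x: "(s + \<delta>) / a < 1" "0 < (s + \<delta>) / a" using s a \<delta> by auto
    have "ln (a / (s + \<delta>)) = - ln ((s + \<delta>) / a)" using s a \<delta> by (simp add: ln_div)
    then show "K 0 s \<le> ln (a / (s + \<delta>))"
      using x neg_ln_taylor_nonneg[of "(s + \<delta>) / a" m] by (simp add: K_def trunc_log_def neg_ln_deriv_def)
    have Kj: "K (m + i) s = neg_ln_deriv (m + i) (s + \<delta>) - neg_ln_taylor m (m + i) ((s + \<delta>) / a) / a ^ (m + i)" for i
      using x a m s \<delta> by (simp add: K_def trunc_log_def neg_ln_deriv_def diff_divide_distrib power_divide)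
    have "radial_power m m K 0 s - (-1) ^ m * fact (2 * m - 1) * \<delta> ^ m / (s + \<delta>) ^ (2 * m)
       = (\<Sum>i\<le>m. radial_coeff m m i * (s ^ i * K (m + i) s))
          - (\<Sum>i\<le>m. radial_coeff m m i * (s ^ i * neg_ln_deriv (m + i) (s + \<delta>)))"
      using radial_power_neg_ln[OF m, of s \<delta>] s \<delta> by (simp add: radial_power_def)
    also have "\<dots> = - (\<Sum>i\<le>m. radial_coeff m m i * (s ^ i * (neg_ln_taylor m (m + i) ((s + \<delta>) / a) / a ^ (m + i))))"
      unfolding Kj by (simp add: algebra_simps sum_subtractf)
    finally have "\<bar>radial_power m m K 0 s - (-1) ^ m * fact (2 * m - 1) * \<delta> ^ m / (s + \<delta>) ^ (2 * m)\<bar>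
       \<le> (\<Sum>i\<le>m. \<bar>radial_coeff m m i * (s ^ i * (neg_ln_taylor m (m + i) ((s + \<delta>) / a) / a ^ (m + i)))\<bar>)"
      by (simp only: abs_minus_cancel sum_abs)
    also have "\<dots> \<le> (\<Sum>i\<le>m. radial_coeff m m i * (B (m + i) / a ^ m))"
    proof (intro sum_mono)
      fix i assume "i \<in> {..m}"
      have "s ^ i \<le> a ^ i" using s \<delta> by (intro power_mono) auto
      then have "s ^ i * \<bar>neg_ln_taylor m (m + i) ((s + \<delta>) / a)\<bar> \<le> a ^ i * B (m + i)"
        using neg_ln_taylor_bound[of "(s + \<delta>) / a" m "m + i"] x s B0 a
        by (intro mult_mono) (auto simp: B_def)
      then have "s ^ i * \<bar>neg_ln_taylor m (m + i) ((s + \<delta>) / a)\<bar> / a ^ (m + i) \<le> a ^ i * B (m + i) / a ^ (m + i)"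
        using a by (intro divide_right_mono) auto
      also have "\<dots> = B (m + i) / a ^ m" using a by (simp add: power_add)
      finally have "radial_coeff m m i * (s ^ i * \<bar>neg_ln_taylor m (m + i) ((s + \<delta>) / a)\<bar> / a ^ (m + i))
         \<le> radial_coeff m m i * (B (m + i) / a ^ m)"
        using rc[of i] by (rule mult_left_mono)
      then show "\<bar>radial_coeff m m i * (s ^ i * (neg_ln_taylor m (m + i) ((s + \<delta>) / a) / a ^ (m + i)))\<bar>
         \<le> radial_coeff m m i * (B (m + i) / a ^ m)"
        using rc[of i] s a by (simp add: abs_mult)
    qed
    also have "\<dots> = C / a ^ m" by (simp add: C_def sum_divide_distrib)
    finally show "\<bar>radial_power m m K 0 s - (-1) ^ m * fact (2 * m - 1) * \<delta> ^ m / (s + \<delta>) ^ (2 * m)\<bar> \<le> C / a ^ m" .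
  qed
qed

section \<open>Integral bounds for nonnegative superpolyharmonic functions\<close>

lemma DERIV_truncated_power:
  assumes "p \<ge> 2"
  shows "((\<lambda>s. if s < 1 then c * (1 - s) ^ p else 0) has_real_derivative
     (if s < 1 then - c * real p * (1 - s) ^ (p - 1) else 0)) (at s)"
proof (rule DERIV_extend_zero)
  show "((\<lambda>s. c * (1 - s) ^ p) has_real_derivative - c * real p * (1 - s) ^ (p - 1)) (at s)"
    by (auto intro!: derivative_eq_intros)
  show "c * (1 - 1) ^ p = 0" "- c * real p * (1 - 1) ^ (p - 1) = 0" using assms by auto
qed

text \<open>Finitely many derivatives suffice, so a truncated power replaces an infinitely smooth
  bump; exponent k + 1 gives class C^k.\<close>

definition trunc_power :: "nat \<Rightarrow> nat \<Rightarrow> real \<Rightarrow> real" where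
  "trunc_power n j s = (if s < 1 then (-1) ^ j * (fact n / fact (n - j)) * (1 - s) ^ (n - j) else 0)"

lemma deriv_chain_trunc_power: "deriv_chain k UNIV (trunc_power (Suc k))"
  unfolding deriv_chain_def
proof (intro conjI allI impI ballI)
  fix j and s :: real assume j: "j < k"
  define p where "p = k - Suc j"
  have p: "Suc k - j = Suc (Suc p)" "Suc k - Suc j = Suc p" using j by (auto simp: p_def)
  have "((\<lambda>s. if s < 1 then ((-1) ^ j * (fact (Suc k) / fact (Suc (Suc p)))) * (1 - s) ^ Suc (Suc p) else 0)
     has_real_derivative (if s < 1 then - ((-1) ^ j * (fact (Suc k) / fact (Suc (Suc p)))) * real (Suc (Suc p))
        * (1 - s) ^ (Suc (Suc p) - 1) else 0)) (at s)"
    by (rule DERIV_truncated_power) simp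
  moreover have "- ((-1) ^ j * (fact (Suc k) / fact (Suc (Suc p)))) * real (Suc (Suc p))
      = (-1) ^ Suc j * (fact (Suc k) / fact (Suc p))"
  proof -
    have "fact (Suc (Suc p)) = real (Suc (Suc p)) * fact (Suc p)" by (rule fact_Suc)
    then show ?thesis by (simp del: of_nat_Suc fact_Suc)
  qed
  ultimately show "(trunc_power (Suc k) j has_real_derivative trunc_power (Suc k) (Suc j) s) (at s)"
    unfolding trunc_power_def p by (simp only: diff_Suc_1)
next
  have "trunc_power (Suc k) k = (\<lambda>s. (-1) ^ k * fact (Suc k) * max 0 (1 - s))"
    by (auto simp: trunc_power_def max_def)
  then show "continuous_on UNIV (trunc_power (Suc k) k)"
    by (simp only:) (intro continuous_intros)
qed

text \<open>Two nested truncated powers: the inner one equals 0 for |x|^2 \<le> 1, where the outer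
  one takes the value 1, and is at least 1 for |x|^2 \<ge> 2, where the outer one vanishes.\<close>

lemma smooth_cutoff:
  obtains \<psi> :: "'a::euclidean_space \<Rightarrow> real"
  where "Ck_on k UNIV \<psi>" "\<And>x. \<psi> x \<ge> 0" "\<And>x. x \<bullet> x \<le> 1 \<Longrightarrow> \<psi> x = 1" "\<And>x. x \<bullet> x \<ge> 2 \<Longrightarrow> \<psi> x = 0"
proof
  let ?b = "trunc_power (Suc k) 0"
  let ?\<psi> = "\<lambda>x::'a. ?b (?b (2 + (-1) * ((x - 0) \<bullet> (x - 0))))"
  have b: "?b s = (if s < 1 then (1 - s) ^ Suc k else 0)" for s by (simp add: trunc_power_def)
  show "Ck_on k UNIV ?\<psi>"
    by (intro Ck_on_compose[OF _ deriv_chain_trunc_power] Ck_on_add Ck_on_mult Ck_on_const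
        Ck_on_norm_squared) auto
  show "?\<psi> x \<ge> 0" for x by (simp add: b)
  show "?\<psi> x = 1" if "x \<bullet> x \<le> 1" for x using that by (simp add: b)
  show "?\<psi> x = 0" if "x \<bullet> x \<ge> 2" for x
  proof -
    have "1 \<le> (x \<bullet> x - 1) ^ Suc k" using that by (intro one_le_power) auto
    then show ?thesis using that by (auto simp: b)
  qed
qed

lemma set_integrable_compact:
  fixes f :: "'a::euclidean_space \<Rightarrow> real"
  shows "compact K \<Longrightarrow> continuous_on K f \<Longrightarrow> set_integrable lborel K f"
  unfolding set_integrable_def by (rule borel_integrable_compact)

lemma set_integral_mono_subset:
  fixes f h :: "'a::euclidean_space \<Rightarrow> real"
  assumes "set_integrable lborel A f" "set_integrable lborel B h" "A \<subseteq> B"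
    "\<And>x. x \<in> A \<Longrightarrow> f x \<le> h x" "\<And>x. x \<in> B \<Longrightarrow> 0 \<le> h x"
  shows "(LINT x:A|lborel. f x) \<le> (LINT x:B|lborel. h x)"
  unfolding set_lebesgue_integral_def
  using assms unfolding set_integrable_def
  by (intro integral_mono) (auto simp: indicator_def)

lemma compact_annulus:
  "compact {x :: 'a::euclidean_space. a \<le> x \<bullet> x \<and> x \<bullet> x \<le> b}" (is "compact ?K")
proof -
  have "norm x \<le> sqrt b" if "x \<in> ?K" for x using that by (simp add: norm_eq_sqrt_inner)
  then have "bounded ?K" by (auto simp: bounded_iff)
  moreover have "closed ?K" by (intro closed_Collect_conj closed_Collect_le continuous_intros)
  ultimately show ?thesis by (simp add: compact_eq_bounded_closed)
qed

lemma annulus_subset_punctured_ball: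
  "0 < a \<Longrightarrow> b < 4 \<Longrightarrow> {x :: 'a::euclidean_space. a \<le> x \<bullet> x \<and> x \<bullet> x \<le> b} \<subseteq> ball 0 2 - {0}"
proof
  fix x :: 'a assume a: "0 < a" "b < 4" "x \<in> {x. a \<le> x \<bullet> x \<and> x \<bullet> x \<le> b}"
  then have "norm x ^ 2 < 2 ^ 2" by (simp add: power2_norm_eq_inner)
  then have "norm x < 2" by (rule power2_less_imp_less) simp
  then show "x \<in> ball 0 2 - {0}" using a by auto
qed

lemma scaled_radial_chain:
  assumes "deriv_chain 2 {0<..} D" "\<epsilon> > 0"
  shows "deriv_chain 2 {0<..} (\<lambda>j s. c * D j (s / \<epsilon>) / \<epsilon> ^ j)"
  unfolding deriv_chain_def
proof (intro conjI allI impI ballI)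
  fix j :: nat and s :: real assume j: "j < 2" and s: "s \<in> {0<..}"
  have "(D j has_real_derivative D (Suc j) (s / \<epsilon>)) (at (s / \<epsilon>))"
    using assms j s by (auto simp: deriv_chain_def)
  moreover have "((\<lambda>s. s / \<epsilon>) has_real_derivative 1 / \<epsilon>) (at s)"
    using assms by (auto intro!: derivative_eq_intros)
  ultimately have "((\<lambda>s. D j (s / \<epsilon>)) has_real_derivative D (Suc j) (s / \<epsilon>) * (1 / \<epsilon>)) (at s)"
    by (rule DERIV_chain2)
  from DERIV_cdivide[OF DERIV_cmult[OF this, of c], of "\<epsilon> ^ j"]
  show "((\<lambda>s. c * D j (s / \<epsilon>) / \<epsilon> ^ j) has_real_derivative c * D (Suc j) (s / \<epsilon>) / \<epsilon> ^ Suc j) (at s)"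
    by simp
next
  have "continuous_on {0<..} (D 2)" using assms by (simp add: deriv_chain_def)
  then have "continuous_on {0<..} (\<lambda>s. D 2 (s / \<epsilon>))"
    by (rule continuous_on_compose2) (use assms in \<open>auto intro!: continuous_intros\<close>)
  then show "continuous_on {0<..} (\<lambda>s. c * D 2 (s / \<epsilon>) / \<epsilon> ^ 2)"
    using assms(2) by (intro continuous_intros) auto
qed

text \<open>After Green's identity the integrals of \<open>w 0 * v\<close> and
  \<open>w m * g\<close> stand on the same side with the same sign, so a bound on their sum bounds
  each. The only other contribution comes from a fixed region away from 0 and is bounded
  independently of the scale \<epsilon>.\<close>

lemma nonneg_superpolyharmonic_bounds:
  fixes u :: "'a::euclidean_space \<Rightarrow> real"
  assumes m: "m \<ge> 2" and dim: "DIM('a) = 2 * m"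
    and smooth: "Ck_on (2 * m) (ball 0 2 - {0}) u"
    and nonneg: "\<And>x. x \<in> ball 0 2 - {0} \<Longrightarrow> u x \<ge> 0"
    and super: "\<And>x. x \<in> ball 0 2 - {0} \<Longrightarrow> (laplacian ^^ m) u x \<le> 0"
  obtains C where
    "\<And>a. 0 < a \<Longrightarrow> (LINT x:{x. a \<le> x \<bullet> x \<and> x \<bullet> x \<le> 1/2}|lborel. (x \<bullet> x) ^ (m - 1) * - (laplacian ^^ m) u x) \<le> C"
    "\<And>\<epsilon>. 0 < \<epsilon> \<Longrightarrow> \<epsilon> \<le> 1/25 \<Longrightarrow> (LINT x:{x. 9 * \<epsilon> \<le> x \<bullet> x \<and> x \<bullet> x \<le> 25 * \<epsilon>}|lborel. u x) \<le> C * \<epsilon>"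
proof -
  define S where "S = (ball 0 2 - {0} :: 'a set)"
  have S: "open S" by (simp add: S_def open_delete)
  have annulus_S: "{x :: 'a. a \<le> x \<bullet> x \<and> x \<bullet> x \<le> b} \<subseteq> S" if "0 < a" "b < 4" for a b
    unfolding S_def using that by (rule annulus_subset_punctured_ball)
  define g where "g = (\<lambda>x. - (laplacian ^^ m) u x)"
  have g0: "g x \<ge> 0" if "x \<in> S" for x using super that by (simp add: g_def S_def)
  have "Ck_on 0 S ((laplacian ^^ m) u)"
    using smooth by (intro Ck_on_iter_laplacian S) (simp add: S_def)
  then have cg: "continuous_on S g" unfolding g_def by (auto simp: Ck_on_0 intro: continuous_intros)
  have cu: "continuous_on S u" using Ck_on_continuous[OF smooth] by (simp add: S_def)
  obtain \<psi> :: "'a \<Rightarrow> real" where \<psi>: "Ck_on (2 * m) UNIV \<psi>" "\<And>x. \<psi> x \<ge> 0"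
    "\<And>x. x \<bullet> x \<le> 1 \<Longrightarrow> \<psi> x = 1" "\<And>x. x \<bullet> x \<ge> 2 \<Longrightarrow> \<psi> x = 0" by (fact smooth_cutoff)
  define v where "v = (\<lambda>x. \<psi> x * u x)"
  have Cv: "Ck_on (2 * m) S v"
    unfolding v_def using smooth \<psi>(1) by (intro Ck_on_mult S) (auto simp: S_def intro: Ck_on_subset)
  have cv: "continuous_on S v" by (rule Ck_on_continuous[OF Cv])
  have v0: "v x \<ge> 0" if "x \<in> S" for x using nonneg \<psi>(2) that by (simp add: v_def S_def)
  have "Ck_on 0 S ((laplacian ^^ m) v)" using Cv by (intro Ck_on_iter_laplacian S) simp
  then have cLv: "continuous_on S ((laplacian ^^ m) v)" by (simp add: Ck_on_0)
  have Lv: "(laplacian ^^ m) v x = - g x" if "x \<in> S" "x \<bullet> x < 1" for x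
  proof -
    have "open (S \<inter> {x. x \<bullet> x < 1})" by (intro open_Int S open_Collect_less continuous_intros)
    then have "(laplacian ^^ m) v x = (laplacian ^^ m) u x"
      by (rule iter_laplacian_cong) (use that \<psi>(3) in \<open>auto simp: v_def\<close>)
    then show ?thesis by (simp add: g_def)
  qed
  obtain D C c A where D: "\<And>k. deriv_chain 2 {0<..} (D (Suc k))"
    "\<And>k s. s > 0 \<Longrightarrow> s * D (Suc k) 2 s + real m * D (Suc k) 1 s = D k 0 s"
    "\<And>k s. s \<le> 1 \<Longrightarrow> D k 0 s = 0" "\<And>s. D 0 0 s = max 0 (s - 1) / s ^ (m + 2)"
    "\<And>k s. D k 0 s \<ge> 0"
    and DC: "\<And>s. s \<ge> 1 \<Longrightarrow> D m 0 s \<le> C * s ^ (m - 1)" "C \<ge> 0" "c > 0" "A \<ge> 1"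
    "\<And>s. s \<ge> A \<Longrightarrow> c * s ^ (m - 1) \<le> D m 0 s"
    by (fact radial_polyharmonic_chain[OF m])
  \<comment> \<open>The support of \<open>v\<close> beyond |x|^2 = 1/2, including the transition
    zone of the cut-off. It is compact in the punctured ball, so one bound M serves for every
    \<epsilon>.\<close>
  define K2 where "K2 = {x::'a. 1/2 \<le> x \<bullet> x \<and> x \<bullet> x \<le> 2}"
  have K2: "compact K2" "K2 \<subseteq> S"
    unfolding K2_def by (rule compact_annulus, rule annulus_S) auto
  obtain M where M: "\<And>x. x \<in> K2 \<Longrightarrow> \<bar>(laplacian ^^ m) v x\<bar> \<le> M"
  proof -
    have "bounded ((laplacian ^^ m) v ` K2)"
      using K2 cLv by (intro compact_imp_bounded compact_continuous_image) (auto intro: continuous_on_subset)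
    then show ?thesis using that by (auto simp: bounded_iff)
  qed
  define M' where "M' = max M 0"
  define W where "W = C * 2 ^ (m - 1)"
  define Q where "Q = W * M' * measure lborel K2"
  have M'0: "M' \<ge> 0" and MM': "\<And>x. x \<in> K2 \<Longrightarrow> \<bar>(laplacian ^^ m) v x\<bar> \<le> M'" and W0: "W \<ge> 0"
    using M DC(2) by (auto simp: M'_def W_def le_max_iff_disj)
  \<comment> \<open>Each Laplacian of a profile in s / \<epsilon> produces a factor 4 / \<epsilon>,
    compensated by (\<epsilon> / 4)^k. The remaining 1 / \<epsilon> makes
    \<open>w \<epsilon> m\<close> comparable with |x|^(2m-2) uniformly in \<epsilon>, and
    \<open>w \<epsilon> 0\<close> of order 1 / \<epsilon> where |x|^2 is of order
    \<epsilon>.\<close>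
  define w where "w = (\<lambda>\<epsilon> k (x::'a). \<epsilon> ^ k / (4 ^ k * \<epsilon>) * D k 0 (x \<bullet> x / \<epsilon>))"
  define K where "K = (\<lambda>\<epsilon>. {x::'a. \<epsilon> \<le> x \<bullet> x \<and> x \<bullet> x \<le> 2})"
  define K1 where "K1 = (\<lambda>\<epsilon>. {x::'a. \<epsilon> \<le> x \<bullet> x \<and> x \<bullet> x \<le> 1/2})"
  have w0: "w \<epsilon> k x \<ge> 0" if "\<epsilon> > 0" for \<epsilon> k x using D(5) that by (simp add: w_def)
  have wC: "Ck_on 2 S (w \<epsilon> (Suc k))" and wlap: "\<And>x. x \<in> S \<Longrightarrow> laplacian (w \<epsilon> (Suc k)) x = w \<epsilon> k x"
    if \<epsilon>: "\<epsilon> > 0" for \<epsilon> k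
  proof -
    let ?c = "\<epsilon> ^ Suc k / (4 ^ Suc k * \<epsilon>)"
    let ?E = "\<lambda>j s. ?c * D (Suc k) j (s / \<epsilon>) / \<epsilon> ^ j"
    have ch: "deriv_chain 2 {0<..} ?E" by (rule scaled_radial_chain[OF D(1) \<epsilon>])
    have T: "(x - 0) \<bullet> (x - 0) \<in> {0<..}" if "x \<in> S" for x using that by (auto simp: S_def)
    have weq: "w \<epsilon> (Suc k) = (\<lambda>x. ?E 0 ((x - 0) \<bullet> (x - 0)))" by (simp add: w_def)
    show "Ck_on 2 S (w \<epsilon> (Suc k))"
      unfolding weq by (rule Ck_on_compose[OF S ch Ck_on_norm_squared[OF S] T])
    fix x assume x: "x \<in> S"
    define s where "s = x \<bullet> x"
    have s: "s > 0" using x by (auto simp: S_def s_def)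
    have "laplacian (w \<epsilon> (Suc k)) x = 4 * s * ?E 2 s + 2 * real DIM('a) * ?E 1 s"
      unfolding weq by (subst laplacian_radial[OF S ch T x]) (simp_all add: s_def)
    also have "\<dots> = 4 * ?c / \<epsilon> * (s / \<epsilon> * D (Suc k) 2 (s / \<epsilon>) + real m * D (Suc k) 1 (s / \<epsilon>))"
      using \<epsilon> dim by (simp add: field_simps power2_eq_square)
    also have "\<dots> = 4 * ?c / \<epsilon> * D k 0 (s / \<epsilon>)" using D(2)[of "s / \<epsilon>" k] s \<epsilon> by simp
    also have "\<dots> = w \<epsilon> k x" using \<epsilon> by (simp add: w_def s_def)
    finally show "laplacian (w \<epsilon> (Suc k)) x = w \<epsilon> k x" .
  qed
  have wm_up: "w \<epsilon> m x \<le> W" if "\<epsilon> > 0" "x \<in> K \<epsilon>" for \<epsilon> x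
  proof -
    have "w \<epsilon> m x \<le> \<epsilon> ^ m / (4 ^ m * \<epsilon>) * (C * (x \<bullet> x / \<epsilon>) ^ (m - 1))"
      unfolding w_def using that DC(1)[of "x \<bullet> x / \<epsilon>"] by (intro mult_left_mono) (auto simp: K_def)
    also have "\<epsilon> ^ m = \<epsilon> ^ (m - 1) * \<epsilon>" using m by (simp flip: power_Suc2)
    also have "\<epsilon> ^ (m - 1) * \<epsilon> / (4 ^ m * \<epsilon>) * (C * (x \<bullet> x / \<epsilon>) ^ (m - 1)) = C * (x \<bullet> x) ^ (m - 1) / 4 ^ m"
      using that by (simp add: power_divide)
    also have "\<dots> \<le> C * 2 ^ (m - 1) / 1"
      using that DC(2) by (intro frac_le mult_left_mono power_mono mult_nonneg_nonneg) (auto simp: K_def)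
    finally show ?thesis by (simp add: W_def)
  qed
  have wm_low: "c / 4 ^ m * (x \<bullet> x) ^ (m - 1) \<le> w \<epsilon> m x" if "\<epsilon> > 0" "A * \<epsilon> \<le> x \<bullet> x" for \<epsilon> x
  proof -
    have "\<epsilon> ^ m / (4 ^ m * \<epsilon>) * (c * (x \<bullet> x / \<epsilon>) ^ (m - 1)) \<le> w \<epsilon> m x"
      unfolding w_def using that DC(5)[of "x \<bullet> x / \<epsilon>"] by (intro mult_left_mono) (auto simp: field_simps)
    also have "\<epsilon> ^ m = \<epsilon> ^ (m - 1) * \<epsilon>" using m by (simp flip: power_Suc2)
    also have "\<epsilon> ^ (m - 1) * \<epsilon> / (4 ^ m * \<epsilon>) * (c * (x \<bullet> x / \<epsilon>) ^ (m - 1)) = c / 4 ^ m * (x \<bullet> x) ^ (m - 1)"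
      using that by (simp add: power_divide)
    finally show ?thesis .
  qed
  have w0_low: "8 / 25 ^ (m + 2) / \<epsilon> \<le> w \<epsilon> 0 x" if "\<epsilon> > 0" "9 * \<epsilon> \<le> x \<bullet> x" "x \<bullet> x \<le> 25 * \<epsilon>" for \<epsilon> x
  proof -
    have t: "9 \<le> x \<bullet> x / \<epsilon>" "x \<bullet> x / \<epsilon> \<le> 25" using that by (auto simp: field_simps)
    then have "8 / 25 ^ (m + 2) \<le> max 0 (x \<bullet> x / \<epsilon> - 1) / (x \<bullet> x / \<epsilon>) ^ (m + 2)"
      by (intro frac_le power_mono zero_less_power) (simp_all del: times_divide_eq_right)
    then have "8 / 25 ^ (m + 2) / \<epsilon> \<le> max 0 (x \<bullet> x / \<epsilon> - 1) / (x \<bullet> x / \<epsilon>) ^ (m + 2) / \<epsilon>"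
      using that by (intro divide_right_mono) auto
    then show ?thesis using D(4)[of "x \<bullet> x / \<epsilon>"] by (simp add: w_def)
  qed
  have cw: "continuous_on S (w \<epsilon> k)" if "\<epsilon> > 0" for \<epsilon> k
  proof (cases k)
    case 0
    have "continuous_on S (\<lambda>x. 1 / \<epsilon> * (max 0 (x \<bullet> x / \<epsilon> - 1) / (x \<bullet> x / \<epsilon>) ^ (m + 2)))"
      using that by (intro continuous_intros) (auto simp: S_def)
    moreover have "w \<epsilon> 0 = (\<lambda>x. 1 / \<epsilon> * (max 0 (x \<bullet> x / \<epsilon> - 1) / (x \<bullet> x / \<epsilon>) ^ (m + 2)))"
      by (simp only: w_def D(4)) simp
    ultimately show ?thesis using 0 by simp
  next
    case (Suc j)
    then show ?thesis using Ck_on_continuous[OF wC[OF that]] by simp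
  qed
  have main: "(LINT x:K \<epsilon>|lborel. w \<epsilon> 0 x * v x) + (LINT x:K1 \<epsilon>|lborel. w \<epsilon> m x * g x) \<le> Q"
    if \<epsilon>: "\<epsilon> > 0" for \<epsilon>
  proof -
    have K: "compact (K \<epsilon>)" "K \<epsilon> \<subseteq> S" and K1: "compact (K1 \<epsilon>)" "K1 \<epsilon> \<subseteq> S"
      unfolding K_def K1_def using \<epsilon> by - (rule compact_annulus | rule annulus_S | simp)+
    have "(LINT x:K \<epsilon>|lborel. w \<epsilon> m x * (laplacian ^^ m) v x) = (LINT x:K \<epsilon>|lborel. w \<epsilon> 0 x * v x)"
    proof (rule green_iterated[OF S K, of "{x. x \<bullet> x < \<epsilon>}" "{x. x \<bullet> x > 2}"])
      show "open {x::'a. x \<bullet> x < \<epsilon>}" "open {x::'a. x \<bullet> x > 2}"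
        by (intro open_Collect_less continuous_intros)+
      show "w \<epsilon> k x = 0" if "x \<in> {x. x \<bullet> x < \<epsilon>}" for k x
        using that \<epsilon> D(3)[of "x \<bullet> x / \<epsilon>" k] by (simp add: w_def)
      show "S - K \<epsilon> \<subseteq> {x. x \<bullet> x < \<epsilon>} \<union> {x. x \<bullet> x > 2}" by (auto simp: K_def)
      show "v x = 0" if "x \<in> {x. x \<bullet> x > 2}" for x using that \<psi>(4)[of x] by (simp add: v_def)
    qed (rule wC[OF \<epsilon>] wlap[OF \<epsilon>] Cv, assumption?)+
    moreover have "(LINT x:K \<epsilon>|lborel. w \<epsilon> m x * (laplacian ^^ m) v x)
        \<le> (LINT x|lborel. - (indicator (K1 \<epsilon>) x *\<^sub>R (w \<epsilon> m x * g x)) + indicator K2 x *\<^sub>R (W * M'))"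
      unfolding set_lebesgue_integral_def
    proof (rule integral_mono)
      have i1: "integrable lborel (\<lambda>x. indicator (K1 \<epsilon>) x *\<^sub>R (w \<epsilon> m x * g x))"
        by (intro borel_integrable_compact K1 continuous_intros continuous_on_subset[OF cw[OF \<epsilon>] K1(2)]
            continuous_on_subset[OF cg K1(2)])
      have i2: "integrable lborel (\<lambda>x. indicator K2 x *\<^sub>R (W * M'))"
        by (intro borel_integrable_compact K2 continuous_intros)
      show "integrable lborel (\<lambda>x. - (indicator (K1 \<epsilon>) x *\<^sub>R (w \<epsilon> m x * g x)) + indicator K2 x *\<^sub>R (W * M'))"
        by (intro Bochner_Integration.integrable_add Bochner_Integration.integrable_minus i1 i2)
      show "integrable lborel (\<lambda>x. indicator (K \<epsilon>) x *\<^sub>R (w \<epsilon> m x * (laplacian ^^ m) v x))"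
        by (intro borel_integrable_compact K continuous_intros continuous_on_subset[OF cw[OF \<epsilon>] K(2)]
            continuous_on_subset[OF cLv K(2)])
      fix x :: 'a
      show "indicator (K \<epsilon>) x *\<^sub>R (w \<epsilon> m x * (laplacian ^^ m) v x)
         \<le> - (indicator (K1 \<epsilon>) x *\<^sub>R (w \<epsilon> m x * g x)) + indicator K2 x *\<^sub>R (W * M')"
      proof (cases "x \<in> K1 \<epsilon>")
        case True
        then have "x \<in> K \<epsilon>" "x \<in> S" "x \<bullet> x < 1" using K1 by (auto simp: K_def K1_def)
        then show ?thesis using True Lv M'0 W0 by (simp add: indicator_def)
      next
        case False
        show ?thesis
        proof (cases "x \<in> K \<epsilon>")
          case True
          with False have x: "x \<in> K2" by (auto simp: K_def K1_def K2_def)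
          have "w \<epsilon> m x * (laplacian ^^ m) v x \<le> w \<epsilon> m x * M'"
            using MM'[OF x] w0[OF \<epsilon>] by (intro mult_left_mono) auto
          also have "\<dots> \<le> W * M'" using wm_up[OF \<epsilon> True] M'0 by (intro mult_right_mono)
          finally show ?thesis using True False x by simp
        next
          case False
          then show ?thesis using \<open>x \<notin> K1 \<epsilon>\<close> M'0 W0 by (simp add: indicator_def)
        qed
      qed
    qed
    moreover have "(LINT x|lborel. - (indicator (K1 \<epsilon>) x *\<^sub>R (w \<epsilon> m x * g x)) + indicator K2 x *\<^sub>R (W * M'))
       = - (LINT x:K1 \<epsilon>|lborel. w \<epsilon> m x * g x) + Q"
    proof -
      have i1: "integrable lborel (\<lambda>x. indicator (K1 \<epsilon>) x *\<^sub>R (w \<epsilon> m x * g x))"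
        by (intro borel_integrable_compact K1 continuous_intros continuous_on_subset[OF cw[OF \<epsilon>] K1(2)]
            continuous_on_subset[OF cg K1(2)])
      have i2: "integrable lborel (\<lambda>x. indicator K2 x *\<^sub>R (W * M'))"
        by (intro borel_integrable_compact K2 continuous_intros)
      have "(LINT x:K2|lborel. W * M') = Q"
        using emeasure_compact_finite[OF K2(1)] borel_compact[OF K2(1)]
        by (subst set_integral_const) (auto simp: Q_def)
      then show ?thesis
        using Bochner_Integration.integral_add[OF Bochner_Integration.integrable_minus[OF i1] i2]
        by (simp add: set_lebesgue_integral_def mult_ac)
    qed
    ultimately show ?thesis by linarith
  qed
  have part: "(LINT x:K \<epsilon>|lborel. w \<epsilon> 0 x * v x) \<le> Q" "(LINT x:K1 \<epsilon>|lborel. w \<epsilon> m x * g x) \<le> Q"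
    if \<epsilon>: "\<epsilon> > 0" for \<epsilon>
  proof -
    have "K \<epsilon> \<subseteq> S" "K1 \<epsilon> \<subseteq> S"
      unfolding K_def K1_def using \<epsilon> by - (rule compact_annulus | rule annulus_S | simp)+
    note sub = this
    have "(LINT x:K \<epsilon>|lborel. w \<epsilon> 0 x * v x) \<ge> 0" "(LINT x:K1 \<epsilon>|lborel. w \<epsilon> m x * g x) \<ge> 0"
      unfolding set_lebesgue_integral_def
      by (rule Bochner_Integration.integral_nonneg, use sub w0[OF \<epsilon>] v0 g0 in \<open>force simp: indicator_def\<close>)+
    then show "(LINT x:K \<epsilon>|lborel. w \<epsilon> 0 x * v x) \<le> Q" "(LINT x:K1 \<epsilon>|lborel. w \<epsilon> m x * g x) \<le> Q"
      using main[OF \<epsilon>] by auto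
  qed
  show ?thesis
  proof (rule that[of "max (Q * 4 ^ m / c) (Q * 25 ^ (m + 2) / 8)"])
    fix a :: real assume a: "0 < a"
    \<comment> \<open>With this scale the lower growth bound, valid from A \<epsilon> on, starts
      exactly at a.\<close>
    define \<epsilon> where "\<epsilon> = a / A"
    have \<epsilon>: "\<epsilon> > 0" "A * \<epsilon> = a" "\<epsilon> \<le> a" using a DC(4) by (auto simp: \<epsilon>_def field_simps)
    let ?Ka = "{x::'a. a \<le> x \<bullet> x \<and> x \<bullet> x \<le> 1/2}"
    have sub: "?Ka \<subseteq> K1 \<epsilon>" using \<epsilon>(3) by (auto simp: K1_def)
    have K1: "compact (K1 \<epsilon>)" "K1 \<epsilon> \<subseteq> S"
      unfolding K1_def using \<epsilon>(1) by - (rule compact_annulus | rule annulus_S | simp)+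
    have "(LINT x:?Ka|lborel. c / 4 ^ m * ((x \<bullet> x) ^ (m - 1) * g x)) \<le> (LINT x:K1 \<epsilon>|lborel. w \<epsilon> m x * g x)"
    proof (rule set_integral_mono_subset[OF _ _ sub])
      show "set_integrable lborel ?Ka (\<lambda>x. c / 4 ^ m * ((x \<bullet> x) ^ (m - 1) * g x))"
        by (intro set_integrable_compact compact_annulus continuous_intros continuous_on_subset[OF cg order.trans[OF sub K1(2)]])
      show "set_integrable lborel (K1 \<epsilon>) (\<lambda>x. w \<epsilon> m x * g x)"
        by (intro set_integrable_compact K1 continuous_intros continuous_on_subset[OF cw[OF \<epsilon>(1)] K1(2)]
            continuous_on_subset[OF cg K1(2)])
      show "c / 4 ^ m * ((x \<bullet> x) ^ (m - 1) * g x) \<le> w \<epsilon> m x * g x" if "x \<in> ?Ka" for x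
        using mult_right_mono[OF wm_low[OF \<epsilon>(1), of x] g0[of x]] that \<epsilon>(2) sub K1(2) by (auto simp: mult.assoc)
    qed (use w0[OF \<epsilon>(1)] g0 K1 in auto)
    then have "c / 4 ^ m * (LINT x:?Ka|lborel. (x \<bullet> x) ^ (m - 1) * g x) \<le> Q"
      using part(2)[OF \<epsilon>(1)] by simp
    then have "(LINT x:?Ka|lborel. (x \<bullet> x) ^ (m - 1) * g x) \<le> Q * 4 ^ m / c"
      using DC(3) by (simp add: field_simps)
    then show "(LINT x:?Ka|lborel. (x \<bullet> x) ^ (m - 1) * - (laplacian ^^ m) u x) \<le> max (Q * 4 ^ m / c) (Q * 25 ^ (m + 2) / 8)"
      by (simp add: g_def le_max_iff_disj)
  next
    fix \<epsilon> :: real assume \<epsilon>: "0 < \<epsilon>" "\<epsilon> \<le> 1/25"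
    \<comment> \<open>For \<epsilon> = r^2 / 16 this is the annulus of radii 3r/4 and 5r/4 that
      occurs in the pointwise estimate.\<close>
    let ?L = "{x::'a. 9 * \<epsilon> \<le> x \<bullet> x \<and> x \<bullet> x \<le> 25 * \<epsilon>}"
    have sub: "?L \<subseteq> K \<epsilon>" using \<epsilon> by (auto simp: K_def)
    have K: "compact (K \<epsilon>)" "K \<epsilon> \<subseteq> S"
      unfolding K_def using \<epsilon>(1) by - (rule compact_annulus | rule annulus_S | simp)+
    have "(LINT x:?L|lborel. 8 / 25 ^ (m + 2) / \<epsilon> * u x) \<le> (LINT x:K \<epsilon>|lborel. w \<epsilon> 0 x * v x)"
    proof (rule set_integral_mono_subset[OF _ _ sub])
      show "set_integrable lborel ?L (\<lambda>x. 8 / 25 ^ (m + 2) / \<epsilon> * u x)"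
        by (intro set_integrable_compact compact_annulus continuous_on_mult_left
            continuous_on_subset[OF cu order.trans[OF sub K(2)]])
      show "set_integrable lborel (K \<epsilon>) (\<lambda>x. w \<epsilon> 0 x * v x)"
        by (intro set_integrable_compact K continuous_on_mult continuous_on_subset[OF cw[OF \<epsilon>(1)] K(2)]
            continuous_on_subset[OF cv K(2)])
      show "8 / 25 ^ (m + 2) / \<epsilon> * u x \<le> w \<epsilon> 0 x * v x" if x: "x \<in> ?L" for x
      proof -
        have "v x = u x" using x \<epsilon> \<psi>(3)[of x] by (simp add: v_def)
        moreover have "v x \<ge> 0" using x sub K(2) v0 by auto
        ultimately show ?thesis using mult_right_mono[OF w0_low[OF \<epsilon>(1), of x]] x by simp
      qed
    qed (use w0[OF \<epsilon>(1)] v0 K in auto)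
    then have "8 / 25 ^ (m + 2) / \<epsilon> * (LINT x:?L|lborel. u x) \<le> Q"
      using part(1)[OF \<epsilon>(1)] by simp
    then have "(LINT x:?L|lborel. u x) \<le> Q * 25 ^ (m + 2) / 8 * \<epsilon>"
      using \<epsilon>(1) by (simp add: field_simps)
    also have "\<dots> \<le> max (Q * 4 ^ m / c) (Q * 25 ^ (m + 2) / 8) * \<epsilon>"
      using \<epsilon>(1) by (intro mult_right_mono) auto
    finally show "(LINT x:?L|lborel. u x) \<le> max (Q * 4 ^ m / c) (Q * 25 ^ (m + 2) / 8) * \<epsilon>" .
  qed
qed

section \<open>Logarithmic potential bound\<close>

text \<open>A discrete layer-cake formula: the number of j with 4^j \<le> t exceeds the logarithm of
  t to base 4. Base 4 in the squared distance corresponds to halving radii.\<close>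

lemma ln_le_dyadic_count:
  fixes t :: real
  assumes "1 \<le> t" "t < 4 ^ N"
  shows "ln t \<le> (\<Sum>j<N. if 4 ^ j \<le> t then ln 4 else 0)"
  using assms(2)
proof (induction N)
  case 0
  then have "t < 1" by simp
  then show ?case using assms(1) by simp
next
  case (Suc N)
  show ?case
  proof (cases "t < 4 ^ N")
    case True
    then show ?thesis using Suc.IH by (simp add: add_increasing2)
  next
    case False
    then have "4 ^ j \<le> t" if "j < Suc N" for j
      using that power_increasing[of j N "4::real"] by linarith
    then have "(\<Sum>j<Suc N. if 4 ^ j \<le> t then ln 4 else 0) = (\<Sum>j<Suc N. ln (4::real))"
      by (intro sum.cong) auto
    also have "\<dots> = ln (4 ^ Suc N)" using ln_realpow[of "4::real" "Suc N"] by simp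
    finally show ?thesis using Suc.prems assms(1) by simp
  qed
qed

lemma mem_cball_inner:
  fixes x y :: "'a::euclidean_space"
  assumes "r \<ge> 0"
  shows "x \<in> cball y r \<longleftrightarrow> (x - y) \<bullet> (x - y) \<le> r\<^sup>2"
proof -
  have "x \<in> cball y r \<longleftrightarrow> norm (x - y) \<le> r" by (simp add: dist_norm norm_minus_commute)
  also have "\<dots> \<longleftrightarrow> norm (x - y) ^ 2 \<le> r\<^sup>2"
    using assms by (simp add: abs_le_square_iff[symmetric])
  finally show ?thesis by (simp add: power2_norm_eq_inner)
qed

text \<open>The layers are balls of radius \<tau> / 2^j, whose volumes form a convergent series;
  this makes the bound independent of \<delta>.\<close>

lemma log_integral_bound:
  fixes y :: "'a::euclidean_space"
  assumes \<tau>: "\<tau> > 0" and \<delta>: "\<delta> > 0"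
  shows "(LINT x:cball y \<tau>|lborel. max 0 (ln (\<tau>\<^sup>2 / ((x - y) \<bullet> (x - y) + \<delta>))))
     \<le> 2 * ln 4 * unit_ball_vol (real DIM('a)) * \<tau> ^ DIM('a)"
proof -
  let ?V = "unit_ball_vol (real DIM('a))"
  \<comment> \<open>The argument of the logarithm is at most \<tau>^2 / \<delta>, so finitely many
    layers suffice. N depends on \<delta>, the sum of the series does not.\<close>
  obtain N where N: "\<tau>\<^sup>2 / \<delta> < 4 ^ N" using real_arch_pow[of 4 "\<tau>\<^sup>2 / \<delta>"] by auto
  define h where "h = (\<lambda>x. max 0 (ln (\<tau>\<^sup>2 / ((x - y) \<bullet> (x - y) + \<delta>))))"
  have pw: "indicator (cball y \<tau>) x *\<^sub>R h x \<le> (\<Sum>j<N. indicator (cball y (\<tau> / 2 ^ j)) x *\<^sub>R ln 4)" for x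
  proof -
    define s where "s = (x - y) \<bullet> (x - y)"
    have s: "s \<ge> 0" by (simp add: s_def)
    define t where "t = \<tau>\<^sup>2 / (s + \<delta>)"
    have nn: "0 \<le> (\<Sum>j<N. indicator (cball y (\<tau> / 2 ^ j)) x *\<^sub>R ln (4::real))"
      by (intro sum_nonneg) auto
    show ?thesis
    proof (cases "t \<ge> 1")
      case False
      have "t > 0" using s \<delta> \<tau> by (auto simp: t_def)
      then have "h x = 0" using False by (simp add: h_def t_def s_def)
      then show ?thesis using nn by simp
    next
      case True
      have "t \<le> \<tau>\<^sup>2 / \<delta>" unfolding t_def using s \<delta> by (intro divide_left_mono) auto
      then have "t < 4 ^ N" using N by linarith
      then have "ln t \<le> (\<Sum>j<N. if 4 ^ j \<le> t then ln 4 else 0)" by (rule ln_le_dyadic_count[OF True])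
      also have "\<dots> \<le> (\<Sum>j<N. indicator (cball y (\<tau> / 2 ^ j)) x *\<^sub>R ln 4)"
      proof (intro sum_mono)
        fix j
        have "x \<in> cball y (\<tau> / 2 ^ j)" if "4 ^ j \<le> t"
        proof -
          have "4 ^ j * s \<le> 4 ^ j * (s + \<delta>)" using \<delta> by simp
          also have "\<dots> \<le> \<tau>\<^sup>2" using that s \<delta> by (simp add: t_def pos_le_divide_eq)
          finally have "s \<le> \<tau>\<^sup>2 / 4 ^ j" by (simp add: field_simps)
          also have "\<dots> = (\<tau> / 2 ^ j)\<^sup>2" by (simp add: power_divide power2_eq_square flip: power_mult_distrib)
          finally show ?thesis using \<tau> by (subst mem_cball_inner) (auto simp: s_def)
        qed
        then show "(if 4 ^ j \<le> t then ln 4 else 0) \<le> indicator (cball y (\<tau> / 2 ^ j)) x *\<^sub>R ln (4::real)"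
          by (auto simp: indicator_def)
      qed
      finally have "h x \<le> (\<Sum>j<N. indicator (cball y (\<tau> / 2 ^ j)) x *\<^sub>R ln 4)"
        using nn by (simp add: h_def t_def s_def)
      then show ?thesis using nn by (auto simp: indicator_def)
    qed
  qed
  have int_ind: "integrable lborel (\<lambda>x. indicator (cball y r) x *\<^sub>R ln (4::real))" for r
    by (intro borel_integrable_compact) auto
  have "continuous_on (cball y \<tau>) h"
    unfolding h_def using \<tau> \<delta>
    by (intro continuous_intros) (auto simp: add_nonneg_eq_0_iff intro: add_nonneg_pos less_imp_neq)
  then have int_h: "integrable lborel (\<lambda>x. indicator (cball y \<tau>) x *\<^sub>R h x)"
    by (intro borel_integrable_compact) auto
  have "(LINT x:cball y \<tau>|lborel. h x) \<le> (LINT x|lborel. (\<Sum>j<N. indicator (cball y (\<tau> / 2 ^ j)) x *\<^sub>R ln 4))"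
    unfolding set_lebesgue_integral_def
    by (intro integral_mono int_h Bochner_Integration.integrable_sum int_ind pw)
  also have "\<dots> = (\<Sum>j<N. LINT x|lborel. indicator (cball y (\<tau> / 2 ^ j)) x *\<^sub>R ln 4)"
    by (intro Bochner_Integration.integral_sum int_ind)
  also have "\<dots> = (\<Sum>j<N. ?V * (\<tau> / 2 ^ j) ^ DIM('a) * ln 4)"
    using \<tau> by (intro sum.cong refl) (simp add: content_cball)
  also have "\<dots> \<le> (\<Sum>j<N. (?V * \<tau> ^ DIM('a) * ln 4) * (1/2) ^ j)"
  proof (intro sum_mono)
    fix j
    have "(2::real) ^ j \<le> (2 ^ j) ^ DIM('a)" by (rule self_le_power) auto
    then have "\<tau> ^ DIM('a) / (2 ^ j) ^ DIM('a) \<le> \<tau> ^ DIM('a) / 2 ^ j"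
      using \<tau> by (intro divide_left_mono) auto
    then have "(\<tau> / 2 ^ j) ^ DIM('a) \<le> \<tau> ^ DIM('a) * (1/2) ^ j" by (simp add: power_divide)
    then have "?V * ln 4 * (\<tau> / 2 ^ j) ^ DIM('a) \<le> ?V * ln 4 * (\<tau> ^ DIM('a) * (1/2) ^ j)"
      by (intro mult_left_mono) auto
    then show "?V * (\<tau> / 2 ^ j) ^ DIM('a) * ln 4 \<le> ?V * \<tau> ^ DIM('a) * ln 4 * (1/2) ^ j"
      by (simp only: mult_ac)
  qed
  also have "\<dots> = (?V * \<tau> ^ DIM('a) * ln 4) * (\<Sum>j<N. (1/2) ^ j)" by (simp add: sum_distrib_left)
  also have "\<dots> \<le> (?V * \<tau> ^ DIM('a) * ln 4) * 2"
  proof (rule mult_left_mono)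
    have "(\<Sum>j<N. (1/2::real) ^ j) = 2 - 2 * (1/2) ^ N" by (induction N) (auto simp: field_simps)
    then show "(\<Sum>j<N. (1/2::real) ^ j) \<le> 2" by simp
    show "0 \<le> ?V * \<tau> ^ DIM('a) * ln 4" using \<tau> by simp
  qed
  finally show ?thesis by (simp add: h_def mult_ac)
qed

text \<open>Testing \<open>u\<close> against the truncated logarithm of \<open>|x - y|\<^sup>2 + \<delta>\<close>, whose polyharmonic Laplacian is,
  up to a bounded error, an approximate identity as \<open>\<delta>\<close> tends to 0. Oddness of \<open>m\<close> gives it the right sign.\<close>

lemma log_potential_bound:
  fixes u :: "'a::euclidean_space \<Rightarrow> real"
  assumes m: "m \<ge> 1" "odd m" and dim: "DIM('a) = 2 * m" and S: "open S"
    and smooth: "Ck_on (2 * m) S u"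
    and nonneg: "\<And>x. x \<in> S \<Longrightarrow> u x \<ge> 0"
    and super: "\<And>x. x \<in> S \<Longrightarrow> (laplacian ^^ m) u x \<le> 0"
  obtains c C where "c > 0" "C \<ge> 0"
    "\<And>y R \<tau> G. 0 < \<tau> \<Longrightarrow> \<tau> \<le> R \<Longrightarrow> cball y R \<subseteq> S \<Longrightarrow>
       (\<And>x. x \<in> cball y \<tau> \<Longrightarrow> - (laplacian ^^ m) u x \<le> G) \<Longrightarrow>
       c * u y \<le> C / R ^ (2 * m) * (LINT x:cball y R|lborel. u x)
         + 2 * ln (R / \<tau>) * (LINT x:cball y R|lborel. - (laplacian ^^ m) u x) + C * G * \<tau> ^ (2 * m)"
proof -
  obtain C where C: "C \<ge> 0"
    "\<And>a \<delta>. a > 0 \<Longrightarrow> \<delta> > 0 \<Longrightarrow> \<exists>K. deriv_chain (2 * m) {-\<delta><..} K \<and>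
       (\<forall>j s. s + \<delta> \<ge> a \<longrightarrow> K j s = 0) \<and>
       (\<forall>s\<ge>0. s + \<delta> < a \<longrightarrow> K 0 s \<le> ln (a / (s + \<delta>)) \<and>
          \<bar>radial_power m m K 0 s - (-1) ^ m * fact (2 * m - 1) * \<delta> ^ m / (s + \<delta>) ^ (2 * m)\<bar> \<le> C / a ^ m)"
    by (fact log_kernel[OF m(1)])
  define V where "V = unit_ball_vol (real DIM('a))"
  have V: "V > 0" by (simp add: V_def)
  define g where "g = (\<lambda>x. - (laplacian ^^ m) u x)"
  have g0: "g x \<ge> 0" if "x \<in> S" for x using super that by (simp add: g_def)
  have "Ck_on 0 S ((laplacian ^^ m) u)"
    using smooth by (intro Ck_on_iter_laplacian S) simp
  then have cg: "continuous_on S g" unfolding g_def by (auto simp: Ck_on_0 intro: continuous_intros)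
  have cu: "continuous_on S u" by (rule Ck_on_continuous[OF smooth])
  define F where "F = (fact (2 * m - 1) :: real)"
  have F: "F > 0" by (simp add: F_def)
  define Cf where "Cf = max (4 ^ m * C) (2 * ln 4 * V)"
  show ?thesis
  \<comment> \<open>\<open>F * V\<close> bounds from below, for every \<delta>, the mass of the
    approximate identity in the ball |x - y|^2 \<le> \<delta>. \<open>Cf\<close> covers both the
    Taylor error and the integral of the logarithm.\<close>
  proof (rule that[of "F * V" Cf])
    show "F * V > 0" using F V by simp
    show "Cf \<ge> 0" using C(1) by (simp add: Cf_def le_max_iff_disj)
    fix y R \<tau> G
    assume \<tau>: "0 < \<tau>" "\<tau> \<le> R" and sub: "cball y R \<subseteq> S"
      and G: "\<And>x. x \<in> cball y \<tau> \<Longrightarrow> - (laplacian ^^ m) u x \<le> G"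
    have R: "R > 0" using \<tau> by simp
    have yS: "y \<in> S" using sub R by auto
    have G0: "G \<ge> 0" using G[of y] g0[OF yS] \<tau> by (auto simp: g_def)
    define a where "a = R\<^sup>2"
    have a: "a > 0" using R by (simp add: a_def)
    have am: "a ^ m = R ^ (2 * m)" by (simp add: a_def power_mult)
    define Iu where "Iu = (LINT x:cball y R|lborel. u x)"
    define Ig where "Ig = (LINT x:cball y R|lborel. g x)"
    define sq where "sq = (\<lambda>x. (x - y) \<bullet> (x - y))"
    have sq0: "sq x \<ge> 0" for x by (simp add: sq_def)
    have csq: "continuous_on A sq" for A unfolding sq_def by (intro continuous_intros)
    have iu: "set_integrable lborel (cball y R) u"
      by (intro set_integrable_compact continuous_on_subset[OF cu sub]) simp
    have ig: "set_integrable lborel (cball y R) g"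
      by (intro set_integrable_compact continuous_on_subset[OF cg sub]) simp
    \<comment> \<open>The loss e comes from replacing \<open>u\<close> by \<open>u y\<close> on a
      small ball, by continuity; it is sent to 0 at the end.\<close>
    have key: "F * V * (u y - e) \<le> 4 ^ m * C / R ^ (2 * m) * Iu + 2 * ln (R / \<tau>) * Ig + 2 * ln 4 * V * G * \<tau> ^ (2 * m)"
      if e: "e > 0" for e
    proof -
      have "continuous (at y) u" using cu S yS by (simp add: continuous_on_eq_continuous_at)
      then obtain d where d: "d > 0" "\<And>x. dist x y < d \<Longrightarrow> dist (u x) (u y) < e"
        using e by (auto simp: continuous_at_eps_delta)
      define \<rho> where "\<rho> = min (d / 2) (R / 2)"
      have \<rho>: "\<rho> > 0" "\<rho> < d" "\<rho> \<le> R / 2" using d(1) R by (auto simp: \<rho>_def)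
      \<comment> \<open>The ball on which u \<ge> u y - e is thereby exactly |x - y|^2 \<le>
        \<delta>, and \<rho> \<le> R / 2 places it within the support of the kernel, where its
        formula applies.\<close>
      define \<delta> where "\<delta> = \<rho>\<^sup>2"
      have \<delta>: "\<delta> > 0" using \<rho> by (simp add: \<delta>_def)
      have \<delta>a: "2 * \<delta> < a"
      proof -
        have "\<rho>\<^sup>2 \<le> (R / 2)\<^sup>2" using \<rho> by (intro power_mono) auto
        then have "\<delta> \<le> a / 4" by (simp add: \<delta>_def a_def power_divide)
        then show ?thesis using a by linarith
      qed
      from C(2)[OF a \<delta>] obtain K where K: "deriv_chain (2 * m) {-\<delta><..} K"
        "\<And>j s. s + \<delta> \<ge> a \<Longrightarrow> K j s = 0"
        "\<And>s. 0 \<le> s \<Longrightarrow> s + \<delta> < a \<Longrightarrow> K 0 s \<le> ln (a / (s + \<delta>))"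
        "\<And>s. 0 \<le> s \<Longrightarrow> s + \<delta> < a \<Longrightarrow>
           \<bar>radial_power m m K 0 s - (-1) ^ m * fact (2 * m - 1) * \<delta> ^ m / (s + \<delta>) ^ (2 * m)\<bar> \<le> C / a ^ m"
        by blast
      \<comment> \<open>Indexed for \<open>green_iterated\<close>: \<open>w m\<close> is the kernel,
        and \<open>w j\<close> is its Laplacian iterated m - j times, with a factor 4 for
        each.\<close>
      define w where "w = (\<lambda>j x. 4 ^ (m - j) * radial_power m (m - j) K 0 (sq x))"
      have sq\<delta>: "- \<delta> < sq x" for x using \<delta> less_le_trans[OF _ sq0[of x], of "- \<delta>"] by simp
      have wm: "w m x = K 0 (sq x)" for x
        by (simp add: w_def radial_power_def radial_coeff_def)
      have sqT: "(x - y) \<bullet> (x - y) \<in> {-\<delta><..}" for x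
          using \<delta> less_le_trans[of "- \<delta>" 0 "(x - y) \<bullet> (x - y)"] by simp
      have ch: "deriv_chain 2 {-\<delta><..} (radial_power m k K)" if "k < m" for k
        by (rule deriv_chain_radial_power[OF K(1) that])
      have w0eq: "w 0 x = 4 ^ m * radial_power m m K 0 (sq x)" for x by (simp add: w_def)
      have green: "(LINT x:cball y R|lborel. w m x * (laplacian ^^ m) u x) = (LINT x:cball y R|lborel. w 0 x * u x)"
      \<comment> \<open>The kernel itself vanishes outside the ball, so \<open>u\<close> needs no
        cut-off and the second zero set is empty.\<close>
      proof (rule green_iterated[OF S compact_cball sub, of "{x. sq x + \<delta> > a}" "{}"])
        show "open {x. sq x + \<delta> > a}" unfolding sq_def by (intro open_Collect_less continuous_intros)
        show "S - cball y R \<subseteq> {x. sq x + \<delta> > a} \<union> {}"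
        proof
          fix x assume "x \<in> S - cball y R"
          then have "\<not> (x - y) \<bullet> (x - y) \<le> R\<^sup>2" using R mem_cball_inner[of R x y] by auto
          then show "x \<in> {x. sq x + \<delta> > a} \<union> {}" using \<delta> by (simp add: sq_def a_def)
        qed
        show "w k x = 0" if "x \<in> {x. sq x + \<delta> > a}" for k x
          using that K(2) by (simp add: w_def radial_power_def)
        fix k assume k: "k < m"
        then have k': "m - Suc k < m" by simp
        have w: "w (Suc k) = (\<lambda>x. 4 ^ (m - Suc k) * radial_power m (m - Suc k) K 0 ((x - y) \<bullet> (x - y)))"
          by (simp add: w_def sq_def)
        have ch': "deriv_chain 2 {-\<delta><..} (\<lambda>j s. 4 ^ (m - Suc k) * radial_power m (m - Suc k) K j s)"
          using ch[OF k'] unfolding deriv_chain_def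
          by (auto intro!: DERIV_cmult continuous_intros)
        show "Ck_on 2 S (w (Suc k))"
          unfolding w by (rule Ck_on_compose[OF S ch' Ck_on_norm_squared[OF S] sqT])
        fix x assume x: "x \<in> S"
        have "laplacian (w (Suc k)) x = 4 * sq x * (4 ^ (m - Suc k) * radial_power m (m - Suc k) K 2 (sq x))
           + 2 * real DIM('a) * (4 ^ (m - Suc k) * radial_power m (m - Suc k) K 1 (sq x))"
          unfolding w sq_def by (rule laplacian_radial[OF S ch' sqT x])
        also have "\<dots> = 4 ^ Suc (m - Suc k) * (sq x * radial_power m (m - Suc k) K 2 (sq x)
           + real m * radial_power m (m - Suc k) K 1 (sq x))"
          by (simp add: dim algebra_simps)
        also have "\<dots> = w k x"
          unfolding radial_power_Suc[OF m(1)] using k by (simp add: w_def Suc_diff_Suc)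
        finally show "laplacian (w (Suc k)) x = w k x" .
      qed (use smooth in auto)
      have cK: "continuous_on (cball y R) (\<lambda>x. K 0 (sq x))"
        by (rule continuous_on_compose2[OF deriv_chain_continuous[OF K(1), of 0] csq])
           (use sq\<delta> in auto)
      have cw0: "continuous_on (cball y R) (w 0)"
      proof -
        have "continuous_on {-\<delta><..} (K j)" if "j \<le> 2 * m" for j
          using deriv_chain_continuous[OF K(1) that] .
        then have "continuous_on {-\<delta><..} (radial_power m m K 0)"
          unfolding radial_power_def by (auto intro!: continuous_intros)
        then have "continuous_on (cball y R) (\<lambda>x. radial_power m m K 0 (sq x))"
          by (rule continuous_on_compose2[OF _ csq]) (use sq\<delta> in auto)
        then show ?thesis unfolding w0eq by (intro continuous_intros)
      qed
      have "(LINT x:cball y R|lborel. K 0 (sq x) * g x) = (LINT x:cball y R|lborel. - w 0 x * u x)"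
        using green by (simp add: wm g_def set_lebesgue_integral_def)
      moreover have "F / \<delta> ^ m * (u y - e) * (V * \<rho> ^ (2 * m)) - 4 ^ m * C / a ^ m * Iu
          \<le> (LINT x:cball y R|lborel. - w 0 x * u x)"
      proof -
        have i1: "integrable lborel (\<lambda>x. indicator (cball y \<rho>) x *\<^sub>R (F / \<delta> ^ m * (u y - e)))"
          by (intro borel_integrable_compact) auto
        have i2: "integrable lborel (\<lambda>x. indicator (cball y R) x *\<^sub>R (4 ^ m * C / a ^ m * u x))"
          by (intro borel_integrable_compact continuous_intros continuous_on_subset[OF cu sub]) simp
        have "(LINT x|lborel. indicator (cball y \<rho>) x *\<^sub>R (F / \<delta> ^ m * (u y - e))
             - indicator (cball y R) x *\<^sub>R (4 ^ m * C / a ^ m * u x))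
          \<le> (LINT x:cball y R|lborel. - w 0 x * u x)"
          unfolding set_lebesgue_integral_def
        proof (rule integral_mono[OF Bochner_Integration.integrable_diff[OF i1 i2]])
          show "integrable lborel (\<lambda>x. indicator (cball y R) x *\<^sub>R (- w 0 x * u x))"
            by (intro borel_integrable_compact continuous_intros cw0 continuous_on_subset[OF cu sub]) simp
          fix x
          show "indicator (cball y \<rho>) x *\<^sub>R (F / \<delta> ^ m * (u y - e))
             - indicator (cball y R) x *\<^sub>R (4 ^ m * C / a ^ m * u x) \<le> indicator (cball y R) x *\<^sub>R (- w 0 x * u x)"
          proof (cases "x \<in> cball y R")
            case False
            then have "x \<notin> cball y \<rho>" using \<rho> R by auto
            then show ?thesis using False by simp
          next
            case True
            then have ux: "u x \<ge> 0" using nonneg sub by auto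
            let ?P = "4 ^ m * F * \<delta> ^ m / (sq x + \<delta>) ^ (2 * m)"
            have P0: "?P \<ge> 0" using F \<delta> sq0[of x] by simp
            have low: "- w 0 x \<ge> ?P - 4 ^ m * C / a ^ m" if "sq x + \<delta> < a"
            proof -
              \<comment> \<open>Oddness of m enters here: (-1)^m = -1 makes the main part of
                \<open>- w 0\<close> positive.\<close>
              have "- radial_power m m K 0 (sq x) \<ge> F * \<delta> ^ m / (sq x + \<delta>) ^ (2 * m) - C / a ^ m"
                using K(4)[OF sq0 that] m(2) unfolding F_def by (simp add: abs_le_iff)
              then have "4 ^ m * (F * \<delta> ^ m / (sq x + \<delta>) ^ (2 * m) - C / a ^ m) \<le> 4 ^ m * - radial_power m m K 0 (sq x)"
                by (intro mult_left_mono) auto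
              then show ?thesis by (simp add: w0eq right_diff_distrib mult.assoc)
            qed
            have low': "- w 0 x \<ge> - (4 ^ m * C / a ^ m)"
            proof (cases "sq x + \<delta> < a")
              case True
              then show ?thesis using low P0 by linarith
            next
              case False
              then have "w 0 x = 0" using K(2) by (simp add: w0eq radial_power_def)
              then show ?thesis using C(1) a by simp
            qed
            show ?thesis
            proof (cases "x \<in> cball y \<rho>")
              case False
              then show ?thesis using True mult_right_mono[OF low' ux] by simp
            next
              case xr: True
              then have s: "sq x \<le> \<delta>" using mem_cball_inner[of \<rho> x y] \<rho> by (simp add: sq_def \<delta>_def)
              \<comment> \<open>On the small ball sq + \<delta> \<le> 2 \<delta>. The factor 4^m so
                arising cancels that of \<open>w 0\<close>, and 1 / \<delta>^m will cancel the power
                \<rho>^(2m) in the volume of the ball.\<close>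
              have "F / \<delta> ^ m = 4 ^ m * F * \<delta> ^ m / (2 * \<delta>) ^ (2 * m)"
              proof -
                have "(2 * \<delta>) ^ (2 * m) = ((2 * \<delta>)\<^sup>2) ^ m" by (rule power_mult)
                also have "(2 * \<delta>)\<^sup>2 = 4 * (\<delta> * \<delta>)" by (simp add: power2_eq_square)
                finally have "(2 * \<delta>) ^ (2 * m) = 4 ^ m * (\<delta> ^ m * \<delta> ^ m)"
                  by (simp only: power_mult_distrib)
                then show ?thesis using \<delta> by simp
              qed
              also have "\<dots> \<le> ?P"
                using s sq0[of x] \<delta> F by (intro divide_left_mono power_mono mult_pos_pos zero_less_power) auto
              finally have "F / \<delta> ^ m - 4 ^ m * C / a ^ m \<le> - w 0 x"
                using low s \<delta>a by linarith
              then have "(F / \<delta> ^ m - 4 ^ m * C / a ^ m) * u x \<le> - w 0 x * u x"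
                using ux by (rule mult_right_mono)
              moreover have "u y - e \<le> u x"
              proof -
                have "dist x y < d" using xr \<rho> by (simp add: dist_commute)
                then show ?thesis using d(2)[of x] by (simp add: dist_real_def)
              qed
              then have "F / \<delta> ^ m * (u y - e) \<le> F / \<delta> ^ m * u x"
                using F \<delta> by (intro mult_left_mono) auto
              ultimately show ?thesis using True xr by (simp add: left_diff_distrib)
            qed
          qed
        qed
        moreover have "(LINT x|lborel. indicator (cball y \<rho>) x *\<^sub>R (F / \<delta> ^ m * (u y - e))
             - indicator (cball y R) x *\<^sub>R (4 ^ m * C / a ^ m * u x))
           = F / \<delta> ^ m * (u y - e) * (V * \<rho> ^ (2 * m)) - 4 ^ m * C / a ^ m * Iu"
        proof -
          have "(LINT x|lborel. indicator (cball y \<rho>) x *\<^sub>R (F / \<delta> ^ m * (u y - e)))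
              = F / \<delta> ^ m * (u y - e) * (V * \<rho> ^ (2 * m))"
            using \<rho>(1) by (simp add: content_cball V_def dim)
          moreover have "(LINT x|lborel. indicator (cball y R) x *\<^sub>R (4 ^ m * C / a ^ m * u x)) = 4 ^ m * C / a ^ m * Iu"
            using set_integral_mult_right[of lborel "cball y R" "4 ^ m * C / a ^ m" u]
            by (simp only: Iu_def set_lebesgue_integral_def)
          ultimately show ?thesis by (simp only: Bochner_Integration.integral_diff[OF i1 i2])
        qed
        ultimately show ?thesis by simp
      qed
      moreover have "(LINT x:cball y R|lborel. K 0 (sq x) * g x)
          \<le> 2 * ln (R / \<tau>) * Ig + 2 * ln 4 * V * G * \<tau> ^ (2 * m)"
      proof -
        \<comment> \<open>The logarithm splits into 2 ln (R / \<tau>) and ln (\<tau>^2 / (sq +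
          \<delta>)). The first is charged to the total mass of g; the second is positive only
          within distance \<tau> of y and is charged to the pointwise bound G.\<close>
        let ?h = "\<lambda>x. max 0 (ln (\<tau>\<^sup>2 / (sq x + \<delta>)))"
        have lnR: "2 * ln (R / \<tau>) \<ge> 0" using \<tau> by simp
        have i1: "integrable lborel (\<lambda>x. indicator (cball y R) x *\<^sub>R (2 * ln (R / \<tau>) * g x))"
          by (intro borel_integrable_compact continuous_intros continuous_on_subset[OF cg sub]) simp
        have "sq x + \<delta> \<noteq> 0" "\<tau>\<^sup>2 / (sq x + \<delta>) \<noteq> 0" for x
          using sq0[of x] \<delta> \<tau> by auto
        then have "continuous_on (cball y \<tau>) (\<lambda>x. G * ?h x)"
          by (intro continuous_intros csq) auto
        then have i2: "integrable lborel (\<lambda>x. indicator (cball y \<tau>) x *\<^sub>R (G * ?h x))"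
          by (intro borel_integrable_compact) auto
        have "(LINT x:cball y R|lborel. K 0 (sq x) * g x)
          \<le> (LINT x|lborel. indicator (cball y R) x *\<^sub>R (2 * ln (R / \<tau>) * g x) + indicator (cball y \<tau>) x *\<^sub>R (G * ?h x))"
          unfolding set_lebesgue_integral_def
        proof (rule integral_mono[OF _ Bochner_Integration.integrable_add[OF i1 i2]])
          show "integrable lborel (\<lambda>x. indicator (cball y R) x *\<^sub>R (K 0 (sq x) * g x))"
            by (intro borel_integrable_compact continuous_intros cK continuous_on_subset[OF cg sub]) simp
          fix x
          have hG: "0 \<le> indicator (cball y \<tau>) x *\<^sub>R (G * ?h x)" using G0 by (simp add: indicator_def)
          show "indicator (cball y R) x *\<^sub>R (K 0 (sq x) * g x)
             \<le> indicator (cball y R) x *\<^sub>R (2 * ln (R / \<tau>) * g x) + indicator (cball y \<tau>) x *\<^sub>R (G * ?h x)"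
          proof (cases "x \<in> cball y R")
            case False
            then show ?thesis using hG by simp
          next
            case True
            then have gx: "g x \<ge> 0" using g0 sub by auto
            have "K 0 (sq x) * g x \<le> 2 * ln (R / \<tau>) * g x + indicator (cball y \<tau>) x *\<^sub>R (G * ?h x)"
            proof (cases "sq x + \<delta> < a")
              case False
              then show ?thesis using K(2)[of "sq x" 0] hG lnR gx by simp
            next
              case lt: True
              have p: "sq x + \<delta> > 0" using sq0[of x] \<delta> by simp
              have Kle: "K 0 (sq x) \<le> ln (a / (sq x + \<delta>))" by (rule K(3)[OF sq0 lt])
              have lna: "ln (a / \<tau>\<^sup>2) = 2 * ln (R / \<tau>)"
                using R \<tau> by (simp add: a_def ln_div ln_realpow)
              show ?thesis
              proof (cases "x \<in> cball y \<tau>")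
                case False
                then have "sq x > \<tau>\<^sup>2" using mem_cball_inner[of \<tau> x y] \<tau> by (simp add: sq_def)
                then have "a / (sq x + \<delta>) \<le> a / \<tau>\<^sup>2" using \<delta> \<tau> a p
                  by (intro divide_left_mono mult_pos_pos) auto
                moreover have "0 < a / (sq x + \<delta>)" "0 < a / \<tau>\<^sup>2" using a p \<tau> by auto
                ultimately have "ln (a / (sq x + \<delta>)) \<le> ln (a / \<tau>\<^sup>2)" by (simp only: ln_le_cancel_iff)
                then have "K 0 (sq x) * g x \<le> 2 * ln (R / \<tau>) * g x"
                  using Kle lna gx by (intro mult_right_mono) auto
                then show ?thesis using False by simp
              next
                case xt: True
                have "ln (a / (sq x + \<delta>)) = ln (a / \<tau>\<^sup>2) + ln (\<tau>\<^sup>2 / (sq x + \<delta>))"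
                  using a p \<tau> by (simp add: ln_div)
                then have "K 0 (sq x) \<le> 2 * ln (R / \<tau>) + ?h x" using Kle lna by simp
                then have "K 0 (sq x) * g x \<le> (2 * ln (R / \<tau>) + ?h x) * g x" using gx by (rule mult_right_mono)
                also have "\<dots> \<le> 2 * ln (R / \<tau>) * g x + ?h x * G"
                proof -
                  have "g x \<le> G" using G[OF xt] by (simp add: g_def)
                  then have "?h x * g x \<le> ?h x * G" by (rule mult_left_mono) simp
                  then show ?thesis by (simp only: distrib_right add_left_mono)
                qed
                finally show ?thesis using xt by (simp add: mult.commute)
              qed
            qed
            then show ?thesis using True by simp
          qed
        qed
        also have "\<dots> = 2 * ln (R / \<tau>) * Ig + G * (LINT x:cball y \<tau>|lborel. ?h x)"
          using set_integral_mult_right[of lborel "cball y R" "2 * ln (R / \<tau>)" g]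
            set_integral_mult_right[of lborel "cball y \<tau>" G ?h]
          by (simp only: Ig_def set_lebesgue_integral_def Bochner_Integration.integral_add[OF i1 i2])
        also have "G * (LINT x:cball y \<tau>|lborel. ?h x) \<le> G * (2 * ln 4 * V * \<tau> ^ (2 * m))"
          using log_integral_bound[OF \<tau>(1) \<delta>, of y] G0 unfolding V_def sq_def dim
          by (intro mult_left_mono)
        finally show ?thesis by (simp add: mult_ac)
      qed
      moreover have "F / \<delta> ^ m * (u y - e) * (V * \<rho> ^ (2 * m)) = F * V * (u y - e)"
      proof -
        have "\<rho> ^ (2 * m) = \<delta> ^ m" by (simp add: \<delta>_def power_mult)
        then show ?thesis using \<delta> by simp
      qed
      ultimately show ?thesis by (simp add: am)
    qed
    have "F * V * u y \<le> 4 ^ m * C / R ^ (2 * m) * Iu + 2 * ln (R / \<tau>) * Ig + 2 * ln 4 * V * G * \<tau> ^ (2 * m)"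
    proof (rule field_le_epsilon)
      fix e :: real assume "e > 0"
      then have "e / (F * V) > 0" using F V by simp
      from key[OF this] show "F * V * u y \<le> 4 ^ m * C / R ^ (2 * m) * Iu + 2 * ln (R / \<tau>) * Ig
          + 2 * ln 4 * V * G * \<tau> ^ (2 * m) + e"
        using F V by (simp add: right_diff_distrib)
    qed
    also have "4 ^ m * C / R ^ (2 * m) * Iu \<le> Cf / R ^ (2 * m) * Iu"
    proof (intro mult_right_mono divide_right_mono)
      show "Iu \<ge> 0" unfolding Iu_def set_lebesgue_integral_def
        using nonneg sub by (intro Bochner_Integration.integral_nonneg) (auto simp: indicator_def)
    qed (use R in \<open>auto simp: Cf_def\<close>)
    also have "2 * ln 4 * V * G * \<tau> ^ (2 * m) \<le> Cf * G * \<tau> ^ (2 * m)"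
      using \<tau> G0 by (intro mult_right_mono) (auto simp: Cf_def)
    finally show "F * V * u y \<le> Cf / R ^ (2 * m) * (LINT x:cball y R|lborel. u x)
         + 2 * ln (R / \<tau>) * (LINT x:cball y R|lborel. - (laplacian ^^ m) u x) + Cf * G * \<tau> ^ (2 * m)"
      by (simp add: Iu_def Ig_def g_def)
  qed
qed

section \<open>Pointwise growth\<close>

text \<open>The integrals over growing annuli are monotone and bounded. Once one of them is within
  \<eta> of the supremum, any annulus further inside, being disjoint from it, can add at most
  \<eta>.\<close>

lemma integral_tail_vanishes:
  fixes h :: "'a::euclidean_space \<Rightarrow> real"
  assumes cont: "continuous_on (ball 0 2 - {0}) h"
    and nonneg: "\<And>x. x \<in> ball 0 2 - {0} \<Longrightarrow> h x \<ge> 0"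
    and bound: "\<And>a. 0 < a \<Longrightarrow> (LINT x:{x. a \<le> x \<bullet> x \<and> x \<bullet> x \<le> 1/2}|lborel. h x) \<le> C"
    and \<eta>: "\<eta> > 0"
  obtains r where "r > 0"
    "\<And>a b. 0 < a \<Longrightarrow> b \<le> r \<Longrightarrow> (LINT x:{x. a \<le> x \<bullet> x \<and> x \<bullet> x \<le> b}|lborel. h x) \<le> \<eta>"
proof -
  define \<Phi> where "\<Phi> = (\<lambda>a. LINT x:{x. a \<le> x \<bullet> x \<and> x \<bullet> x \<le> 1/2}|lborel. h x)"
  have bdd: "bdd_above (\<Phi> ` {0<..})" using bound by (auto simp: \<Phi>_def bdd_above_def)
  have "(SUP a\<in>{0<..}. \<Phi> a) - \<eta> < (SUP a\<in>{0<..}. \<Phi> a)" using \<eta> by simp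
  then obtain a0 where a0: "a0 > 0" "(SUP a\<in>{0<..}. \<Phi> a) - \<eta> < \<Phi> a0"
    using less_cSUP_iff[OF _ bdd] by (metis empty_iff greaterThan_iff zero_less_one)
  have int: "integrable lborel (\<lambda>x. indicator {x. a \<le> x \<bullet> x \<and> x \<bullet> x \<le> b} x *\<^sub>R h x)" if "0 < a" "b < 4" for a b
    by (rule borel_integrable_compact[OF compact_annulus continuous_on_subset[OF cont annulus_subset_punctured_ball[OF that]]])
  show ?thesis
  \<comment> \<open>Half of a0 makes the two annuli disjoint, and 1/4 keeps the inner one below the
    common outer bound 1/2.\<close>
  proof (rule that[of "min (a0 / 2) (1/4)"])
    show "min (a0 / 2) (1/4) > 0" using a0 by simp
    fix a b :: real assume a: "0 < a" and b: "b \<le> min (a0 / 2) (1/4)"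
    define a' where "a' = min a a0"
    have a': "a' > 0" using a a0 by (simp add: a'_def)
    let ?I = "\<lambda>a b x. indicator {x. a \<le> x \<bullet> x \<and> x \<bullet> x \<le> b} (x::'a) *\<^sub>R h x"
    have b4: "b < 4" "(1/2::real) < 4" using b by auto
    have "(LINT x|lborel. ?I a b x + ?I a0 (1/2) x) \<le> (LINT x|lborel. ?I a' (1/2) x)"
    proof (rule integral_mono)
      show "integrable lborel (\<lambda>x. ?I a b x + ?I a0 (1/2) x)"
        by (intro Bochner_Integration.integrable_add int a a0 b4)
      show "integrable lborel (?I a' (1/2))" by (intro int a' b4)
      fix x :: 'a
      have "0 \<le> ?I a' (1/2) x"
        using nonneg[OF subsetD[OF annulus_subset_punctured_ball[OF a' b4(2)], of x]]
        by (cases "x \<in> {x. a' \<le> x \<bullet> x \<and> x \<bullet> x \<le> 1/2}") (simp_all only: indicator_simps, simp_all)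
      then show "?I a b x + ?I a0 (1/2) x \<le> ?I a' (1/2) x"
        using a0(1) b by (auto simp: indicator_def a'_def min_def split: if_splits)
    qed
    moreover have "(LINT x|lborel. ?I a b x + ?I a0 (1/2) x)
        = (LINT x:{x. a \<le> x \<bullet> x \<and> x \<bullet> x \<le> b}|lborel. h x) + \<Phi> a0"
      unfolding \<Phi>_def set_lebesgue_integral_def
      by (rule Bochner_Integration.integral_add[OF int[OF a b4(1)] int[OF a0(1) b4(2)]])
    moreover have "(LINT x|lborel. ?I a' (1/2) x) = \<Phi> a'" by (simp add: \<Phi>_def set_lebesgue_integral_def)
    moreover have "\<Phi> a' \<le> (SUP a\<in>{0<..}. \<Phi> a)" using a' by (intro cSUP_upper bdd) auto
    ultimately show "(LINT x:{x. a \<le> x \<bullet> x \<and> x \<bullet> x \<le> b}|lborel. h x) \<le> \<eta>"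
      using a0(2) by linarith
  qed
qed

text \<open>The growth hypothesis says nothing about bounded t; there f is bounded by continuity,
  and the summand 1 in the exponent absorbs that bound.\<close>

lemma exp_growth_bound:
  fixes f :: "real \<Rightarrow> real"
  assumes cont: "continuous_on {0..} f" and nonneg: "\<forall>t\<ge>0. f t \<ge> 0"
    and growth: "(\<lambda>t. ln (1 + f t)) \<in> O[at_top](\<lambda>t. t powr lam)"
  obtains B where "B \<ge> 0" "\<And>t. t \<ge> 0 \<Longrightarrow> f t \<le> exp (B * (1 + t powr lam))"
proof -
  obtain c where "c > 0" "\<forall>\<^sub>F t in at_top. norm (ln (1 + f t)) \<le> c * norm (t powr lam)"
    using landau_o.bigE[OF growth] by blast
  then obtain t0 where c: "c > 0" "\<And>t. t \<ge> t0 \<Longrightarrow> \<bar>ln (1 + f t)\<bar> \<le> c * t powr lam"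
    by (auto simp: eventually_at_top_linorder)
  have "bounded (f ` {0..t0})"
    by (intro compact_imp_bounded compact_continuous_image continuous_on_subset[OF cont]) auto
  then obtain M where M: "\<forall>t\<in>{0..t0}. \<bar>f t\<bar> \<le> M" by (auto simp: bounded_iff)
  define B where "B = max c (max M 0)"
  show ?thesis
  proof (rule that[of B])
    show B0: "B \<ge> 0" by (simp add: B_def)
    fix t :: real assume t: "t \<ge> 0"
    have f0: "f t \<ge> 0" using nonneg t by simp
    show "f t \<le> exp (B * (1 + t powr lam))"
    proof (cases "t \<ge> t0")
      case True
      have "1 + f t = exp (ln (1 + f t))" using f0 by simp
      also have "\<dots> \<le> exp (c * t powr lam)" using c(2)[OF True] by simp
      also have "c * t powr lam \<le> B * (1 + t powr lam)"
        using c(1) by (intro mult_mono) (auto simp: B_def)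
      finally show ?thesis by simp
    next
      case False
      then have "f t \<le> B" using bspec[OF M, of t] t by (auto simp: B_def)
      also have "B \<le> B * (1 + t powr lam)" using B0 mult_left_mono[of 1 "1 + t powr lam" B] by simp
      also have "\<dots> \<le> exp (B * (1 + t powr lam))" using exp_ge_add_one_self[of "B * (1 + t powr lam)"] by linarith
      finally show ?thesis .
    qed
  qed
qed

text \<open>The point \<open>y\<close> maximising \<open>u y (R - |y - x\<^sub>0|)\<close> replaces \<open>x\<^sub>0\<close>, so that \<open>u \<le> 2 u y\<close> on a ball around \<open>y\<close>
  whose radius is only polynomially small in \<open>u y\<close>.\<close>

lemma doubling_point:
  fixes u :: "'a::euclidean_space \<Rightarrow> real"
  assumes R: "R > 0" and cont: "continuous_on (cball x0 R) u"
    and nonneg: "\<And>x. x \<in> cball x0 R \<Longrightarrow> u x \<ge> 0" and u1: "u x0 \<ge> 1"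
  obtains y d where "y \<in> cball x0 R" "0 < d" "d \<le> R" "u y \<ge> u x0" "R \<le> d * u y"
    "\<And>z. z \<in> cball y (d / 2) \<Longrightarrow> z \<in> cball x0 R \<and> u z \<le> 2 * u y"
proof -
  have "continuous_on (cball x0 R) (\<lambda>y. u y * (R - dist x0 y))"
    using cont by (intro continuous_intros)
  then obtain y where y: "y \<in> cball x0 R"
    "\<And>z. z \<in> cball x0 R \<Longrightarrow> u z * (R - dist x0 z) \<le> u y * (R - dist x0 y)"
    using continuous_attains_sup[of "cball x0 R" "\<lambda>y. u y * (R - dist x0 y)"] R by auto
  define d where "d = R - dist x0 y"
  have base: "u x0 * R \<le> u y * d" using y(2)[of x0] R by (simp add: d_def)
  have uR: "R \<le> u x0 * R" using u1 R by simp
  have "d \<ge> 0" using y(1) by (simp add: d_def)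
  moreover have "d \<noteq> 0"
  proof
    assume "d = 0"
    then have "u x0 * R \<le> 0" using base by simp
    then show False using uR R by linarith
  qed
  ultimately have d: "0 < d" "d \<le> R" by (auto simp: d_def)
  have "u y * d \<le> u y * R" using d nonneg[OF y(1)] by (intro mult_left_mono)
  then have "u x0 * R \<le> u y * R" using base by linarith
  then have uy: "u x0 \<le> u y" using R by simp
  show ?thesis
  proof (rule that[OF y(1) d uy])
    show "R \<le> d * u y" using base uR by (simp add: mult.commute)
    fix z assume z: "z \<in> cball y (d / 2)"
    have "dist x0 z \<le> dist x0 y + dist y z" by (rule dist_triangle)
    \<comment> \<open>The distance to the boundary of the large ball is at least d / 2 here, against
      d at y; maximality then gives the factor 2.\<close>
    then have dz: "d / 2 \<le> R - dist x0 z" using z by (simp add: d_def field_simps)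
    then have zR: "z \<in> cball x0 R" using d by simp
    have "u z * (d / 2) \<le> u z * (R - dist x0 z)" using dz nonneg[OF zR] by (rule mult_left_mono)
    also have "\<dots> \<le> u y * d" using y(2)[OF zR] by (simp add: d_def)
    finally show "z \<in> cball x0 R \<and> u z \<le> 2 * u y" using zR d by (simp add: field_simps)
  qed
qed

text \<open>If U \<le> 4 A X, the claim holds because 1 / (1 - \<lambda>) > 1 and X is large.
  Otherwise A X + A is at most U / 2 and is absorbed, leaving U \<le> 2 A \<eta> X U^\<lambda>; the
  value of \<eta> is chosen so that 2 A \<eta> = \<epsilon>^(1-\<lambda>).\<close>

lemma sublinear_absorption:
  fixes A X U lam \<eta> \<epsilon> :: real
  assumes lam: "0 < lam" "lam < 1" and A: "A > 0" and \<epsilon>: "\<epsilon> > 0"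
    and \<eta>: "\<eta> = \<epsilon> powr (1 - lam) / (2 * A)" and X: "X \<ge> 1" "X \<ge> (4 * A / \<epsilon>) powr ((1 - lam) / lam)"
    and U: "U \<ge> 1" "U \<le> A * X + A * \<eta> * X * U powr lam + A"
  shows "U \<le> \<epsilon> * X powr (1 / (1 - lam))"
proof (cases "U \<le> 4 * A * X")
  case True
  have "4 * A / \<epsilon> = ((4 * A / \<epsilon>) powr ((1 - lam) / lam)) powr (lam / (1 - lam))"
    using lam A \<epsilon> by (simp add: powr_powr)
  also have "\<dots> \<le> X powr (lam / (1 - lam))" using X lam by (intro powr_mono2) auto
  finally have "4 * A \<le> \<epsilon> * X powr (lam / (1 - lam))" using \<epsilon> by (simp add: field_simps)
  then have "4 * A * X \<le> \<epsilon> * X powr (lam / (1 - lam)) * X" using X by (intro mult_right_mono) auto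
  also have "\<dots> = \<epsilon> * X powr (lam / (1 - lam) + 1)" using X by (simp add: powr_add)
  also have "lam / (1 - lam) + 1 = 1 / (1 - lam)" using lam by (simp add: field_simps)
  finally show ?thesis using True by simp
next
  case False
  have "A \<le> A * X" using A X by simp
  then have "U \<le> 2 * (A * \<eta> * X * U powr lam)" using U(2) False by linarith
  also have "2 * (A * \<eta> * X * U powr lam) = (\<epsilon> powr (1 - lam) * X) * U powr lam" using A by (simp add: \<eta>)
  finally have "U \<le> (\<epsilon> powr (1 - lam) * X) * U powr lam" .
  moreover have "U = U powr (1 - lam) * U powr lam" using U(1) by (simp flip: powr_add)
  ultimately have "U powr (1 - lam) * U powr lam \<le> (\<epsilon> powr (1 - lam) * X) * U powr lam" by simp
  then have "U powr (1 - lam) \<le> \<epsilon> powr (1 - lam) * X" using U(1) by simp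
  then have "(U powr (1 - lam)) powr (1 / (1 - lam)) \<le> (\<epsilon> powr (1 - lam) * X) powr (1 / (1 - lam))"
    using lam by (intro powr_mono2) auto
  then show ?thesis using U(1) \<epsilon> X lam by (simp add: powr_powr powr_mult)
qed

theorem theorem1p9:
  fixes m :: nat and f :: "real \<Rightarrow> real" and lam :: real
    and u :: "'a::euclidean_space \<Rightarrow> real"
  assumes m_odd: "odd m" and m_ge: "m \<ge> 3"
    and dim: "DIM('a) = 2 * m"
    and f_cont: "continuous_on {0..} f"
    and f_nonneg: "\<forall>t\<ge>0. f t \<ge> 0"
    and f_growth: "(\<lambda>t. ln (1 + f t)) \<in> O[at_top](\<lambda>t. t powr lam)"
    and lam_bounds: "0 < lam" "lam < 1"
    and u_smooth: "Ck_on (2 * m) (ball 0 2 - {0}) u"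
    and u_nonneg: "\<forall>x\<in>ball 0 2 - {0}. u x \<ge> 0"
    and u_ineq: "\<forall>x\<in>ball 0 2 - {0}.
                   0 \<le> - ((laplacian ^^ m) u x) \<and> - ((laplacian ^^ m) u x) \<le> f (u x)"
  shows "u \<in> o[at 0](\<lambda>x. norm x powr (- (real (2 * m) - 2) / (1 - lam)))"
proof -
  define S where "S = (ball 0 2 - {0} :: 'a set)"
  have S: "open S" by (simp add: S_def open_delete)
  have m2: "m \<ge> 2" and m1: "m \<ge> 1" using m_ge by auto
  define g where "g = (\<lambda>x. - (laplacian ^^ m) u x)"
  have g0: "g x \<ge> 0" and gf: "g x \<le> f (u x)" and u0: "u x \<ge> 0" if "x \<in> S" for x
    using u_ineq u_nonneg that by (auto simp: g_def S_def)
  have "Ck_on 0 S ((laplacian ^^ m) u)"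
    using u_smooth by (intro Ck_on_iter_laplacian S) (simp add: S_def)
  then have cg: "continuous_on S g" unfolding g_def by (auto simp: Ck_on_0 intro: continuous_intros)
  have cu: "continuous_on S u" using Ck_on_continuous[OF u_smooth] by (simp add: S_def)
  have super: "(laplacian ^^ m) u x \<le> 0" if "x \<in> S" for x using g0[OF that] by (simp add: g_def)
  obtain C1 where C1:
    "\<And>a. 0 < a \<Longrightarrow> (LINT x:{x. a \<le> x \<bullet> x \<and> x \<bullet> x \<le> 1/2}|lborel. (x \<bullet> x) ^ (m - 1) * - (laplacian ^^ m) u x) \<le> C1"
    "\<And>\<epsilon>. 0 < \<epsilon> \<Longrightarrow> \<epsilon> \<le> 1/25 \<Longrightarrow> (LINT x:{x. 9 * \<epsilon> \<le> x \<bullet> x \<and> x \<bullet> x \<le> 25 * \<epsilon>}|lborel. u x) \<le> C1 * \<epsilon>"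
    using nonneg_superpolyharmonic_bounds[OF m2 dim u_smooth] u0 super unfolding S_def by blast
  obtain c C2 where c: "c > 0" and C2: "C2 \<ge> 0"
    and pot: "\<And>y R \<tau> G. 0 < \<tau> \<Longrightarrow> \<tau> \<le> R \<Longrightarrow> cball y R \<subseteq> S \<Longrightarrow>
       (\<And>x. x \<in> cball y \<tau> \<Longrightarrow> - (laplacian ^^ m) u x \<le> G) \<Longrightarrow>
       c * u y \<le> C2 / R ^ (2 * m) * (LINT x:cball y R|lborel. u x)
         + 2 * ln (R / \<tau>) * (LINT x:cball y R|lborel. - (laplacian ^^ m) u x) + C2 * G * \<tau> ^ (2 * m)"
    using log_potential_bound[OF m1 m_odd dim S u_smooth[folded S_def] u0 super] by blast
  obtain B where B: "B \<ge> 0" "\<And>t. t \<ge> 0 \<Longrightarrow> f t \<le> exp (B * (1 + t powr lam))"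
    by (fact exp_growth_bound[OF f_cont f_nonneg f_growth])
  \<comment> \<open>The summand 1 / \<lambda> comes from ln M \<le> M^\<lambda> / \<lambda>, and 2 B
    from the exponent B (1 + M^\<lambda>) with M \<ge> 1.\<close>
  define E where "E = 1 / lam + 2 * B"
  have E: "E > 0" using lam_bounds B by (simp add: E_def add_pos_nonneg)
  \<comment> \<open>Compensates the smallest value of |x|^(2m-2) on the annulus, attained at radius
    3r/4.\<close>
  define q where "q = (16 / 9 :: real) ^ (m - 1)"
  have q: "q > 0" by (simp add: q_def)
  \<comment> \<open>The power of 8 comes from R = r / 8, the divisor 16 from the scale r^2 / 16 in
    the mean bound for \<open>u\<close>.\<close>
  define C3 where "C3 = C2 * 8 ^ (2 * m) * C1 / 16"
  define A where "A = (max (max C3 0) (4 * E * q) + C2) / c"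
  have "4 * E * q > 0" using E q by simp
  then have A: "A > 0" "C3 \<le> A * c" "4 * E * q \<le> A * c" "C2 \<le> A * c"
    using c C2 by (auto simp: A_def max_def)
  \<comment> \<open>\<open>A\<close> depends on neither x0 nor \<eta>, so \<eta> can later be chosen
    in terms of \<open>A\<close> and \<epsilon>. The estimate concerns some U \<ge> u x0 because the
    selected point y replaces x0.\<close>
  have main: "\<exists>U\<ge>u x0. U \<le> A * X + A * \<eta> * X * U powr lam + A"
    if x0: "x0 \<noteq> 0" "norm x0 \<le> 1/2" and u1: "u x0 \<ge> 1" and X: "X = 1 / norm x0 ^ (2 * m - 2)"
      and \<eta>: "\<eta> \<ge> 0" "(LINT x:{x. 9/16 * (norm x0)\<^sup>2 \<le> x \<bullet> x \<and> x \<bullet> x \<le> 25/16 * (norm x0)\<^sup>2}|lborel. (x \<bullet> x) ^ (m - 1) * g x) \<le> \<eta>"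
    for x0 :: 'a and X \<eta>
  proof -
    define r where "r = norm x0"
    have r: "0 < r" "r \<le> 1/2" using x0 by (auto simp: r_def)
    \<comment> \<open>A ball of radius r/8 about a point within r/8 of x0 stays within r/4 of x0,
      hence between the radii 3r/4 and 5r/4.\<close>
    define R where "R = r / 8"
    have R: "0 < R" "R \<le> 1" using r by (auto simp: R_def)
    define N where "N = {x::'a. 9/16 * r\<^sup>2 \<le> x \<bullet> x \<and> x \<bullet> x \<le> 25/16 * r\<^sup>2}"
    have "r\<^sup>2 \<le> (1/2)\<^sup>2" using r by (intro power_mono) auto
    then have r2: "25/16 * r\<^sup>2 < 4" "0 < 9/16 * r\<^sup>2" "r\<^sup>2 \<le> 1/4" using r by (auto simp: power_divide)
    have N: "compact N" "N \<subseteq> S" unfolding N_def S_def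
      by (rule compact_annulus, rule annulus_subset_punctured_ball) (use r2 in auto)
    have inN: "x \<in> N" if "dist x0 x \<le> r / 4" for x
    proof -
      have "norm x \<le> norm x0 + dist x0 x" "norm x0 \<le> norm x + dist x0 x"
        using norm_triangle_sub[of x x0] norm_triangle_sub[of x0 x] by (auto simp: dist_norm norm_minus_commute)
      then have n: "3/4 * r \<le> norm x" "norm x \<le> 5/4 * r" using that by (auto simp: r_def)
      have "(3/4 * r)\<^sup>2 \<le> (norm x)\<^sup>2" "(norm x)\<^sup>2 \<le> (5/4 * r)\<^sup>2"
        using n r by (auto intro!: power_mono)
      then show ?thesis by (simp add: N_def power2_norm_eq_inner power_mult_distrib power_divide)
    qed
    have sub0: "cball x0 R \<subseteq> S" using inN N R by (force simp: R_def)
    obtain y d where y: "y \<in> cball x0 R" and d: "0 < d" "d \<le> R" and uy: "u y \<ge> u x0" and dU: "R \<le> d * u y"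
      and dbl: "\<And>z. z \<in> cball y (d / 2) \<Longrightarrow> z \<in> cball x0 R \<and> u z \<le> 2 * u y"
      using doubling_point[OF R(1) continuous_on_subset[OF cu sub0] _ u1] u0 sub0 by blast
    define U where "U = u y"
    have U: "U \<ge> 1" using uy u1 by (simp add: U_def)
    define M where "M = 2 * U"
    have M: "M \<ge> 1" using U by (simp add: M_def)
    define b where "b = B * (1 + M powr lam)"
    have b: "b \<ge> 0" using B by (simp add: b_def)
    \<comment> \<open>The bound d / 2 keeps u \<le> M on the ball of radius \<tau>, so that exp b
      bounds g there; the bound R exp (-b) makes the contribution of that ball at most a
      constant.\<close>
    define \<tau> where "\<tau> = min (d / 2) (R * exp (- b))"
    have \<tau>: "0 < \<tau>" "\<tau> \<le> d / 2" "\<tau> \<le> R * exp (- b)" "\<tau> \<le> R" using d R by (auto simp: \<tau>_def)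
    have subN: "cball y R \<subseteq> N"
    proof
      fix x assume "x \<in> cball y R"
      then have "dist x0 x \<le> r / 4" using y dist_triangle[of x0 x y] by (simp add: R_def)
      then show "x \<in> N" by (rule inN)
    qed
    have subS: "cball y R \<subseteq> S" using subN N by auto
    have G: "- (laplacian ^^ m) u z \<le> exp b" if "z \<in> cball y \<tau>" for z
    proof -
      have z: "z \<in> cball x0 R" "u z \<le> M" using dbl[of z] that \<tau>(2) by (auto simp: M_def U_def)
      then have zS: "z \<in> S" using sub0 by auto
      have "g z \<le> exp (B * (1 + u z powr lam))" using gf[OF zS] B(2)[OF u0[OF zS]] by linarith
      also have "\<dots> \<le> exp b"
        unfolding b_def using B(1) z(2) u0[OF zS] lam_bounds
        by (auto intro!: mult_left_mono powr_mono2)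
      finally show ?thesis by (simp add: g_def)
    qed
    have est: "c * U \<le> C2 / R ^ (2 * m) * (LINT x:cball y R|lborel. u x)
         + 2 * ln (R / \<tau>) * (LINT x:cball y R|lborel. g x) + C2 * exp b * \<tau> ^ (2 * m)"
      using pot[OF \<tau>(1,4) subS G] by (simp add: U_def g_def)
    have X0: "X > 0" using x0 by (simp add: X)
    have rX: "r ^ (2 * m) = r\<^sup>2 * (1 / X)"
    proof -
      have "2 * m = 2 + (2 * m - 2)" using m2 by simp
      then have "r ^ (2 * m) = r\<^sup>2 * r ^ (2 * m - 2)" by (metis power_add)
      then show ?thesis by (simp add: X r_def)
    qed
    have iN: "set_integrable lborel N u" "set_integrable lborel N g"
      by (intro set_integrable_compact N continuous_on_subset[OF cu N(2)] continuous_on_subset[OF cg N(2)])+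
    have iB: "set_integrable lborel (cball y R) u" "set_integrable lborel (cball y R) g"
      by (intro set_integrable_compact compact_cball continuous_on_subset[OF cu subS] continuous_on_subset[OF cg subS])+
    have t1: "C2 / R ^ (2 * m) * (LINT x:cball y R|lborel. u x) \<le> C3 * X"
    proof -
      have "(LINT x:cball y R|lborel. u x) \<le> (LINT x:N|lborel. u x)"
        by (rule set_integral_mono_subset[OF iB(1) iN(1) subN]) (use u0 N in auto)
      also have "\<dots> \<le> C1 * (r\<^sup>2 / 16)"
        using C1(2)[of "r\<^sup>2 / 16"] r r2(3) by (simp add: N_def)
      finally have "C2 / R ^ (2 * m) * (LINT x:cball y R|lborel. u x) \<le> C2 / R ^ (2 * m) * (C1 * (r\<^sup>2 / 16))"
        using C2 R by (intro mult_left_mono) auto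
      also have "\<dots> = C3 * X"
        using r X0 unfolding R_def power_divide rX by (simp add: C3_def)
      finally show ?thesis .
    qed
    have t2: "(LINT x:cball y R|lborel. g x) \<le> q * \<eta> * X"
    proof -
      have low: "(9/16) ^ (m - 1) * (1 / X) * g x \<le> (x \<bullet> x) ^ (m - 1) * g x" if "x \<in> N" for x
      proof -
        have "(9/16 * r\<^sup>2) ^ (m - 1) \<le> (x \<bullet> x) ^ (m - 1)" using that r2(2) by (intro power_mono) (auto simp: N_def)
        moreover have "(9/16 * r\<^sup>2) ^ (m - 1) = (9/16) ^ (m - 1) * (1 / X)"
        proof -
          have "(r\<^sup>2) ^ (m - 1) = r ^ (2 * m - 2)" by (simp add: right_diff_distrib' flip: power_mult)
          then show ?thesis by (simp only: power_mult_distrib X r_def div_by_1 divide_divide_eq_right mult_1)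
        qed
        ultimately show ?thesis using g0 that N by (intro mult_right_mono) auto
      qed
      have "(LINT x:cball y R|lborel. (9/16) ^ (m - 1) * (1 / X) * g x) \<le> (LINT x:N|lborel. (x \<bullet> x) ^ (m - 1) * g x)"
      proof (rule set_integral_mono_subset[OF _ _ subN])
        show "set_integrable lborel (cball y R) (\<lambda>x. (9/16) ^ (m - 1) * (1 / X) * g x)"
          by (intro set_integrable_compact compact_cball continuous_on_mult_left continuous_on_subset[OF cg subS])
        show "set_integrable lborel N (\<lambda>x. (x \<bullet> x) ^ (m - 1) * g x)"
          by (intro set_integrable_compact N continuous_intros continuous_on_subset[OF cg N(2)])
      qed (use low subN g0 N in auto)
      also have "\<dots> \<le> \<eta>" using \<eta>(2) by (simp only: N_def r_def)
      finally have "(9/16) ^ (m - 1) * (1 / X) * (LINT x:cball y R|lborel. g x) \<le> \<eta>" by simp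
      then have le: "q * X * ((9/16) ^ (m - 1) * (1 / X) * (LINT x:cball y R|lborel. g x)) \<le> q * X * \<eta>"
        using q X0 by (intro mult_left_mono) auto
      have "q * (9/16) ^ (m - 1) = 1" by (simp add: q_def flip: power_mult_distrib)
      then have cancel: "q * X * ((9/16) ^ (m - 1) * (1 / X) * I) = I" for I :: real
      proof -
        have "q * X * ((9/16) ^ (m - 1) * (1 / X) * I) = (q * (9/16) ^ (m - 1)) * (X * (1 / X)) * I"
          by (simp only: mult_ac)
        also have "\<dots> = I" using X0 \<open>q * (9/16) ^ (m - 1) = 1\<close> by simp
        finally show ?thesis .
      qed
      show ?thesis using le unfolding cancel by (simp only: mult_ac)
    qed
    have Mp: "M powr lam \<ge> 1" using M lam_bounds by (simp add: ge_one_powr_ge_zero)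
    have lnR: "ln (R / \<tau>) \<le> E * M powr lam"
    proof -
      \<comment> \<open>If d / 2 is the minimum, R \<le> d U gives R / \<tau> \<le> 2 U = M;
        otherwise R / \<tau> = exp b. Thus ln (R / \<tau>) is of order at most M^\<lambda>, although
        \<tau> may be exponentially small.\<close>
      have "R / \<tau> \<le> M * exp b"
      proof (cases "d / 2 \<le> R * exp (- b)")
        case True
        then have "R / \<tau> = 2 * R / d" by (simp add: \<tau>_def)
        also have "\<dots> \<le> M" using dU d by (simp add: M_def U_def field_simps)
        also have "\<dots> \<le> M * exp b" using M b by simp
        finally show ?thesis .
      next
        case False
        then have "R / \<tau> = exp b" using R by (simp add: \<tau>_def exp_minus inverse_eq_divide)
        also have "\<dots> \<le> M * exp b" using M by simp
        finally show ?thesis .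
      qed
      moreover have "0 < R / \<tau>" using R \<tau> by simp
      ultimately have "ln (R / \<tau>) \<le> ln (M * exp b)" using M by (subst ln_le_cancel_iff) auto
      also have "\<dots> = ln M + b" using M by (simp add: ln_mult)
      also have "ln M \<le> M powr lam / lam" using M lam_bounds by (intro ln_powr_bound) auto
      also have "b \<le> 2 * B * M powr lam"
        using mult_left_mono[OF Mp B(1)] by (simp add: b_def algebra_simps)
      finally show ?thesis by (simp add: E_def algebra_simps)
    qed
    have MU: "M powr lam \<le> 2 * U powr lam"
    proof -
      have "2 powr lam \<le> 2 powr 1" using lam_bounds by (intro powr_mono) auto
      then show ?thesis using U by (simp add: M_def powr_mult mult_right_mono)
    qed
    have t3: "2 * ln (R / \<tau>) * (LINT x:cball y R|lborel. g x) \<le> 4 * E * q * (\<eta> * X * U powr lam)"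
    proof -
      have "ln (R / \<tau>) \<ge> 0" using \<tau> R by simp
      then have "2 * ln (R / \<tau>) * (LINT x:cball y R|lborel. g x) \<le> 2 * ln (R / \<tau>) * (q * \<eta> * X)"
        using t2 by (intro mult_left_mono) auto
      also have "\<dots> \<le> 2 * (E * (2 * U powr lam)) * (q * \<eta> * X)"
      proof (rule mult_right_mono)
        have "E * M powr lam \<le> E * (2 * U powr lam)" using MU E by (intro mult_left_mono) auto
        then show "2 * ln (R / \<tau>) \<le> 2 * (E * (2 * U powr lam))" using lnR by linarith
        show "0 \<le> q * \<eta> * X" using q \<eta>(1) X0 by simp
      qed
      finally show ?thesis by (simp add: mult_ac)
    qed
    have t4: "C2 * exp b * \<tau> ^ (2 * m) \<le> C2"
    proof -
      \<comment> \<open>Since \<tau> \<le> R \<le> 1, a single power of \<tau> is enough to cancel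
        exp b.\<close>
      have "\<tau> ^ (2 * m) \<le> \<tau> ^ 1" using \<tau> R m1 by (intro power_decreasing) auto
      then have "exp b * \<tau> ^ (2 * m) \<le> exp b * (R * exp (- b))" using \<tau>(3) by (intro mult_left_mono) auto
      also have "\<dots> = R" by (simp add: exp_minus)
      finally have "exp b * \<tau> ^ (2 * m) \<le> 1" using R by simp
      then show ?thesis using mult_left_mono[of "exp b * \<tau> ^ (2 * m)" 1 C2] C2 by (simp add: mult.assoc)
    qed
    have "c * U \<le> C3 * X + 4 * E * q * (\<eta> * X * U powr lam) + C2"
      using est t1 t3 t4 by linarith
    also have "\<dots> \<le> A * c * X + A * c * (\<eta> * X * U powr lam) + A * c"
      using A(2-4) X0 \<eta>(1) by (intro add_mono mult_right_mono) auto
    also have "\<dots> = c * (A * X + A * \<eta> * X * U powr lam + A)" by (simp add: algebra_simps)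
    finally have "U \<le> A * X + A * \<eta> * X * U powr lam + A" using c by simp
    then show ?thesis using uy by (auto simp: U_def)
  qed
  show ?thesis
  proof (rule landau_o.smallI)
    fix \<epsilon> :: real assume \<epsilon>: "\<epsilon> > 0"
    define \<eta> where "\<eta> = \<epsilon> powr (1 - lam) / (2 * A)"
    have \<eta>: "\<eta> > 0" using \<epsilon> A(1) by (simp add: \<eta>_def)
    have ch: "continuous_on (ball 0 2 - {0}) (\<lambda>x. (x \<bullet> x) ^ (m - 1) * g x)"
      using cg by (auto simp: S_def intro!: continuous_intros)
    have h0: "(x \<bullet> x) ^ (m - 1) * g x \<ge> 0" if "x \<in> ball 0 2 - {0}" for x :: 'a
      using g0[of x] that by (auto simp: S_def)
    have hC: "(LINT x:{x. a \<le> x \<bullet> x \<and> x \<bullet> x \<le> 1/2}|lborel. (x \<bullet> x) ^ (m - 1) * g x) \<le> C1" if "0 < a" for a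
      using C1(1)[OF that] by (simp only: g_def)
    obtain \<rho> where \<rho>: "\<rho> > 0"
      "\<And>a b. 0 < a \<Longrightarrow> b \<le> \<rho> \<Longrightarrow> (LINT x:{x::'a. a \<le> x \<bullet> x \<and> x \<bullet> x \<le> b}|lborel. (x \<bullet> x) ^ (m - 1) * g x) \<le> \<eta>"
      using integral_tail_vanishes[OF ch h0 hC \<eta>] by blast
    \<comment> \<open>The three requirements on X: being at least 1, making \<epsilon> X \<ge> 1 for
      points where u < 1, and reaching the threshold of \<open>sublinear_absorption\<close>.\<close>
    define X0 where "X0 = max 1 (max (1 / \<epsilon>) ((4 * A / \<epsilon>) powr ((1 - lam) / lam)))"
    \<comment> \<open>Below 1/2 the power defining X dominates 1 / |x|, so 1 / X0 yields X \<ge> X0;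
      together with \<rho> / 2 it also gives 25/16 |x|^2 \<le> \<rho>.\<close>
    define \<delta> where "\<delta> = min (1/2) (min (1 / X0) (\<rho> / 2))"
    have X01: "X0 \<ge> 1" by (simp add: X0_def)
    have \<delta>: "\<delta> > 0" "\<delta> \<le> 1/2" "\<delta> \<le> 1 / X0" "\<delta> \<le> \<rho> / 2" using \<rho>(1) X01 by (auto simp: \<delta>_def)
    have "norm (u x) \<le> \<epsilon> * norm (norm x powr (- (real (2 * m) - 2) / (1 - lam)))"
      if x: "x \<noteq> 0" "dist x 0 < \<delta>" for x
    proof -
      have nx: "0 < norm x" "norm x < \<delta>" "norm x \<le> 1/2" using x \<delta> by auto
      have xS: "x \<in> S" using nx by (auto simp: S_def)
      define X where "X = 1 / norm x ^ (2 * m - 2)"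
      have XX0: "X \<ge> X0"
      proof -
        have "norm x ^ (2 * m - 2) \<le> norm x ^ 1" using nx m2 by (intro power_decreasing) auto
        then have "1 / norm x \<le> X" unfolding X_def using nx by (intro divide_left_mono) auto
        moreover have "X0 \<le> 1 / norm x"
        proof -
          have "X0 * norm x \<le> X0 * (1 / X0)" using nx(2) \<delta>(3) X01 by (intro mult_left_mono) auto
          then show ?thesis using nx(1) X01 by (simp add: field_simps)
        qed
        ultimately show ?thesis by linarith
      qed
      then have X: "X \<ge> 1" "X \<ge> 1 / \<epsilon>" "X \<ge> (4 * A / \<epsilon>) powr ((1 - lam) / lam)" by (auto simp: X0_def)
      have Xp: "X powr (1 / (1 - lam)) = norm x powr (- (real (2 * m) - 2) / (1 - lam))"
      proof -
        have "X = norm x powr (- (real (2 * m) - 2))"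
        proof -
          have "real (2 * m) - 2 = real (2 * m - 2)" using m2 by simp
          then show ?thesis using nx(1) by (simp only: X_def powr_minus_divide powr_realpow)
        qed
        then show ?thesis by (simp add: powr_powr)
      qed
      have "u x \<le> \<epsilon> * X powr (1 / (1 - lam))"
      \<comment> \<open>Selecting the point y requires u x \<ge> 1; smaller values lie below the
        claimed bound already.\<close>
      proof (cases "u x \<ge> 1")
        case False
        have 1: "1 \<le> \<epsilon> * X" using X(2) \<epsilon> by (simp add: field_simps)
        have "X powr 1 \<le> X powr (1 / (1 - lam))" using X(1) lam_bounds by (intro powr_mono) auto
        then have "\<epsilon> * X \<le> \<epsilon> * X powr (1 / (1 - lam))" using X(1) \<epsilon> by simp
        then show ?thesis using False 1 by simp
      next
        case True
        have "25/16 * (norm x)\<^sup>2 \<le> \<rho>"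
        proof -
          have "(norm x)\<^sup>2 \<le> norm x * (1/2)" unfolding power2_eq_square using nx by (intro mult_left_mono) auto
          then show ?thesis using nx \<delta>(4) \<rho>(1) by simp
        qed
        then have "(LINT z:{z. 9/16 * (norm x)\<^sup>2 \<le> z \<bullet> z \<and> z \<bullet> z \<le> 25/16 * (norm x)\<^sup>2}|lborel. (z \<bullet> z) ^ (m - 1) * g z) \<le> \<eta>"
          using nx by (intro \<rho>(2)) auto
        from main[OF x(1) nx(3) True X_def less_imp_le[OF \<eta>] this] obtain U where
          U: "U \<ge> u x" "U \<le> A * X + A * \<eta> * X * U powr lam + A" by blast
        have "U \<le> \<epsilon> * X powr (1 / (1 - lam))"
          using sublinear_absorption[OF lam_bounds A(1) \<epsilon> \<eta>_def X(1,3) _ U(2)] U(1) True by simp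
        then show ?thesis using U(1) by simp
      qed
      then show ?thesis using u0[OF xS] by (simp add: Xp)
    qed
    then show "\<forall>\<^sub>F x in at 0. norm (u x) \<le> \<epsilon> * norm (norm x powr (- (real (2 * m) - 2) / (1 - lam)))"
      unfolding eventually_at using \<delta>(1) by blast
  qed
qed

end
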